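(* Each of the sixteen $\square_q$-modules $(\mathbb V/J)_{\rm I}$, $(\mathbb V/J)_{\rm IS}$, $(\mathbb V/J)_{\rm IT}$, $(\mathbb V/J)_{\rm IST}$, $(\mathbb V/J)_{\rm II}$, $(\mathbb V/J)_{\rm IIS}$, $(\mathbb V/J)_{\rm IIT}$, $(\mathbb V/J)_{\rm IIST}$, $U_{\rm III}$, $U_{\rm IIIS}$, $U_{\rm IIIT}$, $U_{\rm IIIST}$, $U_{\rm IV}$, $U_{\rm IVS}$, $U_{\rm IVT}$, $U_{\rm IVST}$ is irreducible.
   Context: Throughout, $\mathbb F$ is a field and $q\in\mathbb F$ is nonzero and not a root of unity. All vector spaces and algebras are over $\mathbb F$; algebras are associative with multiplicative identity. $[3]_q=(q^3-q^{-3})/(q-q^{-1})$ and $Q=1-q^2$. The algebra $\square_q$ is defined by generators $\{x_i\}_{i\in\mathbb Z_4}$ ($\mathbb Z_4=\mathbb Z/4\mathbb Z$) and relations, for $i\in\mathbb Z_4$: $\frac{q x_ix_{i+1}-q^{-1}x_{i+1}x_i}{q-q^{-1}}=1$ and $x_i^3x_{i+2}-[3]_q x_i^2x_{i+2}x_i+[3]_q x_ix_{i+2}x_i^2-x_{i+2}x_i^3=0$. Let $\mathbb V$ be the free algebra on two generators $A,B$. A word of length $n$ is a product $v_1v_2\cdots v_n$ with each $v_i\in\{A,B\}$ (the word of length $0$ is $1$); the words form the standard basis of $\mathbb V$. Let $(\,,\,)$ be the bilinear form on $\mathbb V$ for which the words are orthonormal. ${\rm End}(\mathbb V)$ is the algebra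 of $\mathbb F$-linear maps $\mathbb V\to\mathbb V$ whose matrix with respect to the standard basis has finitely many nonzero entries in each row; each $X\in{\rm End}(\mathbb V)$ has a unique adjoint $X^*\in{\rm End}(\mathbb V)$ with $(Xu,v)=(u,X^*v)$ for all $u,v\in\mathbb V$. $K$ is the automorphism of the free algebra $\mathbb V$ with $A\mapsto q^2A$, $B\mapsto q^{-2}B$. Define $A_L(v)=Av$, $B_L(v)=Bv$, $A_R(v)=vA$, $B_R(v)=vB$ for $v\in\mathbb V$. Put $\langle A,A\rangle=\langle B,B\rangle=2$, $\langle A,B\rangle=\langle B,A\rangle=-2$. The $q$-shuffle product $\star$ is the associative bilinear product on $\mathbb V$ with $1\star v=v\star1=v$ and, recursively for nontrivial words $u=u_1\cdots u_r$, $v=v_1\cdots v_s$, $u\star v=u_1\bigl((u_2\cdots u_r)\star v\bigr)+v_1\bigl(u\star(v_2\cdots v_s)\bigr)q^{\langle u_1,v_1\rangle+\langle u_2,v_1\rangle+\cdots+\langle u_r,v_1\rangle}$. Define $A_\ell(v)=A\star v$, $B_\ell(v)=B\star v$, $A_r(v)=v\star A$, $B_r(v)=v\star B$ for $v\in\mathbb V$. $J$ is the 2-sided ideal of the free algebra $\mathbb V$ generated by $A^3B-[3]_qA^2BA+[3]_qABA^2-BA^3$ and $B^3A-[3]_qB^2AB+[3]_qBAB^2-AB^3$. It is invariant under $K^{\pm1},A_L,B_L,A_R,B_R,A^*_\ell,B^*_\ell,A^*_r,B^*_r$, so these maps act on $\mathbb V/J$. $U$ is the subalgebra of the $q$-shuffle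 algebra $(\mathbb V,\star)$ generated by $A,B$. It is invariant under $K^{\pm1},A_\ell,B_\ell,A_r,B_r,A^*_L,B^*_L,A^*_R,B^*_R$, so these maps act on $U$. The $\square_q$-modules are as follows ($x_0,x_1,x_2,x_3$ act respectively as the listed maps). On $\mathbb V/J$: I: $A_L,\ Q(A^*_\ell-B^*_rK),\ B_L,\ Q(B^*_\ell-A^*_rK^{-1})$. IS: $A_R,\ Q(A^*_r-B^*_\ell K),\ B_R,\ Q(B^*_r-A^*_\ell K^{-1})$. IT: $B_L,\ Q(B^*_\ell-A^*_rK^{-1}),\ A_L,\ Q(A^*_\ell-B^*_rK)$. IST: $B_R,\ Q(B^*_r-A^*_\ell K^{-1}),\ A_R,\ Q(A^*_r-B^*_\ell K)$. II: $Q(A_L-KB_R),\ A^*_\ell,\ Q(B_L-K^{-1}A_R),\ B^*_\ell$. IIS: $Q(A_R-KB_L),\ A^*_r,\ Q(B_R-K^{-1}A_L),\ B^*_r$. IIT: $Q(B_L-K^{-1}A_R),\ B^*_\ell,\ Q(A_L-KB_R),\ A^*_\ell$. IIST: $Q(B_R-K^{-1}A_L),\ B^*_r,\ Q(A_R-KB_L),\ A^*_r$. On $U$: III: $A_\ell,\ Q(A^*_L-B^*_RK),\ B_\ell,\ Q(B^*_L-A^*_RK^{-1})$. IIIS: $A_r,\ Q(A^*_R-B^*_LK),\ B_r,\ Q(B^*_R-A^*_LK^{-1})$. IIIT: $B_\ell,\ Q(B^*_L-A^*_RK^{-1}),\ A_\ell,\ Q(A^*_L-B^*_RK)$. IIIST: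 $B_r,\ Q(B^*_R-A^*_LK^{-1}),\ A_r,\ Q(A^*_R-B^*_LK)$. IV: $Q(A_\ell-KB_r),\ A^*_L,\ Q(B_\ell-K^{-1}A_r),\ B^*_L$. IVS: $Q(A_r-KB_\ell),\ A^*_R,\ Q(B_r-K^{-1}A_\ell),\ B^*_R$. IVT: $Q(B_\ell-K^{-1}A_r),\ B^*_L,\ Q(A_\ell-KB_r),\ A^*_L$. IVST: $Q(B_r-K^{-1}A_\ell),\ B^*_R,\ Q(A_r-KB_\ell),\ A^*_R$. The module with label I is denoted $(\mathbb V/J)_{\rm I}$, the one with label III is denoted $U_{\rm III}$, and so on. *)

theory Defs
  imports
    HOL.Hull
    "HOL-Library.Poly_Mapping"
    "HOL-Library.Numeral_Type"
    "HOL-Algebra.Module"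
    "HOL-Algebra.QuotRing"
begin

section \<open>Free algebras\<close>

text \<open>
  Words form the free monoid under concatenation. With this instance,
  \<^typ>\<open>'x list \<Rightarrow>\<^sub>0 'f\<close> carries the convolution product of the monoid algebra, so it is the
  free algebra on the generators \<^typ>\<open>'x\<close>, and the words \<open>Poly_Mapping.single w 1\<close> are its
  standard basis.
\<close>

instantiation list :: (type) monoid_add
begin

definition zero_list :: "'a list" where "zero_list = []"

definition plus_list :: "'a list \<Rightarrow> 'a list \<Rightarrow> 'a list" where "plus_list = (@)"

instance
  by standard (simp_all add: zero_list_def plus_list_def)

end

definition wd :: "'x list \<Rightarrow> 'x list \<Rightarrow>\<^sub>0 'f::field" where
  "wd w = Poly_Mapping.single w 1"

definition gen :: "'x \<Rightarrow> 'x list \<Rightarrow>\<^sub>0 'f::field" where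
  "gen x = wd [x]"

definition sm :: "'f::field \<Rightarrow> ('b \<Rightarrow>\<^sub>0 'f) \<Rightarrow> 'b \<Rightarrow>\<^sub>0 'f" where
  "sm c v = Poly_Mapping.map ((*) c) v"

definition lin_ext :: "('b \<Rightarrow> 'c \<Rightarrow>\<^sub>0 'f::field) \<Rightarrow> ('b \<Rightarrow>\<^sub>0 'f) \<Rightarrow> 'c \<Rightarrow>\<^sub>0 'f" where
  "lin_ext f v = (\<Sum>w\<in>Poly_Mapping.keys v. sm (Poly_Mapping.lookup v w) (f w))"

definition scalars :: "'f::field ring" where
  "scalars = \<lparr>carrier = UNIV, mult = (*), one = 1, zero = 0, add = (+)\<rparr>"

definition free_algebra :: "('f::field, 'x list \<Rightarrow>\<^sub>0 'f) module" where
  "free_algebra =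
    \<lparr>carrier = UNIV, mult = (*), one = 1, zero = 0, add = (+), smult = sm\<rparr>"

text \<open>
  The quotient of the free algebra by a two-sided ideal: the library's quotient ring, with the
  scalar multiplication \<open>c (I + v) = I + c v\<close>. The union of the cosets \<open>I + c v\<close> over all
  representatives \<open>v\<close> is that single coset.
\<close>

definition quot_algebra ::
    "('x list \<Rightarrow>\<^sub>0 'f) set \<Rightarrow> ('f::field, ('x list \<Rightarrow>\<^sub>0 'f) set) module" where
  "quot_algebra I = ring.extend (free_algebra Quot I)
     (module.fields (\<lambda>c X. \<Union>v\<in>X. I +>\<^bsub>free_algebra\<^esub> sm c v))"

text \<open>
  For a linear map \<open>f\<close> with \<open>f ` I \<subseteq> I\<close>, the map \<open>I + v \<mapsto> I + f v\<close> on the quotient.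
\<close>

definition quot_map ::
    "('x list \<Rightarrow>\<^sub>0 'f) set \<Rightarrow> (('x list \<Rightarrow>\<^sub>0 'f) \<Rightarrow> ('x list \<Rightarrow>\<^sub>0 'f))
      \<Rightarrow> ('x list \<Rightarrow>\<^sub>0 'f::field) set \<Rightarrow> ('x list \<Rightarrow>\<^sub>0 'f) set" where
  "quot_map I f X = (\<Union>v\<in>X. I +>\<^bsub>free_algebra\<^esub> f v)"


section \<open>Modules over an associative algebra\<close>

locale algebra_module = module R W
  for R :: "('k, 'r) ring_scheme" and W :: "('k, 'w, 'm) module_scheme" (structure) +
  fixes S :: "('k, 's, 'n) module_scheme"
    and act :: "'s \<Rightarrow> 'w \<Rightarrow> 'w"
  assumes act_closed: "\<lbrakk>a \<in> carrier S; w \<in> carrier W\<rbrakk> \<Longrightarrow> act a w \<in> carrier W"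
    and act_add_right: "\<lbrakk>a \<in> carrier S; v \<in> carrier W; w \<in> carrier W\<rbrakk>
      \<Longrightarrow> act a (v \<oplus>\<^bsub>W\<^esub> w) = act a v \<oplus>\<^bsub>W\<^esub> act a w"
    and act_smult_right: "\<lbrakk>c \<in> carrier R; a \<in> carrier S; w \<in> carrier W\<rbrakk>
      \<Longrightarrow> act a (c \<odot>\<^bsub>W\<^esub> w) = c \<odot>\<^bsub>W\<^esub> act a w"
    and act_add_left: "\<lbrakk>a \<in> carrier S; b \<in> carrier S; w \<in> carrier W\<rbrakk>
      \<Longrightarrow> act (a \<oplus>\<^bsub>S\<^esub> b) w = act a w \<oplus>\<^bsub>W\<^esub> act b w"
    and act_smult_left: "\<lbrakk>c \<in> carrier R; a \<in> carrier S; w \<in> carrier W\<rbrakk>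
      \<Longrightarrow> act (c \<odot>\<^bsub>S\<^esub> a) w = c \<odot>\<^bsub>W\<^esub> act a w"
    and act_mult: "\<lbrakk>a \<in> carrier S; b \<in> carrier S; w \<in> carrier W\<rbrakk>
      \<Longrightarrow> act (a \<otimes>\<^bsub>S\<^esub> b) w = act a (act b w)"
    and act_one: "w \<in> carrier W \<Longrightarrow> act \<one>\<^bsub>S\<^esub> w = w"

definition irreducible_algebra_module ::
    "('k, 'r) ring_scheme \<Rightarrow> ('k, 'w, 'm) module_scheme \<Rightarrow> ('k, 's, 'n) module_scheme
      \<Rightarrow> ('s \<Rightarrow> 'w \<Rightarrow> 'w) \<Rightarrow> bool" where
  "irreducible_algebra_module R W S act \<longleftrightarrow>
     algebra_module R W S act \<and> carrier W \<noteq> {\<zero>\<^bsub>W\<^esub>} \<and>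
     (\<forall>N. submodule N R W \<and> (\<forall>a\<in>carrier S. \<forall>w\<in>N. act a w \<in> N)
        \<longrightarrow> N = {\<zero>\<^bsub>W\<^esub>} \<or> N = carrier W)"


section \<open>The algebra \<open>\<square>\<^sub>q\<close>\<close>

definition q3 :: "'f::field \<Rightarrow> 'f" where
  "q3 q = (q^3 - inverse q^3) / (q - inverse q)"

definition serre :: "'f::field \<Rightarrow> 'x \<Rightarrow> 'x \<Rightarrow> 'x list \<Rightarrow>\<^sub>0 'f" where
  "serre q x y = gen x^3 * gen y - sm (q3 q) (gen x^2 * gen y * gen x)
     + sm (q3 q) (gen x * gen y * gen x^2) - gen y * gen x^3"

text \<open>\<^typ>\<open>4\<close> is the ring of integers modulo 4, so the indices are cyclic.\<close>

definition box_ideal :: "'f::field \<Rightarrow> (4 list \<Rightarrow>\<^sub>0 'f) set" where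
  "box_ideal q = Idl\<^bsub>free_algebra\<^esub>
     (\<Union>i. {sm (1 / (q - inverse q))
              (sm q (gen i * gen (i + 1)) - sm (inverse q) (gen (i + 1) * gen i)) - 1,
            serre q i (i + 2)})"

definition box :: "'f::field \<Rightarrow> ('f, (4 list \<Rightarrow>\<^sub>0 'f) set) module" where
  "box q = quot_algebra (box_ideal q)"

definition box_gen :: "'f::field \<Rightarrow> 4 \<Rightarrow> (4 list \<Rightarrow>\<^sub>0 'f) set" where
  "box_gen q i = box_ideal q +>\<^bsub>free_algebra\<^esub> gen i"

definition box_action ::
    "'f::field \<Rightarrow> ('f, 'w) module \<Rightarrow> (4 \<Rightarrow> 'w \<Rightarrow> 'w)
      \<Rightarrow> ((4 list \<Rightarrow>\<^sub>0 'f) set \<Rightarrow> 'w \<Rightarrow> 'w) \<Rightarrow> bool" where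
  "box_action q W T act \<longleftrightarrow>
     algebra_module scalars W (box q) act \<and>
     (\<forall>i. \<forall>w\<in>carrier W. act (box_gen q i) w = T i w)"

text \<open>
  The vector space \<open>W\<close> is a \<open>\<square>\<^sub>q\<close>-module on which each generator \<open>x\<^sub>i\<close> acts as \<open>T i\<close>, and this
  module is irreducible. The action is determined by the \<open>T i\<close> (on the carriers), so the
  two conjuncts are its existence and its irreducibility.
\<close>

definition irreducible_box_module ::
    "'f::field \<Rightarrow> ('f, 'w) module \<Rightarrow> (4 \<Rightarrow> 'w \<Rightarrow> 'w) \<Rightarrow> bool" where
  "irreducible_box_module q W T \<longleftrightarrow>
     (\<exists>act. box_action q W T act) \<and>
     (\<forall>act. box_action q W T act \<longrightarrow> irreducible_algebra_module scalars W (box q) act)"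


section \<open>The free algebra \<open>\<V>\<close> on two generators and its maps\<close>

datatype letter = LA | LB

type_synonym 'f V = "letter list \<Rightarrow>\<^sub>0 'f"

definition bil :: "'f::field V \<Rightarrow> 'f V \<Rightarrow> 'f" where
  "bil u v = (\<Sum>w\<in>Poly_Mapping.keys u. Poly_Mapping.lookup u w * Poly_Mapping.lookup v w)"

text \<open>
  The entry in row \<open>w\<close> and column \<open>w'\<close> of the matrix of \<open>X\<close> is the coefficient of \<open>w\<close> in \<open>X w'\<close>.
\<close>

definition EndV :: "('f::field V \<Rightarrow> 'f V) set" where
  "EndV = {X. (\<forall>u v. X (u + v) = X u + X v) \<and> (\<forall>c v. X (sm c v) = sm c (X v)) \<and>
     (\<forall>w. finite {w'. Poly_Mapping.lookup (X (wd w')) w \<noteq> 0})}"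

definition adj :: "('f::field V \<Rightarrow> 'f V) \<Rightarrow> 'f V \<Rightarrow> 'f V" where
  "adj X = (THE Y. Y \<in> EndV \<and> (\<forall>u v. bil (X u) v = bil u (Y v)))"

text \<open>The algebra endomorphism extending the given values on \<open>A\<close> and \<open>B\<close>; it is bijective.\<close>

definition K :: "'f::field \<Rightarrow> 'f V \<Rightarrow> 'f V" where
  "K q = lin_ext (\<lambda>w. prod_list (map
     (\<lambda>x. case x of LA \<Rightarrow> sm (q^2) (gen LA) | LB \<Rightarrow> sm (inverse q^2) (gen LB)) w))"

definition Kinv :: "'f::field \<Rightarrow> 'f V \<Rightarrow> 'f V" where
  "Kinv q = inv_into UNIV (K q)"

definition pairing :: "letter \<Rightarrow> letter \<Rightarrow> int" where
  "pairing x y = (if x = y then 2 else - 2)"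

fun shuffle_words :: "'f::field \<Rightarrow> letter list \<Rightarrow> letter list \<Rightarrow> 'f V" where
  "shuffle_words q [] v = wd v"
| "shuffle_words q u [] = wd u"
| "shuffle_words q (x # u) (y # v) =
     gen x * shuffle_words q u (y # v)
     + sm (q powi (\<Sum>z\<leftarrow>x # u. pairing z y)) (gen y * shuffle_words q (x # u) v)"

definition star :: "'f::field \<Rightarrow> 'f V \<Rightarrow> 'f V \<Rightarrow> 'f V" where
  "star q u v = lin_ext (\<lambda>a. lin_ext (\<lambda>b. shuffle_words q a b) v) u"

definition A_L :: "'f::field V \<Rightarrow> 'f V" where "A_L v = gen LA * v"
definition B_L :: "'f::field V \<Rightarrow> 'f V" where "B_L v = gen LB * v"
definition A_R :: "'f::field V \<Rightarrow> 'f V" where "A_R v = v * gen LA"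
definition B_R :: "'f::field V \<Rightarrow> 'f V" where "B_R v = v * gen LB"

text \<open>Lower-case subscripts denote multiplication for the \<open>q\<close>-shuffle product.\<close>

definition A_l :: "'f::field \<Rightarrow> 'f V \<Rightarrow> 'f V" where "A_l q v = star q (gen LA) v"
definition B_l :: "'f::field \<Rightarrow> 'f V \<Rightarrow> 'f V" where "B_l q v = star q (gen LB) v"
definition A_r :: "'f::field \<Rightarrow> 'f V \<Rightarrow> 'f V" where "A_r q v = star q v (gen LA)"
definition B_r :: "'f::field \<Rightarrow> 'f V \<Rightarrow> 'f V" where "B_r q v = star q v (gen LB)"

text \<open>The map \<open>Q (X - Y)\<close> with \<open>Q = 1 - q\<^sup>2\<close>.\<close>

definition Qdiff ::
    "'f::field \<Rightarrow> ('f V \<Rightarrow> 'f V) \<Rightarrow> ('f V \<Rightarrow> 'f V) \<Rightarrow> 'f V \<Rightarrow> 'f V" where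
  "Qdiff q X Y v = sm (1 - q^2) (X v - Y v)"


section \<open>The vector spaces \<open>\<V>/J\<close> and \<open>U\<close>\<close>

definition J :: "'f::field \<Rightarrow> 'f V set" where
  "J q = Idl\<^bsub>free_algebra\<^esub> {serre q LA LB, serre q LB LA}"

definition VJ :: "'f::field \<Rightarrow> ('f, 'f V set) module" where
  "VJ q = quot_algebra (J q)"

definition shuffle_subalgebra :: "'f::field \<Rightarrow> 'f V set \<Rightarrow> bool" where
  "shuffle_subalgebra q S \<longleftrightarrow> 1 \<in> S \<and> (\<forall>u\<in>S. \<forall>v\<in>S. u + v \<in> S) \<and>
     (\<forall>c. \<forall>v\<in>S. sm c v \<in> S) \<and> (\<forall>u\<in>S. \<forall>v\<in>S. star q u v \<in> S)"

definition U :: "'f::field \<Rightarrow> ('f, 'f V) module" where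
  "U q = \<lparr>carrier = shuffle_subalgebra q hull {gen LA, gen LB},
     mult = star q, one = 1, zero = 0, add = (+), smult = sm\<rparr>"

definition quad :: "'a \<Rightarrow> 'a \<Rightarrow> 'a \<Rightarrow> 'a \<Rightarrow> 4 \<Rightarrow> 'a" where
  "quad t0 t1 t2 t3 i = (if i = 0 then t0 else if i = 1 then t1 else if i = 2 then t2 else t3)"

definition irreducible_VJ ::
    "'f::field \<Rightarrow> ('f V \<Rightarrow> 'f V) \<Rightarrow> ('f V \<Rightarrow> 'f V) \<Rightarrow> ('f V \<Rightarrow> 'f V) \<Rightarrow> ('f V \<Rightarrow> 'f V) \<Rightarrow> bool" where
  "irreducible_VJ q t0 t1 t2 t3 \<longleftrightarrow>
     irreducible_box_module q (VJ q) (\<lambda>i. quot_map (J q) (quad t0 t1 t2 t3 i))"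

definition irreducible_U ::
    "'f::field \<Rightarrow> ('f V \<Rightarrow> 'f V) \<Rightarrow> ('f V \<Rightarrow> 'f V) \<Rightarrow> ('f V \<Rightarrow> 'f V) \<Rightarrow> ('f V \<Rightarrow> 'f V) \<Rightarrow> bool" where
  "irreducible_U q t0 t1 t2 t3 \<longleftrightarrow> irreducible_box_module q (U q) (quad t0 t1 t2 t3)"

end

theory Submission
  imports Defs HOL.Vector_Spaces
begin

text \<open>
  Let \<open>\<phi>\<close> be the homomorphism from the free algebra to the q-shuffle algebra that fixes \<open>A\<close> and
  \<open>B\<close>; its image is \<open>U\<close>. It turns concatenations into shuffle products and skew derivations into
  deletions of letters. The main point is that its kernel is \<open>J\<close>, so that each module on \<open>U\<close> is
  isomorphic to one on \<open>\<V>/J\<close>. Let \<open>x\<close> be an element of the kernel, homogeneous of least possible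
  length, with \<open>r\<close> letters \<open>A\<close> and \<open>s\<close> letters \<open>B\<close>. Modulo \<open>J\<close> it is primitive, so the braided antipode
  negates it; but the antipode acts on degree \<open>(r, s)\<close> as reversal up to sign and a power of \<open>q\<close>, and
  this gives \<open>(r - s)\<^sup>2 = r + s\<close> unless \<open>x\<close> lies in \<open>J\<close>. Hence \<open>r \<noteq> s\<close>, say \<open>r > s\<close>, and then \<open>x\<close> is a
  singular vector of positive weight for the adjoint action of \<open>A\<close>. As that action is locally
  nilpotent on the kernel of the right derivation, \<open>x\<close> lies in \<open>J\<close> after all.

  On \<open>\<V>/J\<close> the maps \<open>x\<^sub>1, x\<^sub>3\<close> lower the degree, with only the constants in their common kernel, and
  \<open>x\<^sub>0, x\<^sub>2\<close> generate everything from \<open>1\<close>. This yields irreducibility, and also the cubic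
  relations, because the Serre expression in \<open>x\<^sub>0, x\<^sub>2\<close> commutes up to a scalar with \<open>x\<^sub>1\<close> and \<open>x\<^sub>3\<close>,
  and vice versa.
\<close>

section \<open>Linear maps on free algebras\<close>

abbreviation lu :: "('b \<Rightarrow>\<^sub>0 'f::zero) \<Rightarrow> 'b \<Rightarrow> 'f" where "lu \<equiv> Poly_Mapping.lookup"

lemma lookup_sm [simp]: "lu (sm c v) w = c * lu v w"
  by (simp add: sm_def Poly_Mapping.map.rep_eq when_def)

interpretation PM: vector_space "sm :: 'f::field \<Rightarrow> ('b \<Rightarrow>\<^sub>0 'f) \<Rightarrow> 'b \<Rightarrow>\<^sub>0 'f"
  by unfold_locales (auto intro!: poly_mapping_eqI simp: lookup_add algebra_simps)

interpretation PMP: vector_space_pair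
  "sm :: 'f::field \<Rightarrow> ('b \<Rightarrow>\<^sub>0 'f) \<Rightarrow> 'b \<Rightarrow>\<^sub>0 'f" "sm :: 'f::field \<Rightarrow> ('c \<Rightarrow>\<^sub>0 'f) \<Rightarrow> 'c \<Rightarrow>\<^sub>0 'f"
  by unfold_locales

abbreviation lin :: "(('b \<Rightarrow>\<^sub>0 'f::field) \<Rightarrow> 'c \<Rightarrow>\<^sub>0 'f) \<Rightarrow> bool" where
  "lin \<equiv> Vector_Spaces.linear sm sm"

lemma linI: "\<lbrakk>\<And>u v. f (u + v) = f u + f v; \<And>c v. f (sm c v) = sm c (f v)\<rbrakk> \<Longrightarrow> lin f"
  unfolding Vector_Spaces.linear_def module_hom_def module_hom_axioms_def
  by (intro conjI PM.vector_space_axioms PM.module_axioms) auto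

lemmas sm_simps = PM.scale_right_distrib PM.scale_right_diff_distrib PM.scale_scale
  PM.scale_minus_right

lemma sm_mult [simp]:
  fixes u v :: "'x::monoid_add \<Rightarrow>\<^sub>0 'f::field"
  shows "sm c u * v = sm c (u * v)"
  by (simp add: sm_def mult_map_scale_conv_mult mult.assoc)

lemma single_zero_mult: "Poly_Mapping.single 0 c * u = sm c u"
  by (simp add: sm_def mult_map_scale_conv_mult)

text \<open>Sums over the supports of \<open>u\<close>, \<open>v\<close> and \<open>u + v\<close>
  become comparable over a common finite set.\<close>

lemma lin_ext_superset:
  assumes "finite A" "Poly_Mapping.keys v \<subseteq> A"
  shows "lin_ext f v = (\<Sum>w\<in>A. sm (lu v w) (f w))"
  unfolding lin_ext_def using assms
  by (intro sum.mono_neutral_left) (auto simp: in_keys_iff)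

lemma lin_lin_ext: "lin (lin_ext f)"
proof (rule linI)
  fix u v :: "'b \<Rightarrow>\<^sub>0 'a" and c
  let ?A = "Poly_Mapping.keys u \<union> Poly_Mapping.keys v"
  have "Poly_Mapping.keys (u + v) \<subseteq> ?A" by (rule Poly_Mapping.keys_add)
  then show "lin_ext f (u + v) = lin_ext f u + lin_ext f v"
    by (simp add: lin_ext_superset[of ?A] lookup_add PM.scale_left_distrib sum.distrib)
  have "Poly_Mapping.keys (sm c v) \<subseteq> Poly_Mapping.keys v" by (auto simp: in_keys_iff)
  then show "lin_ext f (sm c v) = sm c (lin_ext f v)"
    by (simp add: lin_ext_superset[of "Poly_Mapping.keys v"] PM.scale_sum_right)
qed

lemma lin_ext_wd [simp]: "lin_ext f (wd w) = f w"
  by (simp add: lin_ext_def wd_def)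

lemma lin_ext_simps [simp]:
  "lin_ext f (u + v) = lin_ext f u + lin_ext f v"
  "lin_ext f (u - v) = lin_ext f u - lin_ext f v"
  "lin_ext f (- u) = - lin_ext f u"
  "lin_ext f (sm c u) = sm c (lin_ext f u)"
  "lin_ext f 0 = 0"
  using lin_lin_ext[of f]
  by (simp_all add: PMP.linear_add PMP.linear_diff PMP.linear_neg PMP.linear_scale PMP.linear_0)

lemma lookup_wd: "lu (wd w) x = (if w = x then 1 else 0)"
  by (simp add: wd_def lookup_single when_def)

lemma wd_expansion: "(\<Sum>w\<in>Poly_Mapping.keys v. sm (lu v w) (wd w)) = v"
  by (rule poly_mapping_eqI)
     (auto simp: lookup_sum lookup_wd in_keys_iff sum.remove[of "Poly_Mapping.keys v"] if_distrib
        cong: if_cong)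

text \<open>Finite support makes every element a linear combination of words. Zero has no case of
  its own because it is \<open>sm 0 (wd [])\<close>.\<close>

lemma word_induct [case_names wd add sm]:
  assumes "\<And>w. P (wd w)" "\<And>u v. P u \<Longrightarrow> P v \<Longrightarrow> P (u + v)" "\<And>c v. P v \<Longrightarrow> P (sm c v)"
  shows "P (v :: 'x list \<Rightarrow>\<^sub>0 'f::field)"
proof -
  have P0: "P 0" using assms(3)[OF assms(1)[of "[]"], of 0] by simp
  have "P (\<Sum>w\<in>A. sm (lu v w) (wd w))" if "finite A" for A
    using that by (induction A rule: finite_induct) (auto intro: assms P0)
  from this[of "Poly_Mapping.keys v"] show ?thesis by (simp add: wd_expansion)
qed

lemma mult_sm [simp]:
  fixes u v :: "'x list \<Rightarrow>\<^sub>0 'f::field"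
  shows "u * sm c v = sm c (u * v)"
proof -
  \<comment> \<open>The scalar \<open>c\<close> sits on the empty word, and it is central.\<close>
  have "u * Poly_Mapping.single 0 c = sm c u"
    by (induction u rule: word_induct)
       (simp_all add: wd_def mult_single distrib_right PM.scale_right_distrib mult.commute,
        simp add: sm_def)
  then show ?thesis
    by (simp add: single_zero_mult[symmetric] mult.assoc[symmetric])
qed

lemma subspace_UNIV_if_words:
  assumes "PM.subspace S" "\<And>w. wd w \<in> S"
  shows "S = (UNIV :: ('x list \<Rightarrow>\<^sub>0 'f::field) set)"
proof -
  have "v \<in> S" for v
    by (induction v rule: word_induct) (use assms in \<open>auto simp: PM.subspace_def\<close>)
  then show ?thesis by auto
qed

lemma one_eq_wd: "1 = wd []"
  by (simp add: wd_def zero_list_def[symmetric])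

lemma wd_mult [simp]: "wd u * wd v = wd (u @ v)"
  by (simp add: wd_def mult_single plus_list_def)

lemma gen_mult_wd [simp]: "gen a * wd w = wd (a # w)"
  by (simp add: gen_def)

lemma wd_mult_gen [simp]: "wd w * gen a = wd (w @ [a])"
  by (simp add: gen_def)

lemma wd_Cons: "wd (a # w) = gen a * wd w"
  by simp

section \<open>The basic operators\<close>

text \<open>With \<open>r\<close> letters \<open>A\<close> and \<open>s\<close> letters
  \<open>B\<close>, \<open>wt LA\<close> is \<open>2 (r - s)\<close> and \<open>wt LB\<close> is its
  negative. It is the exponent of \<open>q\<close> picked up when the letter crosses the
  word.\<close>

definition wt :: "letter \<Rightarrow> letter list \<Rightarrow> int" where
  "wt a w = (\<Sum>z\<leftarrow>w. pairing z a)"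

lemma wt_simps [simp]: "wt a [] = 0" "wt a (b # w) = pairing b a + wt a w"
  "wt a (u @ v) = wt a u + wt a v" "wt a (rev w) = wt a w"
  by (simp_all add: wt_def rev_map[symmetric])

lemma pairing_commute: "pairing a b = pairing b a"
  by (simp add: pairing_def)

text \<open>The maps \<open>K\<close> and \<open>K\<inverse>\<close> are \<open>tw q LA\<close> and \<open>tw q LB\<close>.\<close>

definition tw :: "'f::field \<Rightarrow> letter \<Rightarrow> 'f V \<Rightarrow> 'f V" where
  "tw q a = lin_ext (\<lambda>w. sm (q powi wt a w) (wd w))"

definition rv :: "'f::field V \<Rightarrow> 'f V" where
  "rv = lin_ext (\<lambda>w. wd (rev w))"

definition ls :: "'f::field \<Rightarrow> letter \<Rightarrow> 'f V \<Rightarrow> 'f V" where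
  "ls q a = star q (gen a)"

text \<open>Right shuffle multiplication by a letter, as \<open>star_gen_right\<close> confirms.
  Defining it by reversal carries facts about \<open>ls\<close> over to the right side.\<close>

definition rs :: "'f::field \<Rightarrow> letter \<Rightarrow> 'f V \<Rightarrow> 'f V" where
  "rs q a v = rv (ls q a (rv v))"

definition dL :: "letter \<Rightarrow> 'f::field V \<Rightarrow> 'f V" where
  "dL a = lin_ext (\<lambda>w. case w of [] \<Rightarrow> 0 | b # w' \<Rightarrow> if a = b then wd w' else 0)"

definition dR :: "letter \<Rightarrow> 'f::field V \<Rightarrow> 'f V" where
  "dR a v = rv (dL a (rv v))"

text \<open>The left skew derivation of the free algebra, with a braiding factor for each letter
  crossed. By \<open>lookup_ls_dl\<close> it is the adjoint of \<open>ls\<close>.\<close>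

fun dlw :: "'f::field \<Rightarrow> letter \<Rightarrow> letter list \<Rightarrow> 'f V" where
  "dlw q a [] = 0"
| "dlw q a (b # w) =
     (if a = b then wd w else 0) + sm (q powi pairing a b) (gen b * dlw q a w)"

definition dl :: "'f::field \<Rightarrow> letter \<Rightarrow> 'f V \<Rightarrow> 'f V" where
  "dl q a = lin_ext (dlw q a)"

definition dr :: "'f::field \<Rightarrow> letter \<Rightarrow> 'f V \<Rightarrow> 'f V" where
  "dr q a v = rv (dl q a (rv v))"

fun phiw :: "'f::field \<Rightarrow> letter list \<Rightarrow> 'f V" where
  "phiw q [] = 1"
| "phiw q (a # w) = ls q a (phiw q w)"

definition phi :: "'f::field \<Rightarrow> 'f V \<Rightarrow> 'f V" where
  "phi q = lin_ext (phiw q)"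

lemma star_wd [simp]: "star q (wd u) v = lin_ext (shuffle_words q u) v"
  by (simp add: star_def)

lemma star_simps_left [simp]:
  "star q (u + u') v = star q u v + star q u' v"
  "star q (u - u') v = star q u v - star q u' v"
  "star q (- u) v = - star q u v"
  "star q (sm c u) v = sm c (star q u v)"
  "star q 0 v = 0"
  by (simp_all add: star_def)

lemma star_simps_right [simp]:
  "star q u (v + v') = star q u v + star q u v'"
  "star q u (sm c v) = sm c (star q u v)"
  by (induction u rule: word_induct) (simp_all add: algebra_simps sm_simps)

lemma lin_star: "lin (star q u)" by (rule linI) simp_all

lemma star_simps_right' [simp]:
  "star q u (v - v') = star q u v - star q u v'"
  "star q u (- v) = - star q u v"
  "star q u 0 = 0"
  using lin_star[of q u] by (simp_all add: PMP.linear_diff PMP.linear_neg PMP.linear_0)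

lemma tw_simps [simp]:
  "tw q a (u + v) = tw q a u + tw q a v"  "tw q a (u - v) = tw q a u - tw q a v"
  "tw q a (- u) = - tw q a u"  "tw q a (sm c u) = sm c (tw q a u)"  "tw q a 0 = 0"
  "tw q a (wd w) = sm (q powi wt a w) (wd w)"
  by (simp_all add: tw_def)

lemma rv_simps [simp]:
  "rv (u + v) = rv u + rv v"  "rv (u - v) = rv u - rv v"  "rv (- u) = - rv u"
  "rv (sm c u) = sm c (rv u)"  "rv 0 = 0"  "rv (wd w) = wd (rev w)"
  by (simp_all add: rv_def)

lemma ls_simps [simp]:
  "ls q a (u + v) = ls q a u + ls q a v"  "ls q a (u - v) = ls q a u - ls q a v"
  "ls q a (- u) = - ls q a u"  "ls q a (sm c u) = sm c (ls q a u)"  "ls q a 0 = 0"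
  by (simp_all add: ls_def)

lemma rs_simps [simp]:
  "rs q a (u + v) = rs q a u + rs q a v"  "rs q a (u - v) = rs q a u - rs q a v"
  "rs q a (- u) = - rs q a u"  "rs q a (sm c u) = sm c (rs q a u)"  "rs q a 0 = 0"
  by (simp_all add: rs_def)

lemma dL_simps [simp]:
  "dL a (u + v) = dL a u + dL a v"  "dL a (u - v) = dL a u - dL a v"
  "dL a (- u) = - dL a u"  "dL a (sm c u) = sm c (dL a u)"  "dL a 0 = 0"
  "dL a (wd []) = 0" "dL a (wd (b # w)) = (if a = b then wd w else 0)"
  by (simp_all add: dL_def)

lemma dR_simps [simp]:
  "dR a (u + v) = dR a u + dR a v"  "dR a (u - v) = dR a u - dR a v"
  "dR a (- u) = - dR a u"  "dR a (sm c u) = sm c (dR a u)"  "dR a 0 = 0"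
  "dR a (wd []) = 0"  "dR a (wd (w @ [b])) = (if a = b then wd w else 0)"
  by (simp_all add: dR_def)

lemma dl_simps [simp]:
  "dl q a (u + v) = dl q a u + dl q a v"  "dl q a (u - v) = dl q a u - dl q a v"
  "dl q a (- u) = - dl q a u"  "dl q a (sm c u) = sm c (dl q a u)"  "dl q a 0 = 0"
  "dl q a (wd []) = 0"
  by (simp_all add: dl_def)

lemma dr_simps [simp]:
  "dr q a (u + v) = dr q a u + dr q a v"  "dr q a (u - v) = dr q a u - dr q a v"
  "dr q a (- u) = - dr q a u"  "dr q a (sm c u) = sm c (dr q a u)"  "dr q a 0 = 0"
  "dr q a (wd []) = 0"
  by (simp_all add: dr_def)

lemma phi_simps [simp]:
  "phi q (u + v) = phi q u + phi q v"  "phi q (u - v) = phi q u - phi q v"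
  "phi q (- u) = - phi q u"  "phi q (sm c u) = sm c (phi q u)"  "phi q 0 = 0"
  by (simp_all add: phi_def)

lemma lin_ops: "lin (tw q a)" "lin rv" "lin (ls q a)" "lin (rs q a)" "lin (dL a)" "lin (dR a)"
  "lin (dl q a)" "lin (dr q a)" "lin (phi q)"
  by (rule linI; simp)+

lemma rv_rv [simp]: "rv (rv v) = v"
  by (induction v rule: word_induct) simp_all

lemma rv_mult: "rv (u * v) = rv v * rv u"
proof (induction u rule: word_induct)
  case (wd w)
  show ?case by (induction v rule: word_induct) (simp_all add: algebra_simps)
qed (simp_all add: algebra_simps)

lemma rv_gen [simp]: "rv (gen a) = gen a" and rv_1 [simp]: "rv 1 = 1"
  by (simp_all add: gen_def one_eq_wd)

lemma tw_gen_mult: "q \<noteq> 0 \<Longrightarrow> tw q a (gen b * v) = sm (q powi pairing b a) (gen b * tw q a v)"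
  by (induction v rule: word_induct)
     (simp_all add: algebra_simps sm_simps power_int_add)

lemma tw_mult: "q \<noteq> 0 \<Longrightarrow> tw q a (u * v) = tw q a u * tw q a v"
proof (induction u rule: word_induct)
  case (wd w)
  then show ?case
    by (induction v rule: word_induct) (simp_all add: algebra_simps sm_simps power_int_add)
qed (simp_all add: algebra_simps)

lemma tw_gen [simp]: "tw q a (gen b) = sm (q powi pairing b a) (gen b)"
  by (simp add: gen_def)

lemma tw_1 [simp]: "tw q a 1 = 1"
  by (simp add: one_eq_wd)

lemma rv_tw: "rv (tw q a v) = tw q a (rv v)"
  by (induction v rule: word_induct) simp_all

lemma dl_gen_mult: "dl q a (gen b * v) =
    (if a = b then v else 0) + sm (q powi pairing a b) (gen b * dl q a v)"
  by (induction v rule: word_induct)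
     (simp_all add: algebra_simps sm_simps, simp_all add: dl_def)

lemma dl_1 [simp]: "dl q a 1 = 0" and dr_1 [simp]: "dr q a 1 = 0"
  by (simp_all add: one_eq_wd)

lemma dL_gen_mult [simp]: "dL a (gen b * v) = (if a = b then v else 0)"
  by (induction v rule: word_induct) (auto simp: distrib_left)

text \<open>The skew Leibniz rule: a letter of \<open>v\<close> is reached only after crossing all
  of \<open>u\<close>, and \<open>tw q a\<close> records that cost.\<close>

lemma dl_mult: "q \<noteq> 0 \<Longrightarrow> dl q a (u * v) = dl q a u * v + tw q a u * dl q a v"
proof (induction u rule: word_induct)
  case (wd w)
  then show ?case
  proof (induction w)
    case Nil
    then show ?case by (simp flip: one_eq_wd)
  next
    case (Cons b w)
    have "dl q a (wd (b # w) * v) = dl q a (gen b * (wd w * v))"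
      by (simp add: wd_Cons mult.assoc del: gen_mult_wd)
    then show ?case using Cons
      by (simp add: dl_gen_mult wd_Cons del: gen_mult_wd)
         (simp add: algebra_simps sm_simps power_int_add pairing_commute wd_Cons tw_gen_mult
            del: gen_mult_wd)
  qed
qed (simp_all add: algebra_simps sm_simps)

text \<open>The mirror image of \<open>dl_mult\<close>; the twist now falls on the right
  factor.\<close>

lemma dr_mult: "q \<noteq> 0 \<Longrightarrow> dr q a (u * v) = u * dr q a v + dr q a u * tw q a v"
  by (simp add: dr_def rv_mult dl_mult rv_tw)

lemma ls_Nil: "ls q a (wd []) = wd [a]"
  by (simp add: ls_def gen_def)

text \<open>The shuffled letter either comes first or crosses \<open>b\<close> and is shuffled into
  \<open>v\<close>.\<close>

lemma ls_gen_mult: "ls q a (gen b * v) =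
   gen a * (gen b * v) + sm (q powi pairing a b) (gen b * ls q a v)"
proof (induction v rule: word_induct)
  case (wd w)
  show ?case by (cases w) (simp_all add: ls_def gen_def)
qed (simp_all add: algebra_simps sm_simps)

fun flip :: "letter \<Rightarrow> letter" where "flip LA = LB" | "flip LB = LA"

lemma flip_flip [simp]: "flip (flip a) = a" by (cases a) auto

lemma flip_neq [simp]: "flip a \<noteq> a" "a \<noteq> flip a" by (cases a; simp)+

lemma neq_flip: "b \<noteq> a \<longleftrightarrow> b = flip a" by (cases a; cases b; simp)

lemma letter_flip: "b = a \<or> b = flip a" by (cases a; cases b; simp)

lemma pairing_same [simp]: "pairing a a = 2" and pairing_flip [simp]: "pairing a (flip a) = -2"
  "pairing (flip a) a = -2"
  by (simp_all add: pairing_def)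

lemma powi_2 [simp]: "(q::'f::field) powi 2 = q^2" and powi_m2 [simp]: "q powi (-2) = inverse (q^2)"
  by (simp_all add: power_int_minus)

lemma wt_flip: "wt (flip a) w = - wt a w"
proof (induction w)
  case (Cons b w)
  then show ?case using letter_flip[of b a] by (auto simp: pairing_def)
qed simp

lemma tw_tw_flip [simp]: "q \<noteq> 0 \<Longrightarrow> tw q a (tw q (flip a) v) = v"
  "q \<noteq> 0 \<Longrightarrow> tw q (flip a) (tw q a v) = v"
  by (induction v rule: word_induct; simp add: wt_flip power_int_minus)+

lemma tw_commute: "tw q a (tw q b v) = tw q b (tw q a v)"
  by (induction v rule: word_induct) (simp_all add: mult.commute)

text \<open>Induction adapted to operators known by their effect on
  \<open>gen a * v\<close>.\<close>

lemma gen_mult_induct [case_names one gen add sm]: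
  assumes "P 1" "\<And>a v. P v \<Longrightarrow> P (gen a * v)"
    "\<And>u v. P u \<Longrightarrow> P v \<Longrightarrow> P (u + v)" "\<And>c v. P v \<Longrightarrow> P (sm c v)"
  shows "P (v :: 'x list \<Rightarrow>\<^sub>0 'f::field)"
proof (induction v rule: word_induct)
  case (wd w)
  show ?case
    by (induction w) (use assms in \<open>auto simp: one_eq_wd wd_Cons simp del: gen_mult_wd\<close>)
qed (use assms in auto)

lemma dl_tw: "q \<noteq> 0 \<Longrightarrow> dl q a (tw q b v) = sm (q powi pairing a b) (tw q b (dl q a v))"
  by (induction v rule: gen_mult_induct)
     (simp_all add: dl_gen_mult tw_gen_mult algebra_simps sm_simps pairing_commute)

lemma dr_tw: "q \<noteq> 0 \<Longrightarrow> dr q a (tw q b v) = sm (q powi pairing a b) (tw q b (dr q a v))"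
  by (simp add: dr_def rv_tw dl_tw)

lemma lookup_Nil_gen_mult [simp]: "lu (gen a * v) [] = 0"
  by (induction v rule: word_induct) (simp_all add: distrib_left lookup_add lookup_wd)

lemma lookup_Nil_mult_gen [simp]: "lu (v * gen a) [] = 0"
  by (induction v rule: word_induct) (simp_all add: distrib_right lookup_add lookup_wd)

lemma lookup_dL [simp]: "lu (dL a v) w = lu v (a # w)"
proof (induction v rule: word_induct)
  case (wd x)
  then show ?case by (cases x) (auto simp: lookup_wd)
qed (simp_all add: lookup_add)

lemma lookup_rv: "lu (rv v) w = lu v (rev w)"
  by (induction v rule: word_induct) (auto simp: lookup_add lookup_wd)

lemma lookup_dR [simp]: "lu (dR a v) w = lu v (w @ [a])"
  by (simp add: dR_def lookup_rv)

lemma lookup_tw: "lu (tw q a v) w = q powi wt a w * lu v w"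
  by (induction v rule: word_induct) (auto simp: lookup_add lookup_wd algebra_simps)

lemma zero_if_dL:
  assumes "\<And>a. dL a v = 0" "lu v [] = 0"
  shows "v = 0"
proof (rule poly_mapping_eqI)
  fix w show "lu v w = lu 0 w"
  proof (cases w)
    case (Cons a w')
    then have "lu v w = lu (dL a v) w'" by simp
    then show ?thesis by (simp only: assms lookup_zero)
  qed (simp add: assms)
qed

section \<open>The map from the free algebra to the q-shuffle algebra\<close>

lemma star_1_left [simp]: "star q 1 v = v"
proof -
  have "shuffle_words q [] = wd" by (rule ext) simp
  then show ?thesis by (simp add: one_eq_wd, induction v rule: word_induct) simp_all
qed

lemma star_1_right [simp]: "star q v 1 = v"
proof (induction v rule: word_induct)
  case (wd w)
  then show ?case by (cases w) (simp_all add: one_eq_wd)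
qed simp_all

lemma ls_1 [simp]: "ls q a 1 = gen a"
  by (simp add: ls_def)

text \<open>Writing the power of \<open>q\<close> as a twist of the left factor makes the recursion
  bilinear.\<close>

lemma star_gen_mult: "star q (gen c * p) (gen d * r) =
   gen c * star q p (gen d * r) + gen d * star q (tw q d (gen c * p)) r"
proof (induction p rule: word_induct)
  case (wd w)
  show ?case
    by (induction r rule: word_induct) (simp_all add: algebra_simps sm_simps wt_def)
qed (simp_all add: algebra_simps)

lemma tw_ls: "q \<noteq> 0 \<Longrightarrow> tw q b (ls q a v) = sm (q powi pairing a b) (ls q a (tw q b v))"
  by (induction v rule: gen_mult_induct)
     (simp_all add: ls_gen_mult tw_gen_mult algebra_simps sm_simps)

text \<open>The instance of associativity that makes \<open>phi\<close> multiplicative. On words it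
  follows the recursion of the shuffle product, and bilinearity does the rest.\<close>

lemma star_ls:
  assumes "q \<noteq> 0"
  shows "star q (ls q a x) y = ls q a (star q x y)"
proof -
  have *: "star q (ls q a (wd u)) (wd v) = ls q a (star q (wd u) (wd v))" for u v
    using assms
  proof (induction q u v rule: shuffle_words.induct)
    case (1 q v)
    then show ?case by (simp flip: one_eq_wd add: ls_def)
  next
    case (2 q c u)
    then show ?case by (simp flip: one_eq_wd)
  next
    case (3 q c u d v)
    define X Y k p r where "X = (wd u :: 'a V)" and "Y = (wd v :: 'a V)" and
      "k = q powi wt d (c # u)" and "p = q powi pairing a c" and "r = q powi pairing a d"
    have tw: "tw q d (gen c * X) = sm k (gen c * X)" by (simp add: X_def k_def)
    have IH1: "star q (ls q a X) (gen d * Y) = ls q a (star q X (gen d * Y))"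
      and IH2: "star q (ls q a (gen c * X)) Y = ls q a (star q (gen c * X) Y)"
      using 3 by (simp_all add: X_def Y_def del: star_wd)
    have "tw q d (ls q a (gen c * X)) = sm (r * k) (ls q a (gen c * X))"
      using 3 by (simp add: tw_ls tw r_def mult.commute)
    \<comment> \<open>Two computations of \<open>tw q d (ls q a (gen c * X))\<close> are compared:
      by \<open>ls_gen_mult\<close> on the left and by \<open>tw_ls\<close> on the right.\<close>
    then have tw': "star q (tw q d (gen a * (gen c * X))) Y + sm p (star q (tw q d (gen c * ls q a X)) Y)
        = sm (r * k) (ls q a (star q (gen c * X) Y))"
      by (simp add: ls_gen_mult p_def flip: IH2 star_simps_left)
    have "star q (ls q a (gen c * X)) (gen d * Y) =
        gen a * star q (gen c * X) (gen d * Y) + sm p (gen c * star q (ls q a X) (gen d * Y))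
      + gen d * (star q (tw q d (gen a * (gen c * X))) Y + sm p (star q (tw q d (gen c * ls q a X)) Y))"
      by (simp add: ls_gen_mult star_gen_mult p_def sm_simps algebra_simps del: tw_simps)
    also have "\<dots> = ls q a (star q (gen c * X) (gen d * Y))"
      unfolding tw' IH1
      by (simp add: star_gen_mult tw ls_gen_mult p_def r_def sm_simps algebra_simps)
    finally show ?case by (simp add: X_def Y_def del: star_wd)
  qed
  show ?thesis
  proof (induction x rule: word_induct)
    case (wd u)
    show ?case by (induction y rule: word_induct) (simp_all add: * del: star_wd)
  qed simp_all
qed

lemma phi_1 [simp]: "phi q 1 = 1"
  by (simp add: phi_def one_eq_wd)

lemma phi_gen_mult [simp]: "phi q (gen a * v) = ls q a (phi q v)"
  by (induction v rule: word_induct) (simp_all add: distrib_left, simp add: phi_def)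

lemma phi_gen [simp]: "phi q (gen a) = gen a"
  using phi_gen_mult[of q a 1] by (simp del: phi_gen_mult)

lemma phi_mult: "q \<noteq> 0 \<Longrightarrow> phi q (u * v) = star q (phi q u) (phi q v)"
  by (induction u rule: gen_mult_induct) (simp_all add: mult.assoc star_ls distrib_right)

text \<open>Seen from the right end: either \<open>b\<close> stays last, or \<open>a\<close> has
  crossed all of \<open>u\<close> and \<open>b\<close>.\<close>

lemma ls_mult_gen: "q \<noteq> 0 \<Longrightarrow> ls q a (u * gen b) =
   ls q a u * gen b + sm (q powi pairing a b) (tw q a u * (gen b * gen a))"
proof (induction u rule: gen_mult_induct)
  case one
  then show ?case using ls_gen_mult[of q a b 1] by simp
qed (simp_all add: ls_gen_mult algebra_simps sm_simps tw_gen_mult pairing_commute)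

text \<open>Both sides satisfy the same recursion in the first letter.\<close>

lemma star_gen_right: "q \<noteq> 0 \<Longrightarrow> star q v (gen a) = rs q a v"
proof (induction v rule: gen_mult_induct)
  case one then show ?case by (simp add: rs_def)
next
  case (gen b v)
  have "star q (gen b * v) (gen a * 1) = gen b * star q v (gen a) + gen a * tw q a (gen b * v)"
    by (subst star_gen_mult) simp
  moreover have "rs q a (gen b * v) = gen b * rs q a v
      + sm (q powi pairing a b) (gen a * (gen b * tw q a v))"
    using gen by (simp add: rs_def rv_mult ls_mult_gen rv_tw mult.assoc)
  ultimately show ?case using gen by (simp add: tw_gen_mult pairing_commute)
qed simp_all

lemma phi_mult_gen [simp]: "q \<noteq> 0 \<Longrightarrow> phi q (v * gen a) = rs q a (phi q v)"
  by (simp add: phi_mult star_gen_right)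

lemma phi_rv: "q \<noteq> 0 \<Longrightarrow> phi q (rv v) = rv (phi q v)"
  by (induction v rule: gen_mult_induct) (simp_all add: rv_mult, simp add: rs_def)

lemma phi_tw: "q \<noteq> 0 \<Longrightarrow> phi q (tw q a v) = tw q a (phi q v)"
  by (induction v rule: gen_mult_induct) (simp_all add: tw_gen_mult tw_ls)

lemma dL_1 [simp]: "dL a 1 = 0"
  by (simp add: one_eq_wd)

text \<open>For the shuffle product, deleting the first letter obeys the rule that \<open>dl\<close>
  obeys for concatenation; hence \<open>phi_dl\<close>.\<close>

lemma dL_ls: "dL a (ls q b v) = (if a = b then v else 0) + sm (q powi pairing a b) (ls q b (dL a v))"
proof (induction v rule: gen_mult_induct)
  case one
  then show ?case using dL_gen_mult[of a b 1] by simp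
qed (simp_all add: ls_gen_mult algebra_simps sm_simps pairing_commute)

lemma phi_dl: "phi q (dl q a v) = dL a (phi q v)"
  by (induction v rule: gen_mult_induct) (simp_all add: dl_gen_mult dL_ls)

lemma phi_dr: "q \<noteq> 0 \<Longrightarrow> phi q (dr q a v) = dR a (phi q v)"
  by (simp add: dr_def dR_def phi_rv phi_dl)

lemma lookup_Nil_ls [simp]: "lu (ls q a v) [] = 0"
proof (induction v rule: gen_mult_induct)
  case one then show ?case using lookup_Nil_gen_mult[of a 1] by simp
qed (simp_all add: ls_gen_mult lookup_add)

lemma lookup_Nil_phi [simp]: "lu (phi q v) [] = lu v []"
  by (induction v rule: gen_mult_induct) (simp_all add: lookup_add)

section \<open>The adjoint action\<close>

text \<open>The braided commutator with \<open>gen a\<close>.\<close>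

definition ad :: "'f::field \<Rightarrow> letter \<Rightarrow> 'f V \<Rightarrow> 'f V" where
  "ad q a v = gen a * v - tw q a v * gen a"

lemma ad_simps [simp]:
  "ad q a (u + v) = ad q a u + ad q a v"  "ad q a (u - v) = ad q a u - ad q a v"
  "ad q a (- u) = - ad q a u"  "ad q a (sm c u) = sm c (ad q a u)"  "ad q a 0 = 0" "ad q a 1 = 0"
  by (simp_all add: ad_def algebra_simps sm_simps)

lemma ad_mult: "q \<noteq> 0 \<Longrightarrow> ad q a (u * v) = ad q a u * v + tw q a u * ad q a v"
  by (simp add: ad_def tw_mult algebra_simps)

lemma tw_ad: "q \<noteq> 0 \<Longrightarrow> tw q b (ad q a v) = sm (q powi pairing a b) (ad q a (tw q b v))"
  by (simp add: ad_def tw_mult algebra_simps sm_simps tw_commute[of q a])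

lemma dl_gen: "dl q a (gen b) = (if a = b then 1 else 0)"
  using dl_gen_mult[of q a b 1] by simp

text \<open>A commutation relation of \<open>sl2\<close> type between a raising and a lowering
  operator; the Serre element and the singular vectors are both handled with it.\<close>

lemma dl_ad_same: "q \<noteq> 0 \<Longrightarrow>
    dl q a (ad q a v) = v - tw q a (tw q a v) + sm (q^2) (ad q a (dl q a v))"
  by (simp add: ad_def dl_mult dl_gen dl_tw algebra_simps sm_simps)

lemma dl_ad_flip: "q \<noteq> 0 \<Longrightarrow>
    dl q (flip a) (ad q a v) = sm (inverse (q^2)) (ad q a (dl q (flip a) v))"
  by (simp add: ad_def dl_mult dl_gen dl_tw algebra_simps sm_simps)

lemma dr_gen: "dr q a (gen b) = (if a = b then 1 else 0)"
  by (simp add: dr_def dl_gen)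

text \<open>The two terms \<open>tw q a v\<close> cancel, so \<open>ad q a\<close> preserves the
  kernel of \<open>dr q a\<close>, also modulo \<open>J q\<close>.\<close>

lemma dr_ad_same: "q \<noteq> 0 \<Longrightarrow>
    dr q a (ad q a v) = gen a * dr q a v - sm (q^2 * q^2) (tw q a (dr q a v) * gen a)"
  by (simp add: ad_def dr_mult dr_gen dr_tw algebra_simps sm_simps)

lemma q3_eq:
  assumes "(q::'f::field) \<noteq> 0" "q^2 \<noteq> 1"
  shows "q3 q = q^2 + 1 + inverse (q^2)"
proof -
  define p where "p = inverse q"
  have qp: "q * p = 1" "p * q = 1" using assms by (simp_all add: p_def)
  have "q - p \<noteq> 0" using assms qp by (auto simp: power2_eq_square)
  moreover have "(q^2 + 1 + p^2) * (q - p) = q^3 - p^3"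
  proof -
    have "q * (p * x) = x" "p * (q * x) = x" for x
      using qp by (simp_all flip: mult.assoc)
    then show ?thesis
      by (simp add: power2_eq_square power3_eq_cube algebra_simps qp)
  qed
  ultimately show ?thesis
    by (simp add: q3_def p_def nonzero_divide_eq_eq power_inverse)
qed

text \<open>The successive twists are by \<open>q^-2\<close>, \<open>1\<close> and
  \<open>q^2\<close>, and expanding the nested commutators produces their sum \<open>q3 q\<close> as
  coefficient.\<close>

lemma serre_ad:
  assumes "q \<noteq> 0" "q^2 \<noteq> 1"
  shows "serre q a (flip a) = ad q a (ad q a (ad q a (gen (flip a))))"
  unfolding serre_def q3_eq[OF assms]
  using assms(1)
  by (simp add: ad_def tw_mult algebra_simps sm_simps power2_eq_square power3_eq_cube)

section \<open>Two-sided ideals of the free algebra\<close>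

lemma free_algebra_simps [simp]:
  "carrier free_algebra = UNIV" "u \<otimes>\<^bsub>free_algebra\<^esub> v = u * v" "\<one>\<^bsub>free_algebra\<^esub> = 1"
  "\<zero>\<^bsub>free_algebra\<^esub> = 0" "u \<oplus>\<^bsub>free_algebra\<^esub> v = u + v" "c \<odot>\<^bsub>free_algebra\<^esub> v = sm c v"
  by (simp_all add: free_algebra_def)

lemma ring_free_algebra: "ring (free_algebra :: ('f::field, 'x list \<Rightarrow>\<^sub>0 'f) module)"
proof (rule ringI)
  show "abelian_group (free_algebra :: ('f, 'x list \<Rightarrow>\<^sub>0 'f) module)"
  proof (rule abelian_groupI)
    fix x :: "'x list \<Rightarrow>\<^sub>0 'f"
    show "\<exists>y\<in>carrier free_algebra. y \<oplus>\<^bsub>free_algebra\<^esub> x = \<zero>\<^bsub>free_algebra\<^esub>"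
      by (rule bexI[of _ "- x"]) simp_all
  qed (simp_all add: add_ac)
  show "Group.monoid (free_algebra :: ('f, 'x list \<Rightarrow>\<^sub>0 'f) module)"
    by (rule monoidI) (simp_all add: mult.assoc)
qed (simp_all add: distrib_left distrib_right)

lemma ideal_free_algebraI:
  assumes "PM.subspace I" "\<And>u v. v \<in> I \<Longrightarrow> u * v \<in> I" "\<And>u v. v \<in> I \<Longrightarrow> v * u \<in> I"
  shows "ideal I (free_algebra :: ('f::field, 'x list \<Rightarrow>\<^sub>0 'f) module)"
proof (rule idealI[OF ring_free_algebra])
  show "subgroup I (add_monoid (free_algebra :: ('f, 'x list \<Rightarrow>\<^sub>0 'f) module))"
  proof
    fix x assume "x \<in> I"
    then have "- x \<in> I" using PM.subspace_neg[OF assms(1)] by simp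
    moreover have "inv\<^bsub>add_monoid (free_algebra :: ('f, 'x list \<Rightarrow>\<^sub>0 'f) module)\<^esub> x = - x"
      using abelian_group.minus_equality[OF ring.is_abelian_group[OF ring_free_algebra], of "- x" x]
      by (simp add: a_inv_def)
    ultimately show "inv\<^bsub>add_monoid (free_algebra :: ('f, 'x list \<Rightarrow>\<^sub>0 'f) module)\<^esub> x \<in> I" by simp
  qed (use assms in \<open>auto simp: PM.subspace_def\<close>)
qed (use assms in auto)

lemma ideal_subspace:
  assumes "ideal I (free_algebra :: ('f::field, 'x list \<Rightarrow>\<^sub>0 'f) module)"
  shows "PM.subspace I"
proof -
  interpret ideal I "free_algebra :: ('f, 'x list \<Rightarrow>\<^sub>0 'f) module" by fact
  show ?thesis
  proof (rule PM.subspaceI)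
    show "0 \<in> I" using additive_subgroup.zero_closed[OF is_additive_subgroup] by simp
    show "x + y \<in> I" if "x \<in> I" "y \<in> I" for x y using additive_subgroup.a_closed[OF is_additive_subgroup that] by simp
    show "sm c x \<in> I" if "x \<in> I" for c x
      using I_l_closed[OF that, of "sm c 1"] by simp
  qed
qed

lemma ideal_mult:
  assumes "ideal I (free_algebra :: ('f::field, 'x list \<Rightarrow>\<^sub>0 'f) module)" "v \<in> I"
  shows "u * v \<in> I" "v * u \<in> I"
  using ideal.I_l_closed[OF assms] ideal.I_r_closed[OF assms] by simp_all

lemma ideal_J: "ideal (J q) free_algebra"
  unfolding J_def by (rule ring.genideal_ideal[OF ring_free_algebra]) simp

lemma subspace_J: "PM.subspace (J q)"
  by (rule ideal_subspace[OF ideal_J])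

lemma J_closed [simp, intro]:
  "0 \<in> J q" "u \<in> J q \<Longrightarrow> v \<in> J q \<Longrightarrow> u + v \<in> J q" "u \<in> J q \<Longrightarrow> v \<in> J q \<Longrightarrow> u - v \<in> J q"
  "u \<in> J q \<Longrightarrow> - u \<in> J q" "u \<in> J q \<Longrightarrow> sm c u \<in> J q" "v \<in> J q \<Longrightarrow> u * v \<in> J q"
  "v \<in> J q \<Longrightarrow> v * u \<in> J q"
  using subspace_J[of q] PM.subspace_neg[OF subspace_J] PM.subspace_diff[OF subspace_J]
    ideal_mult[OF ideal_J]
  by (simp_all add: PM.subspace_def)

lemma serre_in_J: "serre q a (flip a) \<in> J q"
  using ring.genideal_self[OF ring_free_algebra, of "{serre q LA LB, serre q LB LA}"]
  unfolding J_def by (cases a) auto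

text \<open>The way in which stability of \<open>J q\<close> under an operator is proved:
  \<open>S\<close> is taken to be a preimage of \<open>J q\<close>.\<close>

lemma J_subsetI:
  assumes "PM.subspace S" "\<And>u v. v \<in> S \<Longrightarrow> u * v \<in> S" "\<And>u v. v \<in> S \<Longrightarrow> v * u \<in> S"
    "\<And>a. serre q a (flip a) \<in> S"
  shows "J q \<subseteq> S"
  unfolding J_def
  by (rule ring.genideal_minimal[OF ring_free_algebra ideal_free_algebraI])
     (use assms assms(4)[of LA] assms(4)[of LB] in auto)

lemma subspace_vimage:
  assumes "lin f" "PM.subspace S"
  shows "PM.subspace {v. f v \<in> S}"
  using PMP.linear_0[OF assms(1)] PMP.linear_add[OF assms(1)] PMP.linear_scale[OF assms(1)] assms(2)
  by (auto simp: PM.subspace_def)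

lemma gen_closed_mult:
  assumes "PM.subspace S" "\<And>a v. v \<in> S \<Longrightarrow> gen a * v \<in> S" "v \<in> S"
  shows "u * v \<in> S"
proof (induction u rule: gen_mult_induct)
  case one
  show ?case using assms by simp
qed (use assms in \<open>simp_all add: distrib_right mult.assoc PM.subspace_def\<close>)

lemma gen_closed_mult_right:
  assumes S: "PM.subspace S" "\<And>a v. v \<in> S \<Longrightarrow> v * gen a \<in> S" "v \<in> S"
  shows "v * u \<in> (S :: 'f::field V set)"
proof -
  have "rv u * rv v \<in> {v. rv v \<in> S}"
  proof (rule gen_closed_mult)
    show "PM.subspace {v. rv v \<in> S}" by (rule subspace_vimage[OF lin_ops(2) S(1)])
  qed (use S in \<open>simp_all add: rv_mult\<close>)
  then show ?thesis by (simp add: rv_mult)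
qed

section \<open>Stability of the Serre ideal under twists, skew derivations and reversal\<close>

locale qnz =
  fixes q :: "'f::field"
  assumes q0 [simp]: "q \<noteq> 0" and q_root: "\<And>n. n > 0 \<Longrightarrow> q ^ n \<noteq> 1"
begin

lemma q2 [simp]: "q^2 \<noteq> 1"
  using q_root[of 2] by simp

lemmas serre_ad = serre_ad[OF q0 q2]

lemma tw_serre: "tw q b (serre q a (flip a)) = sm (q powi (3 * pairing a b + pairing (flip a) b)) (serre q a (flip a))"
  by (simp add: serre_ad tw_ad power_int_add power_int_mult mult_ac)
     (simp add: power_numeral_reduce mult_ac numeral_eq_Suc)

lemma tw_J: "v \<in> J q \<Longrightarrow> tw q a v \<in> J q"
proof -
  have "J q \<subseteq> {v. tw q a v \<in> J q}"
    by (rule J_subsetI)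
       (auto simp: tw_mult tw_serre serre_in_J subspace_vimage[OF lin_ops(1) subspace_J])
  then show "v \<in> J q \<Longrightarrow> tw q a v \<in> J q" by auto
qed

text \<open>For \<open>b = a\<close> the contributions along the string of commutators add up to
  \<open>1 - q^4 + q^2 (q^2 - q^-2) = 0\<close>. For the other letter \<open>dl\<close> passes
  through every \<open>ad\<close> and reaches \<open>ad q a 1 = 0\<close>.\<close>

lemma dl_serre: "dl q b (serre q a (flip a)) = 0"
proof (cases "b = a")
  case True
  have 1: "ad q a (gen (flip a)) = gen a * gen (flip a) - sm (inverse (q^2)) (gen (flip a) * gen a)"
    by (simp add: ad_def)
  have d1: "dl q a (ad q a (gen (flip a))) = sm (1 - inverse (q^2) * inverse (q^2)) (gen (flip a))"
    by (simp add: dl_ad_same dl_gen PM.scale_left_diff_distrib)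
  have d2: "dl q a (ad q a (ad q a (gen (flip a)))) = sm (q^2 - inverse (q^2)) (ad q a (gen (flip a)))"
    by (simp add: dl_ad_same d1 tw_ad) (simp add: field_simps)
  show ?thesis
    unfolding serre_ad True
    by (simp add: dl_ad_same d2 tw_ad PM.scale_left_diff_distrib[symmetric])
       (rule poly_mapping_eqI, simp add: lookup_minus lookup_add field_simps)
next
  case False
  then have "b = flip a" by (simp add: neq_flip)
  then show ?thesis by (simp add: serre_ad dl_ad_flip dl_gen)
qed

lemma dl_J: "v \<in> J q \<Longrightarrow> dl q a v \<in> J q"
proof -
  \<comment> \<open>Intersecting with \<open>J q\<close> takes care of the Leibniz terms in which
    \<open>v\<close> is not differentiated.\<close>
  have "J q \<subseteq> {v. dl q a v \<in> J q} \<inter> J q"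
    by (rule J_subsetI)
       (auto simp: dl_mult tw_J dl_serre serre_in_J
         intro!: PM.subspace_inter subspace_vimage[OF lin_ops(7) subspace_J] subspace_J)
  then show "v \<in> J q \<Longrightarrow> dl q a v \<in> J q" by auto
qed

lemma rv_serre: "rv (serre q a b) = - serre q a b"
  by (simp add: serre_def rv_mult power2_eq_square power3_eq_cube mult.assoc)

lemma rv_J: "v \<in> J q \<Longrightarrow> rv v \<in> J q"
proof -
  have "J q \<subseteq> {v. rv v \<in> J q}"
    by (rule J_subsetI)
       (auto simp: rv_mult rv_serre serre_in_J subspace_vimage[OF lin_ops(2) subspace_J])
  then show "v \<in> J q \<Longrightarrow> rv v \<in> J q" by auto
qed

lemma dr_J: "v \<in> J q \<Longrightarrow> dr q a v \<in> J q"
  by (simp add: dr_def rv_J dl_J)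

lemma ad_J: "v \<in> J q \<Longrightarrow> ad q a v \<in> J q"
  by (auto simp: ad_def tw_J)

text \<open>By \<open>phi_dl\<close> and \<open>dl_serre\<close> no first letter can be deleted, and
  the constant term is zero.\<close>

lemma phi_serre: "phi q (serre q a (flip a)) = 0"
proof (rule zero_if_dL)
  show "dL b (phi q (serre q a (flip a))) = 0" for b
    by (simp add: phi_dl[symmetric] dl_serre)
  show "lu (phi q (serre q a (flip a))) [] = 0"
    by (simp add: serre_def lookup_minus lookup_add power3_eq_cube power2_eq_square mult.assoc)
qed

lemma phi_J: "v \<in> J q \<Longrightarrow> phi q v = 0"
proof -
  have "PM.subspace {v. phi q v \<in> {0}}"
    by (rule subspace_vimage[OF lin_ops(9)]) simp
  then have "J q \<subseteq> {v. phi q v \<in> {0}}"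
    by (rule J_subsetI) (simp_all add: phi_mult phi_serre)
  then show "v \<in> J q \<Longrightarrow> phi q v = 0" by auto
qed

end

section \<open>The braided antipode\<close>

text \<open>The sum of the pairings over all pairs of positions: the exponent collected by the
  braiding when a word is reversed.\<close>

fun ew :: "letter list \<Rightarrow> int" where
  "ew [] = 0"
| "ew (a # w) = wt a w + ew w"

text \<open>For \<open>r\<close> letters \<open>A\<close> and \<open>s\<close> letters
  \<open>B\<close> this is \<open>ew w = (r - s)^2 - (r + s)\<close>; in particular
  \<open>ew\<close> depends only on the degree.\<close>

lemma ew_eq: "4 * ew w = (wt LA w)^2 - 4 * int (length w)"
proof (induction w)
  case (Cons a w)
  have "wt a w * pairing a LA = 2 * wt LA w"
    using wt_flip[of LA w] by (cases a) (auto simp: pairing_def)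
  moreover have "(pairing a LA)^2 = 4" by (simp add: pairing_def)
  moreover have "2 * wt LA w * pairing a LA = 4 * wt a w"
    using wt_flip[of LA w] by (cases a) (auto simp: pairing_def)
  ultimately show ?case using Cons by (simp add: power2_sum algebra_simps)
qed simp

text \<open>The antipode of the braided Hopf algebra with primitive letters; \<open>cop_anti\<close>
  is its defining axiom.\<close>

definition anti :: "'f::field \<Rightarrow> 'f V \<Rightarrow> 'f V" where
  "anti q = lin_ext (\<lambda>w. sm ((-1) ^ length w * q powi ew w) (wd (rev w)))"

lemma anti_simps [simp]:
  "anti q (u + v) = anti q u + anti q v"  "anti q (u - v) = anti q u - anti q v"
  "anti q (- u) = - anti q u"  "anti q (sm c u) = sm c (anti q u)"  "anti q 0 = 0" "anti q 1 = 1"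
  by (simp_all add: anti_def one_eq_wd)

text \<open>
  The sum of \<open>\<beta> u v\<close> over the terms \<open>u \<otimes> v\<close> of the braided coproduct of a word, for which the
  letters are primitive.
\<close>

fun cop :: "'f::field \<Rightarrow> (letter list \<Rightarrow> letter list \<Rightarrow> 'f V) \<Rightarrow> letter list \<Rightarrow> 'f V" where
  "cop q \<beta> [] = \<beta> [] []"
| "cop q \<beta> (a # w) = cop q (\<lambda>u v. \<beta> (a # u) v + sm (q powi wt a u) (\<beta> u (a # v))) w"

lemma cop_diff: "cop q (\<lambda>u v. \<beta> u v - \<gamma> u v) w = cop q \<beta> w - cop q \<gamma> w"
proof (induction w arbitrary: \<beta> \<gamma>)
  case (Cons a w)
  have "cop q (\<lambda>u v. \<beta> u v - \<gamma> u v) (a # w) =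
      cop q (\<lambda>u v. (\<beta> (a # u) v + sm (q powi wt a u) (\<beta> u (a # v)))
                  - (\<gamma> (a # u) v + sm (q powi wt a u) (\<gamma> u (a # v)))) w"
    by (simp add: sm_simps algebra_simps)
  then show ?case by (simp only: Cons.IH cop.simps)
qed simp

lemma cop_zero: "cop q (\<lambda>u v. 0) w = 0"
  using cop_diff[of q "\<lambda>u v. 0" "\<lambda>u v. 0"] by simp

text \<open>Each extreme term for the shorter word splits into an extreme term and an interior one
  for the longer word, and the interior ones lie in \<open>J q\<close>.\<close>

lemma cop_interior:
  assumes "\<And>u v. u \<noteq> [] \<Longrightarrow> v \<noteq> [] \<Longrightarrow> length u + length v = length w \<Longrightarrow> \<beta> u v \<in> J q" "w \<noteq> []"
  shows "cop q \<beta> w - (\<beta> w [] + \<beta> [] w) \<in> J q"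
  using assms
proof (induction w arbitrary: \<beta>)
  case (Cons a w)
  show ?case
  proof (cases "w = []")
    case False
    let ?\<gamma> = "\<lambda>u v. \<beta> (a # u) v + sm (q powi wt a u) (\<beta> u (a # v))"
    have "cop q ?\<gamma> w - (?\<gamma> w [] + ?\<gamma> [] w) \<in> J q"
      by (rule Cons.IH) (use Cons.prems False in auto)
    moreover have "\<beta> [a] w \<in> J q" "sm (q powi wt a w) (\<beta> w [a]) \<in> J q"
      using Cons.prems False by auto
    ultimately have "(cop q ?\<gamma> w - (?\<gamma> w [] + ?\<gamma> [] w)) + \<beta> [a] w + sm (q powi wt a w) (\<beta> w [a]) \<in> J q"
      by blast
    then show ?thesis by (simp add: algebra_simps)
  qed simp
qed simp

definition bilin :: "('f::field V \<Rightarrow> 'f V \<Rightarrow> 'f V) \<Rightarrow> bool" where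
  "bilin \<gamma> \<longleftrightarrow> (\<forall>y. lin (\<lambda>x. \<gamma> x y)) \<and> (\<forall>x. lin (\<gamma> x))"

lemma lin_eqI:
  assumes "lin f" "lin g" "\<And>w. f (wd w) = g (wd w)"
  shows "f v = g (v :: 'x list \<Rightarrow>\<^sub>0 'f::field)"
  by (induction v rule: word_induct)
     (simp_all add: assms PMP.linear_add[OF assms(1)] PMP.linear_add[OF assms(2)]
        PMP.linear_scale[OF assms(1)] PMP.linear_scale[OF assms(2)])

lemma bilinI: "\<lbrakk>\<And>x x' y. \<gamma> (x + x') y = \<gamma> x y + \<gamma> x' y; \<And>x y y'. \<gamma> x (y + y') = \<gamma> x y + \<gamma> x y';
   \<And>c x y. \<gamma> (sm c x) y = sm c (\<gamma> x y); \<And>c x y. \<gamma> x (sm c y) = sm c (\<gamma> x y)\<rbrakk> \<Longrightarrow> bilin \<gamma>"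
  by (auto simp: bilin_def intro!: linI)

lemma bilinD:
  assumes "bilin \<gamma>"
  shows "\<gamma> (x + x') y = \<gamma> x y + \<gamma> x' y" "\<gamma> x (y + y') = \<gamma> x y + \<gamma> x y'"
   "\<gamma> (sm c x) y = sm c (\<gamma> x y)" "\<gamma> x (sm c y) = sm c (\<gamma> x y)" "\<gamma> x 0 = 0" "\<gamma> 0 x = 0"
  using assms PMP.linear_add[of "\<lambda>x. \<gamma> x y" x x'] PMP.linear_scale[of "\<lambda>x. \<gamma> x y" c x]
    PMP.linear_0[of "\<lambda>y. \<gamma> y x"]
  by (auto simp: bilin_def PMP.linear_add PMP.linear_scale PMP.linear_0)

text \<open>The same sum for the deconcatenation coproduct.\<close>

fun deconc :: "('f::field V \<Rightarrow> 'f V \<Rightarrow> 'f V) \<Rightarrow> letter list \<Rightarrow> 'f V" where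
  "deconc \<gamma> [] = \<gamma> 1 1"
| "deconc \<gamma> (b # w) = \<gamma> 1 (wd (b # w)) + deconc (\<lambda>x y. \<gamma> (gen b * x) y) w"

lemma deconc_lincomb:
  "deconc (\<lambda>x y. \<gamma> x y + sm c (\<gamma>' x y)) w = deconc \<gamma> w + sm c (deconc \<gamma>' w)"
  by (induction w arbitrary: \<gamma> \<gamma>') (simp_all add: sm_simps algebra_simps)

lemma deconc_gen_mult:
  assumes "bilin \<gamma>"
  shows "lin_ext (deconc \<gamma>) (gen b * v) = \<gamma> 1 (gen b * v) + lin_ext (deconc (\<lambda>x y. \<gamma> (gen b * x) y)) v"
  by (induction v rule: word_induct) (simp_all add: distrib_left bilinD[OF assms] sm_simps)

text \<open>Deconcatenation is compatible with the shuffle product: the letter joins the first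
  factor, or crosses it at the cost of a twist and joins the second.\<close>

lemma deconc_ls:
  assumes "bilin \<gamma>" "q \<noteq> 0"
  shows "lin_ext (deconc \<gamma>) (ls q a (wd w)) =
    deconc (\<lambda>x y. \<gamma> (ls q a x) y + \<gamma> (tw q a x) (ls q a y)) w"
  using assms
proof (induction w arbitrary: \<gamma>)
  case Nil
  have "lin_ext (deconc \<gamma>) (gen a * 1) = \<gamma> 1 (gen a) + \<gamma> (gen a) 1"
    using Nil by (subst deconc_gen_mult) (simp_all add: one_eq_wd gen_def)
  then show ?case using Nil by (simp flip: one_eq_wd)
next
  case (Cons b w)
  define p where "p = q powi pairing a b"
  note bl = bilinD[OF Cons.prems(1)]
  let ?\<gamma>b = "\<lambda>x y. \<gamma> (gen b * x) y"
  have bb: "bilin ?\<gamma>b" "bilin (\<lambda>x y. \<gamma> (gen a * x) y)"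
    by (rule bilinI; simp add: bl distrib_left)+
  have "lin_ext (deconc \<gamma>) (ls q a (wd (b # w))) = lin_ext (deconc \<gamma>) (gen a * wd (b # w))
      + sm p (lin_ext (deconc \<gamma>) (gen b * ls q a (wd w)))"
    by (subst wd_Cons, subst ls_gen_mult) (simp add: p_def)
  also have "lin_ext (deconc \<gamma>) (gen b * ls q a (wd w)) = \<gamma> 1 (gen b * ls q a (wd w)) +
     deconc (\<lambda>x y. ?\<gamma>b (ls q a x) y + ?\<gamma>b (tw q a x) (ls q a y)) w"
    by (simp only: deconc_gen_mult[OF Cons.prems(1)] Cons.IH[OF bb(1) Cons.prems(2)])
  also have "lin_ext (deconc \<gamma>) (gen a * wd (b # w)) = \<gamma> 1 (gen a * wd (b # w)) +
     \<gamma> (gen a) (wd (b # w)) + deconc (\<lambda>x y. \<gamma> (gen a * (gen b * x)) y) w"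
    unfolding deconc_gen_mult[OF Cons.prems(1)] by simp
  also have "\<gamma> 1 (gen a * wd (b # w)) + \<gamma> (gen a) (wd (b # w)) + deconc (\<lambda>x y. \<gamma> (gen a * (gen b * x)) y) w
     + sm p (\<gamma> 1 (gen b * ls q a (wd w)) +
     deconc (\<lambda>x y. ?\<gamma>b (ls q a x) y + ?\<gamma>b (tw q a x) (ls q a y)) w)
    = \<gamma> 1 (ls q a (gen b * wd w)) + \<gamma> (gen a) (wd (b # w)) +
      deconc (\<lambda>x y. \<gamma> (gen a * (gen b * x)) y + sm p (?\<gamma>b (ls q a x) y + ?\<gamma>b (tw q a x) (ls q a y))) w"
    unfolding deconc_lincomb ls_gen_mult by (simp add: bl sm_simps p_def algebra_simps)
  also have "\<dots> = deconc (\<lambda>x y. \<gamma> (ls q a x) y + \<gamma> (tw q a x) (ls q a y)) (b # w)"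
    using Cons.prems(2)
    by (simp add: ls_gen_mult tw_gen_mult bl sm_simps p_def algebra_simps pairing_commute)
  finally show ?case .
qed

text \<open>
  Thus the sum over the coproduct of \<open>x\<close> vanishes when \<open>phi q x = 0\<close> and the summand factors
  through \<open>phi\<close>.
\<close>

lemma cop_phi:
  assumes "bilin \<gamma>" "q \<noteq> 0"
  shows "cop q (\<lambda>u v. \<gamma> (phi q (wd u)) (phi q (wd v))) w = lin_ext (deconc \<gamma>) (phi q (wd w))"
  using assms
proof (induction w arbitrary: \<gamma>)
  case Nil
  have "lin_ext (deconc \<gamma>) 1 = \<gamma> 1 1" by (simp add: one_eq_wd del: deconc.simps) (simp flip: one_eq_wd)
  then show ?case by (simp flip: one_eq_wd)
next
  case (Cons a w)
  note bl = bilinD[OF Cons.prems(1)]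
  let ?\<gamma> = "\<lambda>x y. \<gamma> (ls q a x) y + \<gamma> (tw q a x) (ls q a y)"
  have b: "bilin ?\<gamma>" by (rule bilinI) (simp_all add: bl algebra_simps sm_simps)
  have t: "tw q a (phi q (wd u)) = sm (q powi wt a u) (phi q (wd u))" for u
    using phi_tw[of q a "wd u"] Cons.prems by simp
  have g: "phi q (wd (a # u)) = ls q a (phi q (wd u))" for u
    by (simp add: wd_Cons del: gen_mult_wd)
  \<comment> \<open>\<open>deconc_ls\<close> extended by linearity; it turns the induction
    hypothesis for \<open>?\<gamma>\<close> into the claim for \<open>\<gamma>\<close>.\<close>
  have "lin_ext (deconc ?\<gamma>) v = lin_ext (deconc \<gamma>) (ls q a v)" for v
    by (induction v rule: word_induct) (use deconc_ls[OF Cons.prems] in simp_all)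
  then show ?case using Cons.IH[OF b Cons.prems(2)]
    by (simp add: g t bl)
qed

context qnz begin

text \<open>Braided antimultiplicativity: the first letter moves to the end, and crossing the rest
  gives the twist.\<close>

lemma anti_gen_mult: "anti q (gen a * v) = - (tw q a (anti q v) * gen a)"
proof (induction v rule: word_induct)
  case (wd w)
  show ?case by (simp add: anti_def power_int_add)
qed (simp_all add: algebra_simps sm_simps)

lemma ew_snoc: "ew (w @ [a]) = wt a w + ew w"
  by (induction w) (simp_all add: pairing_commute)

lemma anti_mult_gen: "anti q (v * gen a) = - (gen a * tw q a (anti q v))"
proof (induction v rule: word_induct)
  case (wd w)
  show ?case by (simp add: anti_def power_int_add ew_snoc)
qed (simp_all add: algebra_simps sm_simps)

lemma anti_gen: "anti q (gen a) = - gen a"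
  using anti_gen_mult[of a 1] by simp

text \<open>In this degree the exponent \<open>ew\<close> is \<open>(3 - 1)^2 - 4 = 0\<close> and
  the length is even, so \<open>anti q\<close> is plain reversal, which negates the Serre
  element.\<close>

lemma anti_serre: "anti q (serre q a (flip a)) = - serre q a (flip a)"
proof -
  have c: "q * (inverse q * c) = c" "inverse q * (q * c) = c" for c by simp_all
  show ?thesis
    by (simp add: c serre_def power2_eq_square power3_eq_cube anti_gen_mult anti_gen tw_mult sm_simps mult.assoc)
qed

lemma anti_J: "v \<in> J q \<Longrightarrow> anti q v \<in> J q"
proof -
  have la: "lin (anti q)" by (rule linI) simp_all
  note s = subspace_vimage[OF la subspace_J]
  have "J q \<subseteq> {v. anti q v \<in> J q}"
  proof (rule J_subsetI)
    show "u * v \<in> {v. anti q v \<in> J q}" if "v \<in> {v. anti q v \<in> J q}" for u v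
      by (rule gen_closed_mult[OF s _ that]) (auto simp: anti_gen_mult tw_J)
    show "v * u \<in> {v. anti q v \<in> J q}" if "v \<in> {v. anti q v \<in> J q}" for u v
      by (rule gen_closed_mult_right[OF s _ that]) (auto simp: anti_mult_gen tw_J)
  qed (auto simp: s anti_serre serre_in_J)
  then show "v \<in> J q \<Longrightarrow> anti q v \<in> J q" by auto
qed

text \<open>The terms cancel in pairs: the first letter of the word goes to the left or to the right
  factor, with opposite signs.\<close>

lemma cop_anti: "w \<noteq> [] \<Longrightarrow> cop q (\<lambda>u v. anti q (wd u) * wd v) w = 0"
proof (cases w)
  case (Cons a w')
  have "anti q (wd (a # u)) * wd v + sm (q powi wt a u) (anti q (wd u) * wd (a # v)) = 0" for u v
    by (simp add: anti_def power_int_add)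
  then show ?thesis unfolding Cons by (simp add: cop_zero)
qed simp

text \<open>The bound is strict, so \<open>Vlen 0\<close> is the zero space, where the inductions on
  length start.\<close>

definition Vlen :: "nat \<Rightarrow> 'f V set" where
  "Vlen n = {v. \<forall>w. lu v w \<noteq> 0 \<longrightarrow> length w < n}"

lemma subspace_Vlen: "PM.subspace (Vlen n)"
proof (rule PM.subspaceI)
  show "x + y \<in> Vlen n" if "x \<in> Vlen n" "y \<in> Vlen n" for x y
    unfolding Vlen_def
  proof (intro CollectI allI impI)
    fix w assume "lu (x + y) w \<noteq> 0"
    then have "lu x w \<noteq> 0 \<or> lu y w \<noteq> 0" by (auto simp: lookup_add)
    then show "length w < n" using that by (auto simp: Vlen_def)
  qed
qed (auto simp: Vlen_def)

lemma wd_Vlen: "length w < n \<Longrightarrow> wd w \<in> Vlen n"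
  by (simp add: Vlen_def lookup_wd)

text \<open>
  The summand \<open>\<beta>1\<close> gives \<open>0\<close> by the antipode axiom. Replacing both arguments by lifts of their images
  under \<open>phi\<close> gives \<open>\<beta>2\<close>, which also sums to \<open>0\<close>, and by assumption the two summands agree modulo \<open>J\<close>
  except at the two extreme terms of the coproduct.
\<close>

lemma anti_radical:
  assumes ker: "\<And>v. v \<in> Vlen n \<Longrightarrow> phi q v = 0 \<Longrightarrow> v \<in> J q"
    and n: "n > 0" and x: "\<And>w. lu x w \<noteq> 0 \<Longrightarrow> length w = n" "phi q x = 0"
  shows "anti q x + x \<in> J q"
proof -
  \<comment> \<open>A linear section of \<open>phi\<close> over the image of \<open>Vlen n\<close>;
    it provides the lifts.\<close>
  obtain g where g: "range g \<subseteq> Vlen n" "lin g" "\<And>v. v \<in> phi q ` Vlen n \<Longrightarrow> phi q (g v) = v"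
    using PMP.linear_exists_right_inverse_on[OF lin_ops(9)[of q] subspace_Vlen[of n]]
    by (elim exE conjE) (rule that, auto)
  note gs = PMP.linear_add[OF g(2)] PMP.linear_scale[OF g(2)] PMP.linear_diff[OF g(2)] PMP.linear_0[OF g(2)]
  have gphi: "g (phi q v) - v \<in> J q" if "v \<in> Vlen n" for v
  proof (rule ker)
    have "g (phi q v) \<in> Vlen n" using g(1) by auto
    then show "g (phi q v) - v \<in> Vlen n" using that PM.subspace_diff[OF subspace_Vlen] by blast
    show "phi q (g (phi q v) - v) = 0" using that g(3)[of "phi q v"] by simp
  qed
  define \<gamma> where "\<gamma> u v = anti q (g u) * g v" for u v
  have bl: "bilin \<gamma>"
    unfolding \<gamma>_def by (rule bilinI) (simp_all add: gs algebra_simps)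
  let ?\<beta>1 = "\<lambda>u v. anti q (wd u) * wd v"
  let ?\<beta>2 = "\<lambda>u v. \<gamma> (phi q (wd u)) (phi q (wd v))"
  let ?\<beta> = "\<lambda>u v. ?\<beta>1 u v - ?\<beta>2 u v"
  have J: "?\<beta> u v \<in> J q" if "length u < n" "length v < n" for u v
  proof -
    have "anti q (g (phi q (wd u)) - wd u) \<in> J q" "g (phi q (wd v)) - wd v \<in> J q"
      using that by (auto simp del: anti_simps intro!: anti_J gphi wd_Vlen)
    \<comment> \<open>The difference of two products, changed one factor at a time.\<close>
    then have "- (anti q (g (phi q (wd u)) - wd u) * g (phi q (wd v)))
       - anti q (wd u) * (g (phi q (wd v)) - wd v) \<in> J q"
      by blast
    then show ?thesis by (simp add: \<gamma>_def algebra_simps)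
  qed
  have "cop q ?\<beta> w - (?\<beta> w [] + ?\<beta> [] w) \<in> J q" if "lu x w \<noteq> 0" for w
    using x(1)[OF that] n by (intro cop_interior J) (auto simp flip: length_greater_0_conv)
  then have "lin_ext (\<lambda>w. cop q ?\<beta> w - (?\<beta> w [] + ?\<beta> [] w)) x \<in> J q"
    unfolding lin_ext_def by (intro PM.subspace_sum subspace_J) (auto simp: in_keys_iff)
  \<comment> \<open>The extreme terms of \<open>?\<beta>1\<close> give \<open>anti q x + x\<close>;
    those of \<open>?\<beta>2\<close> contain \<open>phi q x\<close> and vanish in the end.\<close>
  moreover have "lin_ext (\<lambda>w. cop q ?\<beta> w - (?\<beta> w [] + ?\<beta> [] w)) x =
     lin_ext (cop q ?\<beta>1) x - lin_ext (cop q ?\<beta>2) x - (anti q x + x)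
     + \<gamma> (phi q x) (phi q (wd [])) + \<gamma> (phi q (wd [])) (phi q x)"
  proof (rule lin_eqI[of "lin_ext _" "\<lambda>x. lin_ext (cop q ?\<beta>1) x - lin_ext (cop q ?\<beta>2) x - (anti q x + x)
     + \<gamma> (phi q x) (phi q (wd [])) + \<gamma> (phi q (wd [])) (phi q x)"])
    show "lin (\<lambda>x. lin_ext (cop q ?\<beta>1) x - lin_ext (cop q ?\<beta>2) x - (anti q x + x)
     + \<gamma> (phi q x) (phi q (wd [])) + \<gamma> (phi q (wd [])) (phi q x))"
      by (rule linI) (simp_all add: bilinD[OF bl] sm_simps algebra_simps)
  qed (simp_all add: lin_lin_ext cop_diff algebra_simps flip: one_eq_wd)
  moreover have "lin_ext (cop q ?\<beta>1) x = 0"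
    unfolding lin_ext_def
  proof (rule sum.neutral, rule ballI)
    fix w assume "w \<in> Poly_Mapping.keys x"
    then have "w \<noteq> []" using x(1)[of w] n by (auto simp: in_keys_iff)
    then show "sm (lu x w) (cop q ?\<beta>1 w) = 0" by (simp add: cop_anti)
  qed
  moreover have "lin_ext (cop q ?\<beta>2) v = lin_ext (deconc \<gamma>) (phi q v)" for v
    by (induction v rule: word_induct) (simp_all add: cop_phi[OF bl])
  ultimately have "- (anti q x + x) \<in> J q"
    using x(2) by (simp add: bilinD[OF bl])
  then have "- (- (anti q x + x)) \<in> J q" by (rule J_closed)
  then show ?thesis by (simp only: minus_minus)
qed

end

section \<open>Elements killed by all skew derivations\<close>

context qnz begin

lemma ad_pow_simps [simp]:
  "(ad q a ^^ k) (u + v) = (ad q a ^^ k) u + (ad q a ^^ k) v"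
  "(ad q a ^^ k) (sm c v) = sm c ((ad q a ^^ k) v)" "(ad q a ^^ k) 0 = 0"
  by (induction k) simp_all

lemma ad_pow_J: "v \<in> J q \<Longrightarrow> (ad q a ^^ k) v \<in> J q"
  by (induction k) (simp_all add: ad_J)

lemma ad_pow_J_mono: "(ad q a ^^ k) v \<in> J q \<Longrightarrow> k \<le> m \<Longrightarrow> (ad q a ^^ m) v \<in> J q"
  using ad_pow_J[of "(ad q a ^^ k) v" "m - k" a] funpow_add[of "m - k" k "ad q a"] by simp

text \<open>The kernel of \<open>dr q a\<close> modulo \<open>J q\<close>, restricted to elements on
  which \<open>ad q a\<close> is nilpotent modulo \<open>J q\<close>. By \<open>ad_nil_if_dr\<close>
  the first condition implies the second.\<close>

definition ad_nil :: "letter \<Rightarrow> 'f V set" where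
  "ad_nil a = {v. dr q a v \<in> J q \<and> (\<exists>k. (ad q a ^^ k) v \<in> J q)}"

lemma subspace_ad_nil: "PM.subspace (ad_nil a)"
proof (rule PM.subspaceI)
  fix u v assume "u \<in> ad_nil a" "v \<in> ad_nil a"
  then obtain k m where "dr q a u \<in> J q" "dr q a v \<in> J q" "(ad q a ^^ k) u \<in> J q" "(ad q a ^^ m) v \<in> J q"
    by (auto simp: ad_nil_def)
  then have "(ad q a ^^ (max k m)) (u + v) \<in> J q" "dr q a (u + v) \<in> J q"
    using ad_pow_J_mono[of k a u "max k m"] ad_pow_J_mono[of m a v "max k m"] by simp_all
  then show "u + v \<in> ad_nil a" unfolding ad_nil_def by blast
qed (auto simp: ad_nil_def)

lemma ad_nil_J: "v \<in> J q \<Longrightarrow> v \<in> ad_nil a"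
  unfolding ad_nil_def by (auto simp: dr_J intro: exI[of _ 0])

lemma ad_nil_1: "1 \<in> ad_nil a"
  unfolding ad_nil_def by (auto intro: exI[of _ 1])

lemma ad_nil_ad: "v \<in> ad_nil a \<Longrightarrow> ad q a v \<in> ad_nil a"
  unfolding ad_nil_def
proof clarify
  fix k assume "dr q a v \<in> J q" "(ad q a ^^ k) v \<in> J q"
  then show "dr q a (ad q a v) \<in> J q \<and> (\<exists>k. (ad q a ^^ k) (ad q a v) \<in> J q)"
    using ad_pow_J_mono[of k a v "Suc k"]
    by (auto simp: dr_ad_same tw_J funpow_swap1 intro: exI[of _ k])
qed

lemma ad_pow_tw: "(ad q a ^^ k) (tw q a v) = sm (inverse (q^2) ^ k) (tw q a ((ad q a ^^ k) v))"
  by (induction k) (simp_all add: tw_ad mult_ac)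

lemma ad_nil_tw: "v \<in> ad_nil a \<Longrightarrow> tw q a v \<in> ad_nil a"
  unfolding ad_nil_def
proof clarify
  fix k assume "dr q a v \<in> J q" "(ad q a ^^ k) v \<in> J q"
  then show "dr q a (tw q a v) \<in> J q \<and> (\<exists>k. (ad q a ^^ k) (tw q a v) \<in> J q)"
    by (auto simp: dr_tw ad_pow_tw tw_J intro!: exI[of _ k])
qed

text \<open>A further commutator on the left factor gives the Serre element, so modulo
  \<open>J q\<close> all powers of \<open>ad q a\<close> act on \<open>c\<close>.\<close>

lemma ad_pow_mult2: "(ad q a ^^ k) c \<in> J q \<Longrightarrow> (ad q a ^^ k) (ad q a (ad q a (gen (flip a))) * c) \<in> J q"
proof (induction k arbitrary: c)
  case (Suc k)
  have "ad q a (ad q a (ad q a (gen (flip a))) * c) =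
      serre q a (flip a) * c + sm (q^2) (ad q a (ad q a (gen (flip a))) * ad q a c)"
    by (simp add: ad_mult serre_ad tw_ad)
  moreover have "(ad q a ^^ k) (serre q a (flip a) * c) \<in> J q"
    by (intro ad_pow_J J_closed serre_in_J)
  ultimately show ?case using Suc by (simp add: funpow_Suc_right del: funpow.simps)
qed simp

text \<open>One application of \<open>ad q a\<close> may be spent on the left factor, leading to
  \<open>ad_pow_mult2\<close>; hence one extra power.\<close>

lemma ad_pow_mult1: "(ad q a ^^ k) c \<in> J q \<Longrightarrow> (ad q a ^^ Suc k) (ad q a (gen (flip a)) * c) \<in> J q"
proof (induction k arbitrary: c)
  case 0
  then show ?case by (simp add: ad_J)
next
  case (Suc k)
  have "ad q a (ad q a (gen (flip a)) * c) =
      ad q a (ad q a (gen (flip a))) * c + ad q a (gen (flip a)) * ad q a c"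
    by (simp add: ad_mult tw_ad)
  moreover have "(ad q a ^^ Suc k) (ad q a (ad q a (gen (flip a))) * c) \<in> J q"
    by (rule ad_pow_mult2[OF Suc.prems])
  moreover have "(ad q a ^^ Suc k) (ad q a (gen (flip a)) * ad q a c) \<in> J q"
    by (rule Suc.IH) (use Suc.prems in \<open>simp add: funpow_Suc_right del: funpow.simps\<close>)
  ultimately show ?case by (subst funpow_Suc_right) simp
qed

text \<open>The letter itself can absorb two applications of \<open>ad q a\<close> modulo
  \<open>J q\<close>.\<close>

lemma ad_pow_mult0: "(ad q a ^^ k) c \<in> J q \<Longrightarrow> (ad q a ^^ Suc (Suc k)) (gen (flip a) * c) \<in> J q"
proof (induction k arbitrary: c)
  case 0
  then show ?case by (simp add: ad_J)
next
  case (Suc k)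
  have "ad q a (gen (flip a) * c) =
      ad q a (gen (flip a)) * c + sm (inverse (q^2)) (gen (flip a) * ad q a c)"
    by (simp add: ad_mult)
  moreover have "(ad q a ^^ Suc (Suc k)) (ad q a (gen (flip a)) * c) \<in> J q"
    by (rule ad_pow_mult1[OF Suc.prems])
  moreover have "(ad q a ^^ Suc (Suc k)) (gen (flip a) * ad q a c) \<in> J q"
    by (rule Suc.IH) (use Suc.prems in \<open>simp add: funpow_Suc_right del: funpow.simps\<close>)
  ultimately show ?case by (subst funpow_Suc_right) (simp del: funpow.simps)
qed

lemma ad_nil_gen_flip: "c \<in> ad_nil a \<Longrightarrow> gen (flip a) * c \<in> ad_nil a"
  unfolding ad_nil_def
proof clarify
  fix k assume "dr q a c \<in> J q" "(ad q a ^^ k) c \<in> J q"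
  then show "dr q a (gen (flip a) * c) \<in> J q \<and> (\<exists>k. (ad q a ^^ k) (gen (flip a) * c) \<in> J q)"
    using ad_pow_mult0[of k a c] by (auto simp: dr_mult dr_gen simp del: funpow.simps)
qed

text \<open>
  The right derivation separates the powers of \<open>gen a\<close> here, so its kernel modulo \<open>J\<close> is \<open>ad_nil a\<close>.
\<close>

lemma ad_nil_sums:
  fixes v :: "'f V"
  obtains n c where "\<And>i. c i \<in> ad_nil a" "v = (\<Sum>i<n. c i * gen a ^ i)"
proof -
  let ?W = "PM.span {c * gen a ^ i |c i. c \<in> ad_nil a}"
  have "u * 1 \<in> ?W" for u
  proof (rule gen_closed_mult)
    show "1 \<in> ?W" using ad_nil_1 by (auto intro!: PM.span_base exI[of _ "1"] exI[of _ "0::nat"])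
    fix b and v :: "'f V" assume "v \<in> ?W"
    then show "gen b * v \<in> ?W"
    proof (induction rule: PM.span_induct)
      case base
      show ?case
        by (rule PM.subspaceI) (auto simp: distrib_left intro: PM.span_add PM.span_scale PM.span_zero)
    next
      case (step x)
      then obtain c i where x: "x = c * gen a ^ i" "c \<in> ad_nil a" by auto
      consider "b = flip a" | "b = a" using letter_flip[of b a] by blast
      then show ?case
      proof cases
        case 1
        then have "gen b * x = (gen (flip a) * c) * gen a ^ i" by (simp add: x mult.assoc)
        then show ?thesis using ad_nil_gen_flip[OF x(2)] by (auto intro!: PM.span_base)
      next
        case 2
        \<comment> \<open>The definition of \<open>ad\<close>, read as a rule for moving
          \<open>gen a\<close> to the right across \<open>c\<close>.\<close>
        have "gen b * x = ad q a c * gen a ^ i + tw q a c * gen a ^ Suc i"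
          by (simp add: x 2 ad_def algebra_simps)
        moreover have "ad q a c * gen a ^ i \<in> ?W" "tw q a c * gen a ^ Suc i \<in> ?W"
          using ad_nil_ad[OF x(2)] ad_nil_tw[OF x(2)] by (blast intro: PM.span_base)+
        ultimately show ?thesis by (simp only: PM.span_add)
      qed
    qed
  qed simp
  from this[of v] have "v \<in> ?W" by (simp only: mult_1_right)
  \<comment> \<open>The zero tail of \<open>c\<close> lets expansions of different lengths be
    added.\<close>
  then have "\<exists>n c. (\<forall>i. c i \<in> ad_nil a) \<and> (\<forall>i\<ge>n. c i = 0) \<and> v = (\<Sum>i<n. c i * gen a ^ i)"
  proof (induction rule: PM.span_induct)
    case base
    show ?case
    proof (rule PM.subspaceI)
      show "0 \<in> {x. \<exists>n c. (\<forall>i. c i \<in> ad_nil a) \<and> (\<forall>i\<ge>n. c i = 0) \<and> x = (\<Sum>i<n. c i * gen a ^ i)}"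
        by (auto intro!: exI[of _ 0] exI[of _ "\<lambda>i. 0"] simp: ad_nil_J)
    next
      fix x y
      assume "x \<in> {x. \<exists>n c. (\<forall>i. c i \<in> ad_nil a) \<and> (\<forall>i\<ge>n. c i = 0) \<and> x = (\<Sum>i<n. c i * gen a ^ i)}"
        and "y \<in> {x. \<exists>n c. (\<forall>i. c i \<in> ad_nil a) \<and> (\<forall>i\<ge>n. c i = 0) \<and> x = (\<Sum>i<n. c i * gen a ^ i)}"
      then obtain n c m d where
        c: "\<And>i. c i \<in> ad_nil a" "\<And>i. i \<ge> n \<Longrightarrow> c i = 0" "x = (\<Sum>i<n. c i * gen a ^ i)" and
        d: "\<And>i. d i \<in> ad_nil a" "\<And>i. i \<ge> m \<Longrightarrow> d i = 0" "y = (\<Sum>i<m. d i * gen a ^ i)"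
        by auto
      have "x = (\<Sum>i<max n m. c i * gen a ^ i)" "y = (\<Sum>i<max n m. d i * gen a ^ i)"
        unfolding c(3) d(3) by (rule sum.mono_neutral_left; use c(2) d(2) in auto)+
      then have "x + y = (\<Sum>i<max n m. (c i + d i) * gen a ^ i)"
        by (simp add: distrib_right sum.distrib)
      moreover have "\<forall>i. c i + d i \<in> ad_nil a" "\<forall>i\<ge>max n m. c i + d i = 0"
        using c d PM.subspace_add[OF subspace_ad_nil] by auto
      ultimately show "x + y \<in> {x. \<exists>n c. (\<forall>i. c i \<in> ad_nil a) \<and> (\<forall>i\<ge>n. c i = 0) \<and> x = (\<Sum>i<n. c i * gen a ^ i)}"
        by (intro CollectI exI[of _ "max n m"] exI[of _ "\<lambda>i. c i + d i"]) blast
    next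
      fix r x
      assume "x \<in> {x. \<exists>n c. (\<forall>i. c i \<in> ad_nil a) \<and> (\<forall>i\<ge>n. c i = 0) \<and> x = (\<Sum>i<n. c i * gen a ^ i)}"
      then obtain n c where
        c: "\<And>i. c i \<in> ad_nil a" "\<And>i. i \<ge> n \<Longrightarrow> c i = 0" "x = (\<Sum>i<n. c i * gen a ^ i)"
        by auto
      then show "sm r x \<in> {x. \<exists>n c. (\<forall>i. c i \<in> ad_nil a) \<and> (\<forall>i\<ge>n. c i = 0) \<and> x = (\<Sum>i<n. c i * gen a ^ i)}"
        using PM.subspace_scale[OF subspace_ad_nil]
        by (intro CollectI exI[of _ n] exI[of _ "\<lambda>i. sm r (c i)"]) (auto simp: PM.scale_sum_right)
    qed
  next
    case (step x)
    then obtain c i where x: "x = c * gen a ^ i" "c \<in> ad_nil a" by auto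
    have "x = (\<Sum>j<Suc i. (if j = i then c else 0) * gen a ^ j)"
      by (simp add: x if_distrib cong: if_cong)
    then show ?case using x
      by (intro exI[of _ "Suc i"] exI[of _ "\<lambda>j. if j = i then c else 0"]) (auto simp: ad_nil_J)
  qed
  then show thesis using that by blast
qed

section \<open>Powers of a letter and their skew derivatives\<close>

definition qn :: "nat \<Rightarrow> 'f" where "qn n = (\<Sum>i<n. (q^2)^i)"

text \<open>If this geometric sum vanished, \<open>q ^ (2 * Suc n)\<close> would be
  \<open>1\<close>.\<close>

lemma qn_Suc_nonzero: "qn (Suc n) \<noteq> 0"
proof
  assume "qn (Suc n) = 0"
  then have "(q^2)^(Suc n) = 1" using power_diff_1_eq[of "q^2" "Suc n"] by (simp add: qn_def)
  then have "q ^ (2 * Suc n) = 1" by (simp only: power_mult)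
  then show False using q_root[of "2 * Suc n"] by simp
qed

lemma tw_gen_power: "tw q a (gen a ^ i) = sm ((q^2)^i) (gen a ^ i)"
  by (induction i) (simp_all add: tw_mult mult.commute)

lemma dr_gen_power: "dr q a (gen a ^ Suc i) = sm (qn (Suc i)) (gen a ^ i)"
proof (induction i)
  case 0
  then show ?case by (simp add: qn_def dr_gen)
next
  case (Suc i)
  have "dr q a (gen a ^ Suc (Suc i)) = gen a * dr q a (gen a ^ Suc i) + tw q a (gen a ^ Suc i)"
    by (subst power_Suc, subst dr_mult) (simp_all add: dr_gen)
  then show ?case unfolding Suc tw_gen_power
    by (simp add: qn_def PM.scale_left_distrib algebra_simps)
qed

text \<open>Modulo \<open>J q\<close> the coefficients are constants for \<open>dr q a\<close>, so
  the sum is differentiated like a polynomial in \<open>gen a\<close>.\<close>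

lemma dr_sum:
  assumes "\<And>i. c i \<in> ad_nil a"
  shows "dr q a (\<Sum>i<Suc n. c i * gen a ^ i) - (\<Sum>i<n. sm (qn (Suc i)) (c (Suc i)) * gen a ^ i) \<in> J q"
proof -
  have J: "dr q a (c i) * w \<in> J q" for i w using assms by (auto simp: ad_nil_def)
  have s: "dr q a (\<Sum>i\<in>I. f i) = (\<Sum>i\<in>I. dr q a (f i))" for f and I :: "nat set"
    by (rule PMP.linear_sum[OF lin_ops(8)])
  have "dr q a (\<Sum>i<Suc n. c i * gen a ^ i) - (\<Sum>i<n. sm (qn (Suc i)) (c (Suc i)) * gen a ^ i)
     = (\<Sum>i<Suc n. dr q a (c i) * tw q a (gen a ^ i))"
    by (simp only: sum.lessThan_Suc_shift)
       (simp add: s dr_mult dr_gen_power sum.distrib del: power_Suc)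
  also have "\<dots> \<in> J q" by (intro PM.subspace_sum subspace_J J)
  finally show ?thesis .
qed

text \<open>Independence of the powers of \<open>gen a\<close> over \<open>ad_nil a\<close> modulo
  \<open>J q\<close>: differentiation lowers the degree, and the factors \<open>qn (Suc i)\<close>
  are invertible.\<close>

lemma sum_in_J:
  assumes "\<And>i. c i \<in> ad_nil a" "(\<Sum>i<n. c i * gen a ^ i) \<in> J q" "i < n"
  shows "c i \<in> J q"
  using assms
proof (induction n arbitrary: c i)
  case (Suc n)
  have *: "c (Suc i) \<in> J q" if "i < n" for i
  proof -
    have "sm (qn (Suc i)) (c (Suc i)) \<in> J q"
    proof (rule Suc.IH[of "\<lambda>i. sm (qn (Suc i)) (c (Suc i))", OF _ _ that])
      show "sm (qn (Suc i)) (c (Suc i)) \<in> ad_nil a" for i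
        using Suc.prems(1) PM.subspace_scale[OF subspace_ad_nil] by auto
      have "dr q a (\<Sum>i<Suc n. c i * gen a ^ i) -
          (dr q a (\<Sum>i<Suc n. c i * gen a ^ i) - (\<Sum>i<n. sm (qn (Suc i)) (c (Suc i)) * gen a ^ i)) \<in> J q"
        by (rule J_closed(3)[OF dr_J[OF Suc.prems(2)] dr_sum[OF Suc.prems(1)]])
      then show "(\<Sum>i<n. sm (qn (Suc i)) (c (Suc i)) * gen a ^ i) \<in> J q"
        by (simp only: diff_diff_eq2 add_diff_cancel_left')
    qed
    then have "sm (inverse (qn (Suc i))) (sm (qn (Suc i)) (c (Suc i))) \<in> J q" by (rule J_closed)
    then show ?thesis by (simp add: qn_Suc_nonzero del: sum.lessThan_Suc)
  qed
  have "(\<Sum>i<Suc n. c i * gen a ^ i) = c 0 + (\<Sum>i<n. c (Suc i) * gen a ^ Suc i)"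
    by (subst sum.lessThan_Suc_shift) simp
  moreover have "(\<Sum>i<n. c (Suc i) * gen a ^ Suc i) \<in> J q"
    by (intro PM.subspace_sum subspace_J J_closed *) simp
  ultimately have "c 0 \<in> J q"
    using J_closed(3)[OF Suc.prems(2), of "\<Sum>i<n. c (Suc i) * gen a ^ Suc i"]
    by (simp only: add_diff_cancel_right')
  then show ?case using * Suc.prems(3) by (cases i) auto
qed simp

text \<open>Differentiating an expansion from \<open>ad_nil_sums\<close> shows that all coefficients
  after the first lie in \<open>J q\<close>; only \<open>c 0\<close> is left.\<close>

lemma ad_nil_if_dr:
  assumes "dr q a x \<in> J q"
  shows "x \<in> ad_nil a"
proof -
  obtain n c where c: "\<And>i. c i \<in> ad_nil a" "x = (\<Sum>i<n. c i * gen a ^ i)"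
    using ad_nil_sums[of a x] by blast
  show ?thesis
  proof (cases n)
    case 0
    then show ?thesis using c by (simp add: ad_nil_J)
  next
    case (Suc m)
    have c': "sm (qn (Suc i)) (c (Suc i)) \<in> ad_nil a" for i
      using c(1) PM.subspace_scale[OF subspace_ad_nil] by auto
    have "dr q a x - (dr q a x - (\<Sum>i<m. sm (qn (Suc i)) (c (Suc i)) * gen a ^ i)) \<in> J q"
      using J_closed(3)[OF assms] dr_sum[where n = m and c = c, OF c(1)] unfolding c(2) Suc by blast
    then have "(\<Sum>i<m. sm (qn (Suc i)) (c (Suc i)) * gen a ^ i) \<in> J q"
      by (simp only: diff_diff_eq2 add_diff_cancel_left')
    then have "sm (qn (Suc i)) (c (Suc i)) \<in> J q" if "i < m" for i
      using sum_in_J[of "\<lambda>i. sm (qn (Suc i)) (c (Suc i))", OF c' _ that] by simp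
    then have "sm (inverse (qn (Suc i))) (sm (qn (Suc i)) (c (Suc i))) \<in> J q" if "i < m" for i
      using that J_closed(5) by blast
    then have "c (Suc i) \<in> J q" if "i < m" for i
      using that by (simp add: qn_Suc_nonzero)
    then have "(\<Sum>i<m. c (Suc i) * gen a ^ Suc i) \<in> J q"
      by (intro PM.subspace_sum subspace_J J_closed) simp
    moreover have "x = c 0 + (\<Sum>i<m. c (Suc i) * gen a ^ Suc i)"
      unfolding c(2) Suc by (subst sum.lessThan_Suc_shift) simp
    ultimately show ?thesis using c(1)[of 0] ad_nil_J PM.subspace_add[OF subspace_ad_nil] by blast
  qed
qed

text \<open>An argument as for singular vectors of \<open>sl2\<close>. The string
  \<open>ad^j x\<close> ends in \<open>J q\<close> by \<open>ad_nil_if_dr\<close>, and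
  \<open>dl q a\<close> leads back down to \<open>x\<close> with nonzero factors.\<close>

lemma positive_weight_radical:
  assumes dl: "dl q a x \<in> J q" and dr: "dr q a x \<in> J q" and wt: "tw q a x = sm (q ^ k) x" and k: "k > 0"
  shows "x \<in> J q"
proof -
  define X where "X j = (ad q a ^^ j) x" for j
  have X: "X 0 = x" "X (Suc j) = ad q a (X j)" for j by (simp_all add: X_def)
  \<comment> \<open>Solves the recursion \<open>kap\<close>: each step multiplies by
    \<open>q^2\<close> and adds the term \<open>1 - q^(2k + 4(j + 1))\<close> coming from
    \<open>dl_ad_same\<close>.\<close>
  define \<kappa> where "\<kappa> j = (q ^ (2*j+2) - 1) * (1 - q ^ (2*k+2*j)) / (q^2 - 1)" for j
  have twX: "tw q a (X j) = sm (q ^ (k + 2 * j)) (X j)" for j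
    by (induction j) (simp_all add: X wt tw_ad power2_eq_square mult_ac)
  have q21: "q^2 - 1 \<noteq> 0" using q2 by (metis eq_iff_diff_eq_0)
  have kap: "(1 - q ^ (2*k+4*Suc j)) + q^2 * \<kappa> j = \<kappa> (Suc j)" for j
  proof -
    have "((1 - q ^ (2*k+4*Suc j)) + q^2 * \<kappa> j) * (q^2 - 1) = (1 - q ^ (2*k+4*Suc j)) * (q^2 - 1)
        + q^2 * ((q ^ (2*j+2) - 1) * (1 - q ^ (2*k+2*j)))"
      using q21 by (simp add: \<kappa>_def distrib_right)
    also have "\<dots> = (q ^ (2*Suc j+2) - 1) * (1 - q ^ (2*k+2*Suc j))"
      by (simp add: algebra_simps power_add power2_eq_square numeral_eq_Suc)
    finally show ?thesis using q21 by (simp add: \<kappa>_def eq_divide_eq)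
  qed
  have dlX: "dl q a (X (Suc j)) - sm (\<kappa> j) (X j) \<in> J q" for j
  proof (induction j)
    case 0
    have "\<kappa> 0 = 1 - q ^ k * q ^ k" using q21 by (simp add: \<kappa>_def mult_2 power_add power2_eq_square)
    then have "dl q a (X (Suc 0)) - sm (\<kappa> 0) (X 0) = sm (q^2) (ad q a (dl q a x))"
      by (simp add: X dl_ad_same wt PM.scale_left_diff_distrib)
    then show ?case using ad_J[OF dl] by simp
  next
    case (Suc j)
    have "dl q a (X (Suc (Suc j))) - sm (\<kappa> (Suc j)) (X (Suc j)) =
       sm (q^2) (ad q a (dl q a (X (Suc j)) - sm (\<kappa> j) (X j)))"
      unfolding kap[symmetric]
      by (simp add: X(2)[of "Suc j"] dl_ad_same twX)
         (simp add: X(2)[of j, symmetric] PM.scale_left_diff_distrib PM.scale_left_distrib sm_simps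
            power_add[symmetric] algebra_simps, simp add: power_add[of q 4] power4_eq_xxxx mult.assoc)
    then show ?case using ad_J[OF Suc] by simp
  qed
  \<comment> \<open>Positivity of \<open>k\<close> matters for the second factor at
    \<open>j = 0\<close>.\<close>
  have kap0: "\<kappa> j \<noteq> 0" for j
    using q21 q_root[of "2*j+2"] q_root[of "2*k+2*j"] k by (simp add: \<kappa>_def)
  have down: "X j \<in> J q" if "X (Suc j) \<in> J q" for j
  proof -
    have "dl q a (X (Suc j)) - (dl q a (X (Suc j)) - sm (\<kappa> j) (X j)) \<in> J q"
      by (rule J_closed(3)[OF dl_J[OF that] dlX])
    then have "sm (\<kappa> j) (X j) \<in> J q" by (simp only: diff_diff_eq2 add_diff_cancel_left')
    then have "sm (inverse (\<kappa> j)) (sm (\<kappa> j) (X j)) \<in> J q" by (rule J_closed(5))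
    then show ?thesis using kap0 by simp
  qed
  obtain j where "X j \<in> J q" using ad_nil_if_dr[OF dr] by (auto simp: ad_nil_def X_def)
  then have "X 0 \<in> J q"
  proof (induction j)
    case (Suc j)
    show ?case by (rule Suc.IH[OF down[OF Suc.prems]])
  qed
  then show ?thesis by (simp add: X)
qed

end

section \<open>The kernel of the map to the q-shuffle algebra\<close>

lemma lin_image_subspace:
  assumes "lin f" "PM.subspace S" "\<And>w. lu v w \<noteq> 0 \<Longrightarrow> f (wd w) \<in> S"
  shows "f (v :: 'x list \<Rightarrow>\<^sub>0 'f::field) \<in> S"
proof -
  have "f v = (\<Sum>w\<in>Poly_Mapping.keys v. sm (lu v w) (f (wd w)))"
    by (subst wd_expansion[of v, symmetric])
       (simp add: PMP.linear_sum[OF assms(1)] PMP.linear_scale[OF assms(1)])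
  also have "\<dots> \<in> S"
    using assms(3) by (intro PM.subspace_sum assms(2) PM.subspace_scale) (simp add: in_keys_iff)
  finally show ?thesis .
qed

section \<open>The grading by length and weight\<close>

definition proj :: "(letter list \<Rightarrow> bool) \<Rightarrow> 'f::field V \<Rightarrow> 'f V" where
  "proj P = lin_ext (\<lambda>w. if P w then wd w else 0)"

lemma lookup_proj: "lu (proj P v) w = (if P w then lu v w else 0)"
  by (induction v rule: word_induct) (auto simp: proj_def lookup_wd lookup_add)

text \<open>Equivalent to the numbers \<open>r\<close> and \<open>s\<close> of letters
  \<open>A\<close> and \<open>B\<close>, since it is the pair
  \<open>(r + s, 2 (r - s))\<close>.\<close>

definition dg :: "letter list \<Rightarrow> nat \<times> int" where
  "dg w = (length w, wt LA w)"

definition gr :: "nat \<times> int \<Rightarrow> 'f::field V set" where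
  "gr d = {v. \<forall>w. lu v w \<noteq> 0 \<longrightarrow> dg w = d}"

lemma subspace_gr: "PM.subspace (gr d)"
proof (rule PM.subspaceI)
  show "x + y \<in> gr d" if "x \<in> gr d" "y \<in> gr d" for x y
    unfolding gr_def
  proof (intro CollectI allI impI)
    fix w assume "lu (x + y) w \<noteq> 0"
    then have "lu x w \<noteq> 0 \<or> lu y w \<noteq> 0" by (auto simp: lookup_add)
    then show "dg w = d" using that by (auto simp: gr_def)
  qed
qed (auto simp: gr_def)

lemma wd_gr [simp]: "wd w \<in> gr (dg w)"
  by (simp add: gr_def lookup_wd)

lemma gen_mult_gr: "v \<in> gr (n, k) \<Longrightarrow> gen a * v \<in> gr (Suc n, k + pairing a LA)"
proof -
  assume v: "v \<in> gr (n, k)"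
  have "lin ((*) (gen a) :: 'a V \<Rightarrow> 'a V)" by (rule linI) (simp_all add: distrib_left)
  then show ?thesis
  proof (rule lin_image_subspace[OF _ subspace_gr])
    fix w assume "lu v w \<noteq> 0"
    then have "dg (a # w) = (Suc n, k + pairing a LA)" using v by (auto simp: gr_def dg_def)
    then show "gen a * wd w \<in> gr (Suc n, k + pairing a LA)" using wd_gr[of "a # w"] by simp
  qed
qed

lemma ls_gr: "ls q a (wd w) \<in> gr (Suc (length w), wt LA w + pairing a LA)"
proof (induction w)
  case Nil
  have "wd [a] \<in> gr (dg [a])" by (rule wd_gr)
  then show ?case by (simp add: ls_Nil dg_def)
next
  case (Cons b w)
  have "wd (a # b # w) \<in> gr (dg (a # b # w))" by (rule wd_gr)
  then show ?case
    unfolding wd_Cons ls_gen_mult using gen_mult_gr[OF Cons, of b]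
    by (auto simp: dg_def algebra_simps intro!: PM.subspace_add[OF subspace_gr] PM.subspace_scale[OF subspace_gr])
qed

lemma phi_gr: "phi q (wd w) \<in> gr (dg w)"
proof (induction w)
  case Nil
  show ?case using wd_gr[of "[]"] by (simp flip: one_eq_wd)
next
  case (Cons a w)
  have "ls q a (phi q (wd w)) \<in> gr (dg (a # w))"
  proof (rule lin_image_subspace[OF lin_ops(3) subspace_gr])
    fix x assume "lu (phi q (wd w)) x \<noteq> 0"
    then have "dg x = dg w" using Cons by (auto simp: gr_def)
    then show "ls q a (wd x) \<in> gr (dg (a # w))"
      using ls_gr[of q a x] by (simp add: dg_def add.commute)
  qed
  then show ?case by (simp add: wd_Cons del: gen_mult_wd)
qed

text \<open>\<open>phi\<close> preserves the degree, so its kernel is spanned by homogeneous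
  elements.\<close>

lemma phi_proj:
  fixes v :: "'f::field V"
  shows "phi q (proj (\<lambda>w. dg w = d) v) = proj (\<lambda>w. dg w = d) (phi q v)"
proof -
  let ?p = "proj (\<lambda>w. dg w = d) :: 'f V \<Rightarrow> 'f V"
  have lp: "lin ?p" by (simp add: proj_def lin_lin_ext)
  have p: "?p x = (if d' = d then x else 0)" if "x \<in> gr d'" for d' and x :: "'f V"
    using that by (auto intro!: poly_mapping_eqI simp: lookup_proj gr_def)
  have w: "phi q (?p (wd w)) = ?p (phi q (wd w))" for w
    unfolding p[OF phi_gr] p[OF wd_gr] by simp
  show ?thesis
    by (induction v rule: word_induct)
       (simp_all add: w PMP.linear_add[OF lp] PMP.linear_scale[OF lp])
qed

lemma proj_sum: "(\<Sum>d\<in>dg ` Poly_Mapping.keys v. proj (\<lambda>w. dg w = d) v) = v"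
proof (rule poly_mapping_eqI)
  fix w
  have "lu (\<Sum>d\<in>dg ` Poly_Mapping.keys v. proj (\<lambda>w. dg w = d) v) w =
     (\<Sum>d\<in>dg ` Poly_Mapping.keys v. if d = dg w then lu v w else 0)"
    by (simp add: lookup_sum lookup_proj eq_commute)
  also have "\<dots> = lu v w" by (auto simp: in_keys_iff)
  finally show "lu (\<Sum>d\<in>dg ` Poly_Mapping.keys v. proj (\<lambda>w. dg w = d) v) w = lu v w" .
qed

context qnz begin

lemma Vlen_image:
  assumes "lin f" "\<And>w. length w < n \<Longrightarrow> f (wd w) \<in> Vlen m" "v \<in> Vlen n"
  shows "f v \<in> Vlen m"
proof (rule lin_image_subspace[OF assms(1) subspace_Vlen])
  fix w assume "lu v w \<noteq> 0"
  then have "length w < n" using assms(3) by (simp add: Vlen_def)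
  then show "f (wd w) \<in> Vlen m" by (rule assms(2))
qed

lemma rv_Vlen: "v \<in> Vlen n \<Longrightarrow> rv v \<in> Vlen n"
  by (rule Vlen_image[OF lin_ops(2)]) (simp_all add: wd_Vlen)

lemma tw_Vlen: "v \<in> Vlen n \<Longrightarrow> tw q a v \<in> Vlen n"
  by (rule Vlen_image[OF lin_ops(1)]) (simp_all add: wd_Vlen PM.subspace_scale[OF subspace_Vlen])

lemma gen_mult_Vlen: "v \<in> Vlen n \<Longrightarrow> gen a * v \<in> Vlen (Suc n)"
  by (rule Vlen_image[of "(*) (gen a)" n]) (auto intro!: linI wd_Vlen simp: distrib_left)

lemma dl_Vlen: "v \<in> Vlen (Suc n) \<Longrightarrow> dl q a v \<in> Vlen n"
proof (rule Vlen_image[OF lin_ops(7)])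
  fix w :: "letter list" assume "length w < Suc n"
  then show "dl q a (wd w) \<in> Vlen n"
  proof (induction w arbitrary: n)
    case (Cons b w)
    then obtain m where m: "n = Suc m" "length w < Suc m" by (cases n) auto
    show ?case
      using gen_mult_Vlen[OF Cons.IH[OF m(2)], of b] m
      unfolding wd_Cons dl_gen_mult
      by (auto intro!: PM.subspace_add[OF subspace_Vlen] PM.subspace_scale[OF subspace_Vlen] wd_Vlen
          PM.subspace_0[OF subspace_Vlen])
  qed (auto simp: PM.subspace_0[OF subspace_Vlen])
qed

lemma dr_Vlen: "v \<in> Vlen (Suc n) \<Longrightarrow> dr q a v \<in> Vlen n"
  by (simp add: dr_def rv_Vlen dl_Vlen)

text \<open>The skew derivatives of \<open>x\<close> are shorter and lie in \<open>J q\<close> by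
  hypothesis. The antipode then forces a nonzero weight, and \<open>positive_weight_radical\<close>
  applies to one of the letters.\<close>

lemma graded_ker:
  assumes IH: "\<And>v. v \<in> Vlen n \<Longrightarrow> phi q v = 0 \<Longrightarrow> v \<in> J q"
    and x: "x \<in> gr (n, k)" "phi q x = 0" and n: "n > 0"
  shows "x \<in> J q"
proof (rule ccontr)
  assume nJ: "x \<notin> J q"
  have len: "length w = n" "wt LA w = k" if "lu x w \<noteq> 0" for w
    using x(1) that by (auto simp: gr_def dg_def)
  then have xV: "x \<in> Vlen (Suc n)" by (fastforce simp: Vlen_def)
  have dl: "dl q a x \<in> J q" and dr: "dr q a x \<in> J q" for a
    by (rule IH, rule dl_Vlen dr_Vlen, rule xV, simp add: phi_dl phi_dr x)+
  have "x \<noteq> 0" using nJ by auto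
  then obtain w where w: "lu x w \<noteq> 0" by (metis poly_mapping_eqI lookup_zero)
  \<comment> \<open>One exponent serves all words of \<open>x\<close>, by homogeneity and
    \<open>ew_eq\<close>.\<close>
  define e where "e = ew w"
  have e: "ew w' = e" if "lu x w' \<noteq> 0" for w'
    using ew_eq[of w'] ew_eq[of w] len[OF that] len[OF w] by (simp add: e_def)
  define s where "s = (-1) ^ n * q powi e"
  have "anti q x = sm s (rv x)"
    unfolding anti_def rv_def lin_ext_def PM.scale_sum_right
    by (rule sum.cong) (auto simp: in_keys_iff e len s_def mult_ac)
  then have a: "sm s (rv x) + x \<in> J q"
    using anti_radical[OF IH n _ x(2)] len(1) by simp
  \<comment> \<open>Combining the relation with its own reversal eliminates
    \<open>rv x\<close>.\<close>
  have "(sm s (rv x) + x) - sm s (rv (sm s (rv x) + x)) \<in> J q"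
    by (intro J_closed rv_J a)
  then have "sm (1 - s * s) x \<in> J q"
    by (simp add: sm_simps PM.scale_left_diff_distrib)
  then have "sm (inverse (1 - s * s)) (sm (1 - s * s) x) \<in> J q" by (rule J_closed)
  then have "1 - s * s = 0" using nJ by (cases "1 - s * s = 0") auto
  moreover have "s * s = q powi (2 * e)"
  proof -
    have "s * s = ((-1) ^ n * (-1) ^ n) * (q powi e * q powi e)" by (simp only: s_def mult_ac)
    also have "\<dots> = q powi e * q powi e" by (simp flip: power_mult_distrib)
    also have "\<dots> = q powi (e + e)" by (rule power_int_add[symmetric]) simp
    finally show ?thesis by (simp only: mult_2)
  qed
  ultimately have qe: "q powi (2 * e) = 1" by simp
  have "e = 0"
  proof (rule ccontr)
    assume "e \<noteq> 0"
    then have "nat \<bar>2 * e\<bar> > 0" by simp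
    moreover have "q ^ nat \<bar>2 * e\<bar> = 1"
      using qe by (cases "e \<ge> 0") (auto simp: power_int_def power_inverse)
    ultimately show False using q_root by blast
  qed
  \<comment> \<open>With \<open>k = 2 (r - s)\<close> and \<open>n = r + s\<close> this is
    \<open>(r - s)^2 = r + s\<close>.\<close>
  then have "k^2 = 4 * int n" using ew_eq[of w] len[OF w] by (simp add: e_def)
  then have "k \<noteq> 0" using n by auto
  have tw: "tw q LA x = sm (q powi k) x" "tw q LB x = sm (q powi (-k)) x"
  proof -
    have "lu (tw q LA x) w' = lu (sm (q powi k) x) w'"
      "lu (tw q LB x) w' = lu (sm (q powi (-k)) x) w'" for w'
      using len(2)[of w'] wt_flip[of LA w'] by (cases "lu x w' = 0"; simp add: lookup_tw)+
    then show "tw q LA x = sm (q powi k) x" "tw q LB x = sm (q powi (-k)) x"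
      by (auto intro!: poly_mapping_eqI)
  qed
  show False
  proof (cases "k > 0")
    case True
    then have "tw q LA x = sm (q ^ nat k) x" by (simp add: tw power_int_def)
    then show False using positive_weight_radical[OF dl dr, of LA "nat k"] True nJ by simp
  next
    case False
    then have "tw q LB x = sm (q ^ nat (- k)) x" by (simp add: tw power_int_def)
    then show False using positive_weight_radical[OF dl dr, of LB "nat (- k)"] False \<open>k \<noteq> 0\<close> nJ by simp
  qed
qed

text \<open>Each homogeneous component is again in the kernel. Those of length below
  \<open>n\<close> fall under the induction hypothesis; length \<open>n\<close> is a constant if
  \<open>n = 0\<close> and is handled by \<open>graded_ker\<close> otherwise.\<close>

lemma phi_ker_Vlen: "v \<in> Vlen n \<Longrightarrow> phi q v = 0 \<Longrightarrow> v \<in> J q"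
proof (induction n arbitrary: v)
  case 0
  then have "v = 0" by (auto simp: Vlen_def intro!: poly_mapping_eqI)
  then show ?case by simp
next
  case (Suc n)
  have "proj (\<lambda>w. dg w = d) v \<in> J q" for d
  proof -
    obtain m k where d: "d = (m, k)" by (cases d)
    let ?x = "proj (\<lambda>w. dg w = d) v"
    have x: "?x \<in> gr (m, k)" by (simp add: gr_def lookup_proj d)
    have px: "phi q ?x = 0" by (simp add: phi_proj Suc.prems) (simp add: proj_def)
    consider "m < n" | "m > n" | "m = n" "n = 0" | "m = n" "n > 0" by linarith
    then show ?thesis
    proof cases
      case 1
      then have "length w < n" if "lu ?x w \<noteq> 0" for w
        using that by (simp add: lookup_proj d dg_def split: if_splits)
      then have "?x \<in> Vlen n" unfolding Vlen_def by blast
      then show ?thesis by (rule Suc.IH[OF _ px])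
    next
      case 2
      then have "?x = 0" using Suc.prems(1)
        by (intro poly_mapping_eqI) (auto simp: lookup_proj Vlen_def d dg_def)
      then show ?thesis by simp
    next
      case 3
      have "lu ?x [] = 0" using lookup_Nil_phi[of q ?x] px by simp
      then have "?x = 0" using Suc.prems(1) 3
        by (intro poly_mapping_eqI) (auto simp: lookup_proj Vlen_def d dg_def)
      then show ?thesis by simp
    next
      case 4
      then show ?thesis using graded_ker[OF Suc.IH] x px by blast
    qed
  qed
  then have "(\<Sum>d\<in>dg ` Poly_Mapping.keys v. proj (\<lambda>w. dg w = d) v) \<in> J q"
    by (intro PM.subspace_sum subspace_J)
  then show ?case by (simp only: proj_sum)
qed

lemma in_Vlen: obtains n where "(v :: 'f V) \<in> Vlen n"
proof -
  have "v \<in> Vlen (Suc (Max (length ` Poly_Mapping.keys v)))"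
    by (auto simp: Vlen_def less_Suc_eq_le in_keys_iff intro!: Max_ge)
  then show thesis by (rule that)
qed

text \<open>Hence \<open>phi q\<close> induces an isomorphism from the quotient by
  \<open>J q\<close> onto \<open>U\<close>.\<close>

theorem phi_eq_0_iff: "phi q v = 0 \<longleftrightarrow> v \<in> J q"
  using in_Vlen[of v] phi_ker_Vlen phi_J by metis

end

section \<open>Adjoints\<close>

lemma bil_superset:
  assumes "finite A" "Poly_Mapping.keys u \<subseteq> A"
  shows "bil u v = (\<Sum>w\<in>A. lu u w * lu v w)"
  unfolding bil_def using assms by (intro sum.mono_neutral_left) (auto simp: in_keys_iff)

lemma bil_simps [simp]:
  "bil (u + u') v = bil u v + bil u' v" "bil (sm c u) v = c * bil u v"
  "bil u (v + v') = bil u v + bil u v'" "bil u (sm c v) = c * bil u v"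
proof -
  let ?A = "Poly_Mapping.keys u \<union> Poly_Mapping.keys u'"
  have "Poly_Mapping.keys (u + u') \<subseteq> ?A" by (rule Poly_Mapping.keys_add)
  then show "bil (u + u') v = bil u v + bil u' v"
    by (simp add: bil_superset[of ?A] lookup_add distrib_right sum.distrib)
  have "Poly_Mapping.keys (sm c u) \<subseteq> Poly_Mapping.keys u" by (auto simp: in_keys_iff)
  then show "bil (sm c u) v = c * bil u v"
    by (simp add: bil_superset[of "Poly_Mapping.keys u"] sum_distrib_left mult_ac)
qed (simp_all add: bil_def lookup_add distrib_left sum.distrib sum_distrib_left mult_ac)

lemma bil_wd_left [simp]: "bil (wd w) v = lu v w"
  by (simp add: bil_def wd_def)

lemma bil_wd_right [simp]: "bil v (wd w) = lu v w"
  by (induction v rule: word_induct) (simp_all add: lookup_add lookup_wd)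

lemma adj_eqI:
  assumes X: "lin X" and Y: "lin Y" and XY: "\<And>u v. lu (X (wd u)) v = lu (Y (wd v)) u"
  shows "adj X = Y"
  unfolding adj_def
proof (rule the_equality)
  have bil: "bil (X u) v = bil u (Y v)" for u v
  proof (induction u rule: word_induct)
    case (wd w)
    show ?case
      by (induction v rule: word_induct)
         (simp_all add: XY PMP.linear_add[OF Y] PMP.linear_scale[OF Y] lookup_add)
  qed (simp_all add: PMP.linear_add[OF X] PMP.linear_scale[OF X])
  \<comment> \<open>Row \<open>w\<close> of \<open>Y\<close> is column \<open>w\<close> of
    \<open>X\<close>, which is finite.\<close>
  have "finite {w'. lu (Y (wd w')) w \<noteq> 0}" for w
    using finite_keys[of "X (wd w)"] by (simp add: XY[symmetric] Poly_Mapping.keys.rep_eq)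
  then show "Y \<in> EndV \<and> (\<forall>u v. bil (X u) v = bil u (Y v))"
    using bil by (simp add: EndV_def PMP.linear_add[OF Y] PMP.linear_scale[OF Y])
  fix Z assume "Z \<in> EndV \<and> (\<forall>u v. bil (X u) v = bil u (Z v))"
  then have "bil (wd w) (Z v) = bil (wd w) (Y v)" for w v using bil by metis
  then show "Z = Y" by (auto intro: poly_mapping_eqI)
qed

lemma lookup_gen_mult:
  fixes v :: "'f::field V"
  shows "lu (gen a * v) w = (case w of [] \<Rightarrow> 0 | b # w' \<Rightarrow> if a = b then lu v w' else 0)"
proof (cases w)
  case (Cons b w')
  then have "lu (gen a * v) w = lu (dL b (gen a * v)) w'" by (simp del: dL_gen_mult)
  then show ?thesis by (simp add: Cons)
qed simp

text \<open>Comparing first letters, \<open>dL_ls\<close> and \<open>dl_gen_mult\<close> give the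
  two sides the same recursion.\<close>

lemma lookup_ls_dl: "lu (ls q a (wd u)) v = lu (dl q a (wd v)) u"
proof (induction v arbitrary: u)
  case (Cons b v)
  have "lu (ls q a (wd u)) (b # v) = lu (dL b (ls q a (wd u))) v" by simp
  also have "\<dots> = lu (dl q a (wd (b # v))) u"
    unfolding dL_ls wd_Cons dl_gen_mult
    by (cases u) (auto simp: Cons lookup_add lookup_gen_mult lookup_wd pairing_commute)
  finally show ?case .
qed simp

lemma adj_L: "adj ((*) (gen a)) = dL a"
proof (rule adj_eqI)
  show "lin ((*) (gen a) :: 'a V \<Rightarrow> 'a V)" by (rule linI) (simp_all add: distrib_left)
  show "lu (gen a * wd u) v = lu (dL a (wd v)) u" for u v :: "letter list"
    unfolding lookup_dL by (simp add: lookup_wd eq_commute)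
qed (rule lin_ops)

lemma adj_R: "adj (\<lambda>v. v * gen a) = dR a"
proof (rule adj_eqI)
  show "lin (\<lambda>v :: 'a V. v * gen a)" by (rule linI) (simp_all add: distrib_right)
  show "lu (wd u * gen a) v = lu (dR a (wd v)) u" for u v :: "letter list"
    unfolding lookup_dR by (simp add: lookup_wd eq_commute)
qed (rule lin_ops)

lemma adj_ls: "adj (ls q a) = dl q a"
  by (rule adj_eqI) (simp_all add: lin_ops lookup_ls_dl)

lemma adj_rs: "adj (rs q a) = dr q a"
  by (rule adj_eqI) (simp_all add: lin_ops lookup_ls_dl rs_def dr_def lookup_rv)

lemma K_eq: "q \<noteq> 0 \<Longrightarrow> K q = tw q LA"
proof -
  assume q: "q \<noteq> 0"
  have "prod_list (map (case_letter (sm (q^2) (gen LA)) (sm (inverse q^2) (gen LB))) w) =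
      sm (q powi wt LA w) (wd w)" for w :: "letter list"
  proof (induction w)
    case (Cons a w)
    then show ?case
      by (cases a) (simp_all add: power_int_add power_int_diff q pairing_def divide_inverse power_inverse mult.commute)
  qed (simp add: one_eq_wd)
  then show ?thesis by (simp add: K_def tw_def)
qed

lemma Kinv_eq: "q \<noteq> 0 \<Longrightarrow> Kinv q = tw q LB"
  unfolding Kinv_def using tw_tw_flip[of q LA] by (intro inv_unique_comp) (auto simp: K_eq)

lemma op_eqs:
  "A_L = (*) (gen LA)" "B_L = (*) (gen LB)" "A_R = (\<lambda>v. v * gen LA)" "B_R = (\<lambda>v. v * gen LB)"
  "A_l q = ls q LA" "B_l q = ls q LB"
  by (auto simp: A_L_def B_L_def A_R_def B_R_def A_l_def B_l_def ls_def)

lemma op_eqs_r: "q \<noteq> 0 \<Longrightarrow> A_r q = rs q LA" "q \<noteq> 0 \<Longrightarrow> B_r q = rs q LB"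
  by (auto simp: A_r_def B_r_def star_gen_right)

section \<open>The box relations and irreducibility\<close>

text \<open>Crossing three \<open>x\<close> and one \<open>z\<close> gives the factor
  \<open>P^3 P' = P^2\<close>. The value of \<open>t\<close> makes the inhomogeneous terms
  cancel.\<close>

lemma serre_commute:
  fixes x y z :: "('b \<Rightarrow>\<^sub>0 'f::field) \<Rightarrow> ('b \<Rightarrow>\<^sub>0 'f)"
  assumes lin: "lin x" "lin y" "lin z" and P: "P * P' = 1" and t: "t = P + 1 + P'"
    and yx: "\<And>v. y (x v) = sm P (x (y v)) + sm (1 - P) v"
    and yz: "\<And>v. y (z v) = sm P' (z (y v)) + sm (1 - P') v"
  defines "D \<equiv> (\<lambda>v. x (x (x (z v))) - sm t (x (x (z (x v)))) + sm t (x (z (x (x v)))) - z (x (x (x v))))"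
  shows "y (D v) = sm (P * P) (D (y v))"
proof -
  note s = PMP.linear_add[OF lin(1)] PMP.linear_add[OF lin(2)] PMP.linear_add[OF lin(3)]
    PMP.linear_diff[OF lin(1)] PMP.linear_diff[OF lin(2)] PMP.linear_diff[OF lin(3)]
    PMP.linear_scale[OF lin(1)] PMP.linear_scale[OF lin(2)] PMP.linear_scale[OF lin(3)]
  have PP: "P * (P' * c) = c" "P' * (P * c) = c" "P' * P = 1" for c
    using P by (simp_all flip: mult.assoc add: mult.commute[of P'])
  show ?thesis
    unfolding D_def
    by (simp add: s yx yz, rule poly_mapping_eqI)
       (simp add: lookup_add lookup_minus t P PP algebra_simps)
qed

text \<open>Operators on \<open>\<V>\<close> that lift a module structure on the quotient by
  \<open>J q\<close>. The relations between neighbours hold on \<open>\<V>\<close> itself, while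
  \<open>common_kernel\<close> is taken modulo \<open>J q\<close>. The cubic relations are derived
  as \<open>serre_zero\<close> and \<open>serre_J\<close>.\<close>

locale box_data = qnz q for q :: "'f::field" +
  fixes x0 x1 x2 x3 :: "'f::field V \<Rightarrow> 'f V"
  assumes lin: "lin x0" "lin x1" "lin x2" "lin x3"
    and xJ: "\<And>v. v \<in> J q \<Longrightarrow> x0 v \<in> J q" "\<And>v. v \<in> J q \<Longrightarrow> x1 v \<in> J q"
      "\<And>v. v \<in> J q \<Longrightarrow> x2 v \<in> J q" "\<And>v. v \<in> J q \<Longrightarrow> x3 v \<in> J q"
    and x10: "\<And>v. x1 (x0 v) = sm (q^2) (x0 (x1 v)) + sm (1 - q^2) v"
    and x12: "\<And>v. x1 (x2 v) = sm (inverse (q^2)) (x2 (x1 v)) + sm (1 - inverse (q^2)) v"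
    and x32: "\<And>v. x3 (x2 v) = sm (q^2) (x2 (x3 v)) + sm (1 - q^2) v"
    and x30: "\<And>v. x3 (x0 v) = sm (inverse (q^2)) (x0 (x3 v)) + sm (1 - inverse (q^2)) v"
    and x1_1: "x1 1 = 0" and x3_1: "x3 1 = 0"
    and generated: "\<And>S. \<lbrakk>PM.subspace S; 1 \<in> S; \<And>v. v \<in> S \<Longrightarrow> x0 v \<in> S; \<And>v. v \<in> S \<Longrightarrow> x2 v \<in> S\<rbrakk>
      \<Longrightarrow> S = UNIV"
    and common_kernel: "\<And>v. \<lbrakk>x1 v \<in> J q; x3 v \<in> J q\<rbrakk> \<Longrightarrow> v - sm (lu v []) 1 \<in> J q"
    and lower: "\<And>n v. v \<in> Vlen (Suc n) \<Longrightarrow> x1 v \<in> Vlen n" "\<And>n v. v \<in> Vlen (Suc n) \<Longrightarrow> x3 v \<in> Vlen n"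
    and const: "\<And>v. lu (x0 v) [] = 0" "\<And>v. lu (x2 v) [] = 0"
begin

lemma lookup_J: "v \<in> J q \<Longrightarrow> lu v [] = 0"
  using lookup_Nil_phi[of q v] by (simp add: phi_J)

lemma one_notin_J: "1 \<notin> J q"
  using lookup_J[of 1] by (auto simp: one_eq_wd lookup_wd)

section \<open>The cubic relations\<close>

definition serre_map where "serre_map x z v = x (x (x (z v))) - sm (q3 q) (x (x (z (x v))))
   + sm (q3 q) (x (z (x (x v)))) - z (x (x (x v)))" for x z :: "'f V \<Rightarrow> 'f V"

lemma invert:
  fixes c :: 'f
  assumes "c \<noteq> 0" "u = sm c v + sm (1 - c) w"
  shows "v = sm (inverse c) u + sm (1 - inverse c) w"
proof -
  have "1 - inverse c + inverse c * (1 - c) = 0" using assms(1) by (simp add: algebra_simps)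
  then show ?thesis using assms by (simp add: sm_simps) (simp add: PM.scale_left_distrib[symmetric] add_ac)
qed

lemma q2i: "q^2 * inverse (q^2) = 1" "inverse (q^2) * q^2 = 1" by simp_all

lemmas swapped = invert[OF _ x10] invert[OF _ x12] invert[OF _ x32] invert[OF _ x30]

lemma x01: "x0 (x1 v) = sm (inverse (q^2)) (x1 (x0 v)) + sm (1 - inverse (q^2)) v"
  and x21: "x2 (x1 v) = sm (q^2) (x1 (x2 v)) + sm (1 - q^2) v"
  and x23: "x2 (x3 v) = sm (inverse (q^2)) (x3 (x2 v)) + sm (1 - inverse (q^2)) v"
  and x03: "x0 (x3 v) = sm (q^2) (x3 (x0 v)) + sm (1 - q^2) v"
  using swapped[of v] by simp_all

lemma q3': "q3 q = q^2 + 1 + inverse (q^2)" "q3 q = inverse (q^2) + 1 + q^2"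
  using q3_eq[OF q0 q2] by simp_all

text \<open>The first four rules move \<open>x0\<close> and \<open>x2\<close> past the Serre
  expressions in \<open>x1, x3\<close>; the last four do the converse.\<close>

lemmas serre_map_commute =
  serre_commute[OF lin(2) lin(1) lin(4) q2i(2) q3'(2) x01 x03, folded serre_map_def]
  serre_commute[OF lin(2) lin(3) lin(4) q2i(1) q3'(1) x21 x23, folded serre_map_def]
  serre_commute[OF lin(4) lin(1) lin(2) q2i(1) q3'(1) x03 x01, folded serre_map_def]
  serre_commute[OF lin(4) lin(3) lin(2) q2i(2) q3'(2) x23 x21, folded serre_map_def]
  serre_commute[OF lin(1) lin(2) lin(3) q2i(1) q3'(1) x10 x12, folded serre_map_def]
  serre_commute[OF lin(1) lin(4) lin(3) q2i(2) q3'(2) x30 x32, folded serre_map_def]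
  serre_commute[OF lin(3) lin(2) lin(1) q2i(2) q3'(2) x12 x10, folded serre_map_def]
  serre_commute[OF lin(3) lin(4) lin(1) q2i(1) q3'(1) x32 x30, folded serre_map_def]

lemma lin_serre_map: "lin x \<Longrightarrow> lin z \<Longrightarrow> lin (serre_map x z)"
  by (rule linI) (simp_all add: serre_map_def PMP.linear_add PMP.linear_scale sm_simps algebra_simps)

lemma kernel_step:
  assumes "y (D v) = sm (c * c) (D (y v))" "c \<noteq> 0" "lin y" "D v = 0"
  shows "D (y v) = 0"
  using assms PMP.linear_0[OF assms(3)] by (simp add: PM.scale_eq_0_iff)

text \<open>The kernel contains \<open>1\<close>, which \<open>x1\<close> and \<open>x3\<close>
  annihilate, and is stable under \<open>x0\<close> and \<open>x2\<close>, which generate everything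
  from \<open>1\<close>.\<close>

lemma serre_zero: "serre_map x1 x3 v = 0" "serre_map x3 x1 v = 0"
proof -
  have l: "x1 0 = 0" "x3 0 = 0" using lin by (simp_all add: PMP.linear_0)
  have "{v. serre_map x1 x3 v \<in> {0}} = UNIV"
  proof (rule generated)
    show "PM.subspace {v. serre_map x1 x3 v \<in> {0}}" by (rule subspace_vimage[OF lin_serre_map]) (simp_all add: lin)
    show "1 \<in> {v. serre_map x1 x3 v \<in> {0}}" by (simp add: serre_map_def x1_1 x3_1 l)
  qed (use kernel_step[of x0 "serre_map x1 x3", OF serre_map_commute(1) _ lin(1)]
        kernel_step[of x2 "serre_map x1 x3", OF serre_map_commute(2) _ lin(3)] in auto)
  then show "serre_map x1 x3 v = 0" by auto
  have "{v. serre_map x3 x1 v \<in> {0}} = UNIV"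
  proof (rule generated)
    show "PM.subspace {v. serre_map x3 x1 v \<in> {0}}" by (rule subspace_vimage[OF lin_serre_map]) (simp_all add: lin)
    show "1 \<in> {v. serre_map x3 x1 v \<in> {0}}" by (simp add: serre_map_def x1_1 x3_1 l)
  qed (use kernel_step[of x0 "serre_map x3 x1", OF serre_map_commute(3) _ lin(1)]
        kernel_step[of x2 "serre_map x3 x1", OF serre_map_commute(4) _ lin(3)] in auto)
  then show "serre_map x3 x1 v = 0" by auto
qed

text \<open>By induction on the length, \<open>x1\<close> and \<open>x3\<close> send
  \<open>D v\<close> into \<open>J q\<close>. So \<open>D v\<close> is constant modulo
  \<open>J q\<close>, and its constant term is zero.\<close>

lemma serre_J:
  assumes "D = serre_map x0 x2 \<or> D = serre_map x2 x0"
  shows "D v \<in> J q"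
proof -
  have "D v \<in> J q" if "v \<in> Vlen n" for n
    using that
  proof (induction n arbitrary: v)
    case 0
    then have "v = 0" by (auto simp: Vlen_def intro!: poly_mapping_eqI)
    moreover have "lin D" using assms lin_serre_map lin by auto
    ultimately show ?case by (simp add: PMP.linear_0)
  next
    case (Suc n)
    have IH: "D (x1 v) \<in> J q" "D (x3 v) \<in> J q"
      by (rule Suc.IH, rule lower, rule Suc.prems)+
    obtain c d where "x1 (D v) = sm c (D (x1 v))" "x3 (D v) = sm d (D (x3 v))"
      using assms serre_map_commute(5-8) by metis
    then have "x1 (D v) \<in> J q" "x3 (D v) \<in> J q" using IH by simp_all
    then have "D v - sm (lu (D v) []) 1 \<in> J q" by (rule common_kernel)
    moreover have "lu (D v) [] = 0"
      using assms by (auto simp: serre_map_def lookup_add lookup_minus const)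
    ultimately show ?case by simp
  qed
  then show ?thesis using in_Vlen[of v] by blast
qed

text \<open>An element outside \<open>J q\<close> can be shortened by \<open>x1\<close> or
  \<open>x3\<close> while it stays outside, until both send it into \<open>J q\<close>. It is then a
  nonzero constant modulo \<open>J q\<close>, and \<open>1\<close> generates everything.\<close>

lemma irreducible:
  assumes N: "PM.subspace N" "J q \<subseteq> N" "\<And>v. v \<in> N \<Longrightarrow> x0 v \<in> N" "\<And>v. v \<in> N \<Longrightarrow> x1 v \<in> N"
    "\<And>v. v \<in> N \<Longrightarrow> x2 v \<in> N" "\<And>v. v \<in> N \<Longrightarrow> x3 v \<in> N"
  shows "N = J q \<or> N = UNIV"
proof (cases "N \<subseteq> J q")
  case False
  then obtain v where v: "v \<in> N" "v \<notin> J q" by auto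
  have "1 \<in> N" if "v \<in> Vlen n" "v \<in> N" "v \<notin> J q" for n v
    using that
  proof (induction n arbitrary: v)
    case 0
    then have "v = 0" by (auto simp: Vlen_def intro!: poly_mapping_eqI)
    then show ?case using 0 by simp
  next
    case (Suc n)
    show ?case
    proof (cases "x1 v \<in> J q \<and> x3 v \<in> J q")
      case True
      then have *: "v - sm (lu v []) 1 \<in> J q" using common_kernel by blast
      then have "lu v [] \<noteq> 0" using Suc.prems by auto
      have "v - (v - sm (lu v []) 1) \<in> N"
        using PM.subspace_diff[OF N(1) Suc.prems(2)] * N(2) by blast
      then have "sm (lu v []) 1 \<in> N" by simp
      then have "sm (inverse (lu v [])) (sm (lu v []) 1) \<in> N" by (rule PM.subspace_scale[OF N(1)])
      then show ?thesis using \<open>lu v [] \<noteq> 0\<close> by simp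
    next
      case False
      then consider "x1 v \<notin> J q" | "x3 v \<notin> J q" by blast
      then show ?thesis
        by cases (rule Suc.IH, rule lower, rule Suc.prems, rule N, rule Suc.prems, assumption)+
    qed
  qed
  then have "1 \<in> N" using in_Vlen[of v] v by blast
  then show ?thesis using generated[OF N(1)] N by blast
qed (use N in blast)

end

section \<open>Rotation of words\<close>

text \<open>The hypothesis moves one letter; iterating it over \<open>u\<close> multiplies the
  factors.\<close>

lemma rotate_flip:
  fixes f :: "letter list \<Rightarrow> 'f::field V"
  assumes q: "q \<noteq> 0" and S: "PM.subspace S"
    and rot: "\<And>a w. length (a # w) = n \<Longrightarrow> f (a # w) - sm (q powi (wt a w - 2)) (f (w @ [flip a])) \<in> S"
  shows "length (u @ v) = n \<Longrightarrow>
    f (u @ v) - sm (q powi ((\<Sum>x\<leftarrow>u. wt x v) - 2 * int (length u))) (f (v @ map flip u)) \<in> S"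
proof (induction u arbitrary: v)
  case Nil
  show ?case using PM.subspace_0[OF S] by simp
next
  case (Cons a u)
  let ?c = "q powi (wt a (u @ v) - 2)"
  let ?e = "(\<Sum>x\<leftarrow>u. wt x (v @ [flip a])) - 2 * int (length u)"
  \<comment> \<open>The letters of \<open>u\<close> later cross the flipped \<open>a\<close>, which
    cancels what \<open>a\<close> paid for crossing \<open>u\<close>.\<close>
  have "(\<Sum>x\<leftarrow>u. wt x [flip a]) = - wt a u"
    using wt_flip[of a u] by (induction u) (simp_all add: pairing_commute wt_flip)
  then have e: "wt a (u @ v) - 2 + ?e = (\<Sum>x\<leftarrow>a # u. wt x v) - 2 * int (length (a # u))"
    by (simp add: sum_list_addf)
  have "f (a # (u @ v)) - sm ?c (f ((u @ v) @ [flip a])) \<in> S"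
    using Cons.prems by (intro rot) simp
  moreover have "f (u @ (v @ [flip a])) - sm (q powi ?e) (f ((v @ [flip a]) @ map flip u)) \<in> S"
    using Cons.prems by (intro Cons.IH) simp
  then have "sm ?c (f (u @ (v @ [flip a])) - sm (q powi ?e) (f ((v @ [flip a]) @ map flip u))) \<in> S"
    by (rule PM.subspace_scale[OF S])
  ultimately have "f (a # (u @ v)) - sm ?c (f ((u @ v) @ [flip a])) +
     sm ?c (f (u @ (v @ [flip a])) - sm (q powi ?e) (f ((v @ [flip a]) @ map flip u))) \<in> S"
    by (rule PM.subspace_add[OF S])
  then show ?case
    unfolding e[symmetric] using q by (simp add: sm_simps power_int_add del: wt_simps)
qed

text \<open>
  Moving all letters of a word of length \<open>n\<close> to the other end, flipped, costs the factor \<open>q\<^sup>-\<^sup>2\<^sup>n\<close>,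
  and doing it twice restores the word.
\<close>

lemma (in qnz) rotate_in_subspace:
  fixes f :: "letter list \<Rightarrow> 'f V"
  assumes S: "PM.subspace S"
    and rot: "\<And>a w. length (a # w) = n \<Longrightarrow> f (a # w) - sm (q powi (wt a w - 2)) (f (w @ [flip a])) \<in> S"
    and w: "length w = n" "w \<noteq> []"
  shows "f w \<in> S"
proof -
  define c where "c = q powi (- 2 * int n)"
  \<comment> \<open>All letters are moved, so nothing remains to be crossed and only
    \<open>-2\<close> per letter is left.\<close>
  have *: "f u - sm c (f (map flip u)) \<in> S" if "length u = n" for u
    using rotate_flip[OF q0 S rot, of n u "[]"] that by (simp add: c_def)
  have "sm c (f (map flip w) - sm c (f (map flip (map flip w)))) \<in> S"
    by (intro PM.subspace_scale[OF S] *) (simp add: w)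
  moreover have "f w - sm c (f (map flip w)) \<in> S" by (rule *) (simp add: w)
  ultimately have "(f w - sm c (f (map flip w))) + sm c (f (map flip w) - sm c (f (map flip (map flip w)))) \<in> S"
    using PM.subspace_add[OF S] by blast
  then have "sm (1 - c * c) (f w) \<in> S" by (simp add: sm_simps PM.scale_left_diff_distrib comp_def)
  then have "sm (inverse (1 - c * c)) (sm (1 - c * c) (f w)) \<in> S" by (rule PM.subspace_scale[OF S])
  moreover have "1 - c * c \<noteq> 0"
  proof
    assume "1 - c * c = 0"
    moreover have "c = inverse (q ^ (2 * n))"
      unfolding c_def by (simp add: power_int_minus power_int_def nat_mult_distrib power_inverse)
    ultimately have "q ^ (2 * n) * q ^ (2 * n) = 1" by (simp add: field_simps)
    then have "q ^ (2 * n + 2 * n) = 1" by (simp only: power_add)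
    then show False using q_root[of "2 * n + 2 * n"] w by auto
  qed
  ultimately show ?thesis by simp
qed

section \<open>The modules on the quotient\<close>

context qnz begin

text \<open>
  The maps \<open>x\<^sub>1\<close> of module I and \<open>x\<^sub>0\<close> of module II for \<open>a = LA\<close>; \<open>a = LB\<close> gives \<open>x\<^sub>3\<close> and \<open>x\<^sub>2\<close>.
\<close>

definition D1 :: "letter \<Rightarrow> 'f V \<Rightarrow> 'f V" where
  "D1 a v = sm (1 - q^2) (dl q a v - dr q (flip a) (tw q a v))"

definition L1 :: "letter \<Rightarrow> 'f V \<Rightarrow> 'f V" where
  "L1 a v = sm (1 - q^2) (gen a * v - tw q a (v * gen (flip a)))"

lemma lin_D1: "lin (D1 a)" and lin_L1: "lin (L1 a)"
  by (rule linI; simp add: D1_def L1_def sm_simps algebra_simps)+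

lemma D1_gen_same: "D1 a (gen a * v) = sm (q^2) (gen a * D1 a v) + sm (1 - q^2) v"
  by (simp add: D1_def dl_gen_mult tw_gen_mult dr_mult dr_gen sm_simps algebra_simps)

text \<open>Here the inhomogeneous term comes from the right derivation, in which the twists by
  \<open>a\<close> and \<open>flip a\<close> cancel.\<close>

lemma D1_gen_flip: "D1 a (gen (flip a) * v) =
   sm (inverse (q^2)) (gen (flip a) * D1 a v) + sm (1 - inverse (q^2)) v"
proof -
  have c: "inverse (q^2) * (1 - q^2) = inverse (q^2) - 1" by (simp add: algebra_simps)
  have "D1 a (gen (flip a) * v) =
     sm (inverse (q^2)) (gen (flip a) * D1 a v) - sm (inverse (q^2) * (1 - q^2)) v"
    using tw_tw_flip(2)[of q a v]
    by (simp add: D1_def dl_gen_mult tw_gen_mult dr_mult dr_gen sm_simps distrib_left right_diff_distrib mult_ac)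
  then show ?thesis unfolding c by (simp add: PM.scale_left_diff_distrib)
qed

lemma D1_gen: "D1 a (gen b * v) = (if a = b then sm (q^2) (gen b * D1 a v) + sm (1 - q^2) v
   else sm (inverse (q^2)) (gen b * D1 a v) + sm (1 - inverse (q^2)) v)"
  using D1_gen_same D1_gen_flip letter_flip[of b a] by auto

lemma dl_L1_same: "dl q a (L1 a v) = sm (q^2) (L1 a (dl q a v)) + sm (1 - q^2) v"
  by (simp add: L1_def dl_tw dl_mult dl_gen tw_mult sm_simps algebra_simps)

lemma dl_L1_flip: "dl q (flip a) (L1 a v) = sm (inverse (q^2)) (L1 a (dl q (flip a) v)) + sm (1 - inverse (q^2)) v"
proof -
  have c: "inverse (q^2) * (1 - q^2) = inverse (q^2) - 1" by (simp add: algebra_simps)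
  have "dl q (flip a) (L1 a v) =
    sm (inverse (q^2)) (L1 a (dl q (flip a) v)) - sm (inverse (q^2) * (1 - q^2)) v"
    using tw_tw_flip(1)[of q a v]
    by (simp add: L1_def dl_tw dl_mult dl_gen tw_mult sm_simps algebra_simps)
  then show ?thesis unfolding c by (simp add: PM.scale_left_diff_distrib)
qed

lemma dl_L1: "dl q b (L1 a v) = (if a = b then sm (q^2) (L1 a (dl q b v)) + sm (1 - q^2) v
   else sm (inverse (q^2)) (L1 a (dl q b v)) + sm (1 - inverse (q^2)) v)"
  using dl_L1_same dl_L1_flip letter_flip[of b a] by auto

section \<open>Common kernels and generation\<close>

lemma J_if_phi_const:
  assumes "\<And>w. w \<noteq> [] \<Longrightarrow> lu (phi q v) w = 0"
  shows "v - sm (lu v []) 1 \<in> J q"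
proof -
  have "phi q (v - sm (lu v []) 1) = phi q v - sm (lu v []) 1" by simp
  also have "\<dots> = 0"
  proof (rule poly_mapping_eqI)
    fix w show "lu (phi q v - sm (lu v []) 1) w = lu 0 w"
      using assms[of w] by (cases "w = []") (auto simp: lookup_minus one_eq_wd lookup_wd)
  qed
  finally show ?thesis by (simp only: phi_eq_0_iff)
qed

lemma dl_common_kernel:
  assumes "\<And>a. dl q a v \<in> J q"
  shows "v - sm (lu v []) 1 \<in> J q"
proof (rule J_if_phi_const)
  fix w :: "letter list" assume "w \<noteq> []"
  then obtain a w' where w: "w = a # w'" by (cases w) auto
  have "dL a (phi q v) = 0" using assms by (simp add: phi_dl[symmetric] phi_J)
  then show "lu (phi q v) w = 0" unfolding w lookup_dL[symmetric] by simp
qed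

text \<open>Applying \<open>phi\<close> turns the hypothesis into a relation between the
  coefficients of \<open>a # w\<close> and \<open>w @ [flip a]\<close>, and rotation forces these
  coefficients to vanish.\<close>

lemma D1_common_kernel:
  assumes "\<And>a. D1 a v \<in> J q"
  shows "v - sm (lu v []) 1 \<in> J q"
proof (rule J_if_phi_const)
  fix w :: "letter list" assume w: "w \<noteq> []"
  \<comment> \<open>Coefficients are placed on \<open>1\<close> so that the rotation lemma, stated
    for vectors, applies with the zero subspace.\<close>
  let ?f = "\<lambda>w. sm (lu (phi q v) w) (1 :: 'f V)"
  have "?f w \<in> {0}"
  proof (rule rotate_in_subspace)
    fix a w
    have "phi q (D1 a v) = 0" using assms by (simp add: phi_J)
    then have "dL a (phi q v) = dR (flip a) (tw q a (phi q v))"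
      by (simp add: D1_def phi_dl phi_dr phi_tw)
    then have "lu (dL a (phi q v)) w = lu (dR (flip a) (tw q a (phi q v))) w" by simp
    then have "lu (phi q v) (a # w) = q powi (wt a w - 2) * lu (phi q v) (w @ [flip a])"
      by (simp add: lookup_tw)
    then show "?f (a # w) - sm (q powi (wt a w - 2)) (?f (w @ [flip a])) \<in> {0}" by simp
  qed (use w in auto)
  then show "lu (phi q v) w = 0" by simp
qed

text \<open>By induction on the length, \<open>S\<close> contains \<open>L1 a (wd w')\<close>, so
  rotating a word changes it only by a scalar modulo \<open>S\<close>.\<close>

lemma L1_generates:
  assumes S: "PM.subspace S" "1 \<in> S" "\<And>a v. v \<in> S \<Longrightarrow> L1 a v \<in> S"
  shows "S = (UNIV :: 'f V set)"
proof (rule subspace_UNIV_if_words[OF S(1)])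
  fix w :: "letter list"
  show "wd w \<in> S"
  proof (induction "length w" arbitrary: w rule: less_induct)
    case less
    show ?case
    proof (cases "w = []")
      case True
      then show ?thesis using S(2) by (simp add: one_eq_wd)
    next
      case False
      show ?thesis
      proof (rule rotate_in_subspace[OF S(1) _ refl False])
        fix a :: letter and w' assume "length (a # w') = length w"
        then have "L1 a (wd w') \<in> S" by (intro S(3) less) auto
        then have "sm (inverse (1 - q^2)) (L1 a (wd w')) \<in> S" by (rule PM.subspace_scale[OF S(1)])
        moreover have "sm (inverse (1 - q^2)) (L1 a (wd w')) = wd (a # w') - sm (q powi (wt a w' - 2)) (wd (w' @ [flip a]))"
          by (simp add: L1_def)
        ultimately show "wd (a # w') - sm (q powi (wt a w' - 2)) (wd (w' @ [flip a])) \<in> S" by (simp only:)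
      qed
    qed
  qed
qed

lemma D1_J: "v \<in> J q \<Longrightarrow> D1 a v \<in> J q" and L1_J: "v \<in> J q \<Longrightarrow> L1 a v \<in> J q"
  unfolding D1_def L1_def by (intro J_closed dl_J dr_J tw_J; assumption)+

lemma D1_Vlen: "v \<in> Vlen (Suc n) \<Longrightarrow> D1 a v \<in> Vlen n"
  unfolding D1_def
  by (intro PM.subspace_scale PM.subspace_diff subspace_Vlen dl_Vlen dr_Vlen tw_Vlen)

lemma box_I: "box_data q ((*) (gen a)) (D1 a) ((*) (gen (flip a))) (D1 (flip a))"
proof (unfold_locales, goal_cases)
  \<comment> \<open>Each of the four linearity goals splits into two, so goal 19 is
    \<open>generated\<close> and goal 20 is \<open>common_kernel\<close>.\<close>
  case (19 S)
  have "gen b * v \<in> S" if "v \<in> S" for b and v :: "'f V"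
    using 19(3)[OF that] 19(4)[OF that] letter_flip[of b a] by auto
  then have "u * 1 \<in> S" for u by (rule gen_closed_mult[OF 19(1) _ 19(2)])
  then have "u \<in> S" for u by (simp only: mult_1_right)
  then show ?case by blast
next
  case (20 v)
  have "D1 b v \<in> J q" for b using 20 letter_flip[of b a] by auto
  then show ?case by (rule D1_common_kernel)
qed (simp_all add: distrib_left PMP.linear_add[OF lin_D1] PMP.linear_scale[OF lin_D1] D1_J D1_gen D1_Vlen, simp_all add: D1_def)

lemma box_II: "box_data q (L1 a) (dl q a) (L1 (flip a)) (dl q (flip a))"
proof (unfold_locales, goal_cases)
  case (19 S)
  have "L1 b v \<in> S" if "v \<in> S" for b and v :: "'f V"
    using 19(3)[OF that] 19(4)[OF that] letter_flip[of b a] by auto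
  then show ?case using 19(1,2) by (intro L1_generates)
next
  case (20 v)
  have "dl q b v \<in> J q" for b using 20 letter_flip[of b a] by auto
  then show ?case by (rule dl_common_kernel)
qed (simp_all add: PMP.linear_add[OF lin_L1] PMP.linear_scale[OF lin_L1] L1_J dl_J dl_L1 dl_Vlen, simp_all add: L1_def tw_mult lookup_minus)

end

text \<open>Reversal preserves \<open>J q\<close>, length and constant term, so conjugation by it
  gives the modules with \<open>S\<close> in their label.\<close>

lemma (in box_data) box_rv:
  "box_data q (\<lambda>v. rv (x0 (rv v))) (\<lambda>v. rv (x1 (rv v))) (\<lambda>v. rv (x2 (rv v))) (\<lambda>v. rv (x3 (rv v)))"
proof (unfold_locales, goal_cases)
  case (19 S)
  have "{v. rv v \<in> S} = UNIV"
  proof (rule generated)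
    show "PM.subspace {v. rv v \<in> S}" by (rule subspace_vimage[OF lin_ops(2) 19(1)])
    show "1 \<in> {v. rv v \<in> S}" using 19(2) by simp
    show "x0 v \<in> {v. rv v \<in> S}" if "v \<in> {v. rv v \<in> S}" for v using 19(3)[of "rv v"] that by simp
    show "x2 v \<in> {v. rv v \<in> S}" if "v \<in> {v. rv v \<in> S}" for v using 19(4)[of "rv v"] that by simp
  qed
  then have "rv (rv v) \<in> S" for v by blast
  then show ?case by auto
next
  case (20 v)
  have "x1 (rv v) \<in> J q" "x3 (rv v) \<in> J q" using 20 rv_J by fastforce+
  then have "rv v - sm (lu (rv v) []) 1 \<in> J q" by (rule common_kernel)
  then have "rv (rv v - sm (lu (rv v) []) 1) \<in> J q" by (rule rv_J)
  then show ?case by (simp add: lookup_rv)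
qed (use lin x10 x12 x32 x30 in \<open>auto intro!: linI rv_J xJ lower rv_Vlen
    simp: PMP.linear_add PMP.linear_scale x1_1 x3_1 const lookup_rv\<close>)

section \<open>Quotient algebras\<close>

lemma mem_coset: "u \<in> I +>\<^bsub>free_algebra\<^esub> v \<longleftrightarrow> u - v \<in> I"
  by (auto simp: a_r_coset_def' intro!: bexI[of _ "u - v"])

lemma coset_eq_iff:
  assumes "PM.subspace I"
  shows "I +>\<^bsub>free_algebra\<^esub> u = I +>\<^bsub>free_algebra\<^esub> v \<longleftrightarrow> u - v \<in> I"
proof
  assume "I +>\<^bsub>free_algebra\<^esub> u = I +>\<^bsub>free_algebra\<^esub> v"
  moreover have "u \<in> I +>\<^bsub>free_algebra\<^esub> u" using PM.subspace_0[OF assms] by (simp add: mem_coset)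
  ultimately show "u - v \<in> I" by (simp add: mem_coset)
next
  assume uv: "u - v \<in> I"
  have "x - u \<in> I \<longleftrightarrow> x - v \<in> I" for x
    using PM.subspace_add[OF assms _ uv, of "x - u"] PM.subspace_diff[OF assms _ uv, of "x - v"] by auto
  then show "I +>\<^bsub>free_algebra\<^esub> u = I +>\<^bsub>free_algebra\<^esub> v"
    by (auto simp: mem_coset)
qed

text \<open>All cosets in the union coincide, because \<open>f\<close> preserves
  \<open>I\<close>.\<close>

lemma union_cosets:
  assumes I: "PM.subspace I" and f: "lin f" "\<And>v. v \<in> I \<Longrightarrow> f v \<in> I"
  shows "(\<Union>x\<in>I +>\<^bsub>free_algebra\<^esub> v. I +>\<^bsub>free_algebra\<^esub> f x) = I +>\<^bsub>free_algebra\<^esub> f v"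
proof -
  have "I +>\<^bsub>free_algebra\<^esub> f x = I +>\<^bsub>free_algebra\<^esub> f v" if "x \<in> I +>\<^bsub>free_algebra\<^esub> v" for x
    using that f(2)[of "x - v"] by (simp add: mem_coset coset_eq_iff[OF I] PMP.linear_diff[OF f(1)])
  moreover have "v \<in> I +>\<^bsub>free_algebra\<^esub> v" using PM.subspace_0[OF I] by (simp add: mem_coset)
  ultimately show ?thesis by blast
qed

lemma quot_algebra_simps:
  assumes "ideal I (free_algebra :: ('f::field, 'x list \<Rightarrow>\<^sub>0 'f) module)"
  shows "carrier (quot_algebra I) = range (\<lambda>v. I +>\<^bsub>free_algebra\<^esub> v)"
    "(I +>\<^bsub>free_algebra\<^esub> u) \<oplus>\<^bsub>quot_algebra I\<^esub> (I +>\<^bsub>free_algebra\<^esub> v) = I +>\<^bsub>free_algebra\<^esub> (u + v)"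
    "(I +>\<^bsub>free_algebra\<^esub> u) \<otimes>\<^bsub>quot_algebra I\<^esub> (I +>\<^bsub>free_algebra\<^esub> v) = I +>\<^bsub>free_algebra\<^esub> (u * v)"
    "c \<odot>\<^bsub>quot_algebra I\<^esub> (I +>\<^bsub>free_algebra\<^esub> v) = I +>\<^bsub>free_algebra\<^esub> (sm c v)"
    "\<one>\<^bsub>quot_algebra I\<^esub> = I +>\<^bsub>free_algebra\<^esub> 1"
    "\<zero>\<^bsub>quot_algebra I\<^esub> = I +>\<^bsub>free_algebra\<^esub> 0"
proof -
  interpret ideal I "free_algebra :: ('f, 'x list \<Rightarrow>\<^sub>0 'f) module" by fact
  note s = ideal_subspace[OF assms]
  note d = quot_algebra_def ring.extend_def module.fields_def FactRing_def
  show "carrier (quot_algebra I) = range (\<lambda>v. I +>\<^bsub>free_algebra\<^esub> v)"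
    by (auto simp: d A_RCOSETS_def')
  show "(I +>\<^bsub>free_algebra\<^esub> u) \<oplus>\<^bsub>quot_algebra I\<^esub> (I +>\<^bsub>free_algebra\<^esub> v) = I +>\<^bsub>free_algebra\<^esub> (u + v)"
    using a_rcos_sum[of u v] by (simp add: d)
  show "(I +>\<^bsub>free_algebra\<^esub> u) \<otimes>\<^bsub>quot_algebra I\<^esub> (I +>\<^bsub>free_algebra\<^esub> v) = I +>\<^bsub>free_algebra\<^esub> (u * v)"
    using rcoset_mult_add[of u v] by (simp add: d)
  show "c \<odot>\<^bsub>quot_algebra I\<^esub> (I +>\<^bsub>free_algebra\<^esub> v) = I +>\<^bsub>free_algebra\<^esub> (sm c v)"
    using union_cosets[OF s, of "sm c" v] PM.subspace_scale[OF s] by (simp add: d PM.linear_scale_self)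
  show "\<one>\<^bsub>quot_algebra I\<^esub> = I +>\<^bsub>free_algebra\<^esub> 1" by (simp add: d)
  show "\<zero>\<^bsub>quot_algebra I\<^esub> = I +>\<^bsub>free_algebra\<^esub> 0"
    by (auto simp: d mem_coset)
qed

lemma type4_cases: obtains "i = (0::4)" | "i = 1" | "i = 2" | "i = 3"
proof (cases i)
  case (of_int z)
  then have "z = 0 \<or> z = 1 \<or> z = 2 \<or> z = 3" by auto
  then show ?thesis using of_int that by auto
qed

lemma type4_simps: "(4::4) = 0" "(5::4) = 1"
  by simp_all

section \<open>Modules over the box algebra\<close>

lemma cring_scalars: "cring (scalars :: 'f::field ring)"
proof (rule cringI)
  show "abelian_group (scalars :: 'f ring)"
  proof (rule abelian_groupI)
    fix x :: 'f
    show "\<exists>y\<in>carrier scalars. y \<oplus>\<^bsub>scalars\<^esub> x = \<zero>\<^bsub>scalars\<^esub>"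
      by (rule bexI[of _ "- x"]) (simp_all add: scalars_def)
  qed (simp_all add: scalars_def add_ac)
  show "comm_monoid (scalars :: 'f ring)"
    by (rule comm_monoidI) (simp_all add: scalars_def mult_ac)
qed (simp add: scalars_def distrib_right)

text \<open>The quotient by \<open>J q\<close> and \<open>U\<close> are treated alike, with the
  coset map and \<open>phi q\<close> in the role of \<open>\<pi>\<close>.\<close>

lemma module_if_parametrized:
  fixes W :: "('f::field, 'w, 'm) module_scheme" and \<pi> :: "'f V \<Rightarrow> 'w"
  assumes "carrier W = range \<pi>" "\<And>u v. \<pi> u \<oplus>\<^bsub>W\<^esub> \<pi> v = \<pi> (u + v)" "\<And>c v. c \<odot>\<^bsub>W\<^esub> \<pi> v = \<pi> (sm c v)"
    "\<zero>\<^bsub>W\<^esub> = \<pi> 0"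
  shows "Module.module scalars W"
proof (rule moduleI[OF cring_scalars])
  show "abelian_group W"
  proof (rule abelian_groupI)
    fix x assume "x \<in> carrier W"
    then obtain v where "x = \<pi> v" using assms by auto
    then show "\<exists>y\<in>carrier W. y \<oplus>\<^bsub>W\<^esub> x = \<zero>\<^bsub>W\<^esub>"
      using assms by (intro bexI[of _ "\<pi> (- v)"]) auto
  qed (auto simp: assms add_ac)
qed (auto simp: assms scalars_def PM.scale_left_distrib sm_simps)

lemma submodule_vimage:
  fixes W :: "('f::field, 'w, 'm) module_scheme" and \<pi> :: "'f V \<Rightarrow> 'w"
  assumes W: "carrier W = range \<pi>" "\<And>u v. \<pi> u \<oplus>\<^bsub>W\<^esub> \<pi> v = \<pi> (u + v)" "\<And>c v. c \<odot>\<^bsub>W\<^esub> \<pi> v = \<pi> (sm c v)"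
    "\<zero>\<^bsub>W\<^esub> = \<pi> 0" and N: "submodule N scalars W"
  shows "PM.subspace {v. \<pi> v \<in> N}"
proof (rule PM.subspaceI)
  interpret submodule N scalars W by fact
  show "0 \<in> {v. \<pi> v \<in> N}" using one_closed W by simp
  show "x + y \<in> {v. \<pi> v \<in> N}" if "x \<in> {v. \<pi> v \<in> N}" "y \<in> {v. \<pi> v \<in> N}" for x y
    using that m_closed[of "\<pi> x" "\<pi> y"] W by simp
  show "sm c x \<in> {v. \<pi> v \<in> N}" if "x \<in> {v. \<pi> v \<in> N}" for c x
    using that smult_closed[of c "\<pi> x"] W by (simp add: scalars_def)
qed

lemma ideal_box: "ideal (box_ideal q) free_algebra"
  unfolding box_ideal_def by (rule ring.genideal_ideal[OF ring_free_algebra]) simp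

lemmas box_simps = quot_algebra_simps[OF ideal_box, folded box_def]

section \<open>The action of the free algebra on four generators and its descent to the box
  algebra\<close>

context box_data begin

definition X :: "4 \<Rightarrow> 'f V \<Rightarrow> 'f V" where "X = quad x0 x1 x2 x3"

lemma X_simps: "X 0 = x0" "X 1 = x1" "X 2 = x2" "X 3 = x3"
  by (simp_all add: X_def quad_def fun_eq_iff)

lemma lin_X: "lin (X i)"
  by (cases i rule: type4_cases) (simp_all add: X_simps lin)

lemma X_J: "v \<in> J q \<Longrightarrow> X i v \<in> J q"
  by (cases i rule: type4_cases) (simp_all add: X_simps xJ)

definition ev :: "(4 list \<Rightarrow>\<^sub>0 'f) \<Rightarrow> 'f V \<Rightarrow> 'f V" where
  "ev a v = lin_ext (\<lambda>w. foldr X w v) a"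

lemma ev_simps [simp]:
  "ev (a + b) v = ev a v + ev b v" "ev (a - b) v = ev a v - ev b v" "ev (sm c a) v = sm c (ev a v)"
  "ev 0 v = 0" "ev 1 v = v" "ev (wd w) v = foldr X w v"
  by (simp_all add: ev_def one_eq_wd)

lemma foldr_X: "foldr X w (u + v) = foldr X w u + foldr X w v" "foldr X w (sm c v) = sm c (foldr X w v)"
  by (induction w) (simp_all add: PMP.linear_add[OF lin_X] PMP.linear_scale[OF lin_X])

lemma ev_right [simp]: "ev a (u + v) = ev a u + ev a v" "ev a (sm c v) = sm c (ev a v)"
  by (induction a rule: word_induct; simp add: foldr_X sm_simps algebra_simps)+

lemma ev_diff_right: "ev a (u - v) = ev a u - ev a v"
proof -
  have "lin (ev a)" by (rule linI) simp_all
  then show ?thesis by (rule PMP.linear_diff)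
qed

lemma ev_gen [simp]: "ev (gen i) v = X i v"
  by (simp add: gen_def)

lemma ev_mult [simp]: "ev (a * b) v = ev a (ev b v)"
proof (induction a rule: word_induct)
  case (wd w)
  show ?case by (induction b rule: word_induct) (simp_all add: distrib_left foldr_X)
qed (simp_all add: distrib_right)

lemma ev_J: "v \<in> J q \<Longrightarrow> ev a v \<in> J q"
proof (induction a rule: word_induct)
  case (wd w)
  then show ?case by (induction w) (simp_all add: X_J)
qed simp_all

lemma q_inverse: "q - inverse q \<noteq> 0"
proof
  assume "q - inverse q = 0"
  then have "q * q = 1" by (simp add: field_simps)
  then show False using q2 by (simp add: power2_eq_square)
qed

lemma box_relation:
  assumes "u = sm (q^2) w + sm (1 - q^2) v"
  shows "sm q w - sm (inverse q) u = sm (q - inverse q) v"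
proof -
  have "inverse q * (1 - q^2) = inverse q - q" "inverse q * q^2 = q"
    by (simp_all add: power2_eq_square right_diff_distrib flip: mult.assoc)
  then show ?thesis unfolding assms by (simp add: sm_simps PM.scale_left_diff_distrib)
qed

lemma ev_relation: "ev (sm (1 / (q - inverse q))
    (sm q (gen i * gen (i + 1)) - sm (inverse q) (gen (i + 1) * gen i)) - 1) v = 0"
proof -
  have "sm q (X i (X (i + 1) v)) - sm (inverse q) (X (i + 1) (X i v)) = sm (q - inverse q) v"
    using box_relation[OF x10[of v]] box_relation[OF x21[of v]] box_relation[OF x32[of v]] box_relation[OF x03[of v]]
    by (cases i rule: type4_cases) (simp_all add: type4_simps X_simps)
  then show ?thesis using q_inverse by simp
qed

text \<open>For odd \<open>i\<close> the value is zero by \<open>serre_zero\<close>; for even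
  \<open>i\<close> it is only known to lie in \<open>J q\<close>.\<close>

lemma ev_serre: "ev (serre q i (i + 2)) v \<in> J q"
proof -
  have "ev (serre q i (i + 2)) v = serre_map (X i) (X (i + 2)) v"
    by (simp add: serre_def serre_map_def power2_eq_square power3_eq_cube)
  then show ?thesis
    using serre_J[of "serre_map x0 x2" v] serre_J[of "serre_map x2 x0" v] serre_zero[of v]
    by (cases i rule: type4_cases) (simp_all add: type4_simps X_simps)
qed

text \<open>The elements that map \<open>\<V>\<close> into \<open>J q\<close> form a two-sided
  ideal, by \<open>ev_J\<close> on the left, and it contains the defining relations.\<close>

lemma ev_box_ideal: "a \<in> box_ideal q \<Longrightarrow> ev a v \<in> J q"
proof -
  let ?I = "{a. \<forall>v. ev a v \<in> J q}"
  have "ideal ?I free_algebra"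
    by (rule ideal_free_algebraI) (auto simp: ev_J intro!: PM.subspaceI)
  then have "box_ideal q \<subseteq> ?I"
    unfolding box_ideal_def
    by (rule ring.genideal_minimal[OF ring_free_algebra])
       (auto simp: ev_serre ev_relation simp del: ev_simps(2,3))
  then show "a \<in> box_ideal q \<Longrightarrow> ev a v \<in> J q" by auto
qed

theorem irreducible_box_moduleI:
  fixes W :: "('f, 'w) module" and \<pi> :: "'f V \<Rightarrow> 'w"
  assumes W: "carrier W = range \<pi>" "\<And>u v. \<pi> u \<oplus>\<^bsub>W\<^esub> \<pi> v = \<pi> (u + v)" "\<And>c v. c \<odot>\<^bsub>W\<^esub> \<pi> v = \<pi> (sm c v)"
      "\<zero>\<^bsub>W\<^esub> = \<pi> 0"
    and ker: "\<And>u v. \<pi> u = \<pi> v \<longleftrightarrow> u - v \<in> J q"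
    and T: "\<And>i v. T i (\<pi> v) = \<pi> (X i v)"
  shows "irreducible_box_module q W T"
proof -
  let ?cl = "\<lambda>a. box_ideal q +>\<^bsub>free_algebra\<^esub> a"
  note mod = module_if_parametrized[where W = W and \<pi> = \<pi>, OF W]
  \<comment> \<open>Arbitrary representatives are chosen; the fact \<open>act\<close> shows that the
    choice does not matter.\<close>
  define act where "act Y w = \<pi> (ev (SOME a. a \<in> Y) (SOME v. \<pi> v = w))" for Y w
  have act: "act (?cl a) (\<pi> v) = \<pi> (ev a v)" for a v
  proof -
    define a' where "a' = (SOME b. b \<in> ?cl a)"
    define v' where "v' = (SOME u. \<pi> u = \<pi> v)"
    have "a \<in> ?cl a" using PM.subspace_0[OF ideal_subspace[OF ideal_box]] by (simp add: mem_coset)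
    then have "a' \<in> ?cl a" unfolding a'_def by (rule someI)
    then have "ev (a' - a) v' \<in> J q" by (intro ev_box_ideal) (simp add: mem_coset)
    moreover have "\<pi> v' = \<pi> v" unfolding v'_def by (rule someI) simp
    then have "ev a (v' - v) \<in> J q" by (intro ev_J) (simp add: ker)
    ultimately have "ev (a' - a) v' + ev a (v' - v) \<in> J q" by blast
    then show ?thesis by (simp add: act_def a'_def v'_def ker ev_diff_right)
  qed
  have "algebra_module scalars W (box q) act"
    by (intro algebra_module.intro mod algebra_module_axioms.intro)
       (auto simp: box_simps W act)
  then have "box_action q W T act"
    by (auto simp: box_action_def box_gen_def W act T)
  moreover have "irreducible_algebra_module scalars W (box q) act'" if "box_action q W T act'" for act'
    unfolding irreducible_algebra_module_def
  proof (intro conjI allI impI)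
    show "algebra_module scalars W (box q) act'" using that by (simp add: box_action_def)
    have "\<pi> 1 \<noteq> \<pi> 0" using one_notin_J by (simp add: ker)
    then show "carrier W \<noteq> {\<zero>\<^bsub>W\<^esub>}" by (auto simp: W)
    fix N assume N: "submodule N scalars W \<and> (\<forall>a\<in>carrier (box q). \<forall>w\<in>N. act' a w \<in> N)"
    have sub: "N \<subseteq> carrier W" using N by (auto simp: submodule_def subgroup_def)
    \<comment> \<open>Any admissible action is prescribed on the generators, so stability under
      \<open>T\<close> follows whichever action is given.\<close>
    have TN: "T i w \<in> N" if "w \<in> N" for i w
    proof -
      have "box_gen q i \<in> carrier (box q)" by (simp add: box_gen_def box_simps)
      then have "act' (box_gen q i) w \<in> N" using N that by blast
      then show ?thesis using \<open>box_action q W T act'\<close> sub that by (auto simp: box_action_def)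
    qed
    let ?M = "{v. \<pi> v \<in> N}"
    have s: "PM.subspace ?M"
      using N by (intro submodule_vimage[where W = W and \<pi> = \<pi>] W) simp
    have "X i v \<in> ?M" if "v \<in> ?M" for i v using TN[of "\<pi> v" i] that by (simp add: T)
    note XM = this[of _ 0, unfolded X_simps] this[of _ 1, unfolded X_simps]
      this[of _ 2, unfolded X_simps] this[of _ 3, unfolded X_simps]
    have "J q \<subseteq> ?M"
    proof
      fix v assume "v \<in> J q"
      then have "\<pi> v = \<pi> 0" by (simp add: ker)
      then show "v \<in> ?M" using PM.subspace_0[OF s] by simp
    qed
    then have "?M = J q \<or> ?M = UNIV" by (intro irreducible s XM)
    moreover have "N = \<pi> ` ?M" using sub W by auto
    moreover have "\<pi> ` J q = {\<pi> 0}" by (auto simp: ker)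
    ultimately show "N = {\<zero>\<^bsub>W\<^esub>} \<or> N = carrier W" by (auto simp: W)
  qed
  ultimately show ?thesis unfolding irreducible_box_module_def by blast
qed

theorem VJ_irreducible: "irreducible_VJ q x0 x1 x2 x3"
  unfolding irreducible_VJ_def
proof (rule irreducible_box_moduleI)
  note s = quot_algebra_simps[OF ideal_J, folded VJ_def]
  let ?\<pi> = "\<lambda>v. J q +>\<^bsub>free_algebra\<^esub> v"
  show "carrier (VJ q) = range ?\<pi>" by (rule s)
  show "\<zero>\<^bsub>VJ q\<^esub> = ?\<pi> 0" by (rule s)
  show "?\<pi> u \<oplus>\<^bsub>VJ q\<^esub> ?\<pi> v = ?\<pi> (u + v)" for u v by (rule s)
  show "c \<odot>\<^bsub>VJ q\<^esub> ?\<pi> v = ?\<pi> (sm c v)" for c v by (rule s)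
  show "?\<pi> u = ?\<pi> v \<longleftrightarrow> u - v \<in> J q" for u v by (rule coset_eq_iff[OF subspace_J])
  show "quot_map (J q) (quad x0 x1 x2 x3 i) (?\<pi> v) = ?\<pi> (X i v)" for i v
    unfolding quot_map_def X_def[symmetric] by (rule union_cosets[OF subspace_J lin_X X_J])
qed

theorem U_irreducible:
  assumes "\<And>v. y0 (phi q v) = phi q (x0 v)" "\<And>v. y1 (phi q v) = phi q (x1 v)"
    "\<And>v. y2 (phi q v) = phi q (x2 v)" "\<And>v. y3 (phi q v) = phi q (x3 v)"
  shows "irreducible_U q y0 y1 y2 y3"
  unfolding irreducible_U_def
proof (rule irreducible_box_moduleI)
  \<comment> \<open>The image of a homomorphism is a subalgebra, and each of its elements is built
    from the letters by left shuffle multiplication.\<close>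
  have "shuffle_subalgebra q hull {gen LA, gen LB} = range (phi q)"
  proof (rule hull_unique)
    show "{gen LA, gen LB} \<subseteq> range (phi q)" by (auto intro: range_eqI[where f = "phi q", OF phi_gen[symmetric]])
    show "shuffle_subalgebra q (range (phi q))"
      unfolding shuffle_subalgebra_def
      by (auto simp flip: phi_mult[OF q0] phi_simps(1,4) intro: range_eqI[where f = "phi q", OF phi_1[symmetric]])
    fix S' assume S': "{gen LA, gen LB} \<subseteq> S'" "shuffle_subalgebra q S'"
    have "phi q v \<in> S'" for v
    proof (induction v rule: gen_mult_induct)
      case (gen a v)
      have "gen a \<in> S'" using S'(1) by (cases a) auto
      then show ?case using gen S'(2) by (simp add: shuffle_subalgebra_def ls_def)
    qed (use S'(2) in \<open>auto simp: shuffle_subalgebra_def\<close>)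
    then show "range (phi q) \<subseteq> S'" by auto
  qed
  then show "carrier (U q) = range (phi q)" by (simp add: U_def)
  show "phi q u = phi q v \<longleftrightarrow> u - v \<in> J q" for u v
    using phi_eq_0_iff[of "u - v"] by simp
  show "quad y0 y1 y2 y3 i (phi q v) = phi q (X i v)" for i v
    by (cases i rule: type4_cases) (simp_all add: quad_def X_def assms)
qed (simp_all add: U_def)

end

section \<open>Mirror images and the assembly of the sixteen modules\<close>

context qnz begin

definition D1r :: "letter \<Rightarrow> 'f V \<Rightarrow> 'f V" where
  "D1r a v = sm (1 - q^2) (dr q a v - dl q (flip a) (tw q a v))"

definition L1r :: "letter \<Rightarrow> 'f V \<Rightarrow> 'f V" where
  "L1r a v = sm (1 - q^2) (v * gen a - tw q a (gen (flip a) * v))"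

lemma rv_conjugates:
  "(\<lambda>v. rv (gen a * rv v)) = (\<lambda>v. v * gen a)" "(\<lambda>v. rv (D1 a (rv v))) = D1r a"
  "(\<lambda>v. rv (L1 a (rv v))) = L1r a" "(\<lambda>v. rv (dl q a (rv v))) = dr q a"
  by (simp_all add: fun_eq_iff D1_def D1r_def L1_def L1r_def dr_def rv_mult rv_tw)

lemmas box_IS = box_data.box_rv[OF box_I, unfolded rv_conjugates]
lemmas box_IIS = box_data.box_rv[OF box_II, unfolded rv_conjugates]

lemmas phi_intertwines = phi_dl phi_dr[OF q0] phi_tw[OF q0] phi_gen_mult phi_mult_gen[OF q0]

text \<open>With \<open>a = LA\<close> these are I, IS, II and IIS; \<open>a = LB\<close> gives the
  variants with \<open>T\<close>.\<close>

lemma VJ_modules: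
  "irreducible_VJ q ((*) (gen a)) (D1 a) ((*) (gen (flip a))) (D1 (flip a))"
  "irreducible_VJ q (\<lambda>v. v * gen a) (D1r a) (\<lambda>v. v * gen (flip a)) (D1r (flip a))"
  "irreducible_VJ q (L1 a) (dl q a) (L1 (flip a)) (dl q (flip a))"
  "irreducible_VJ q (L1r a) (dr q a) (L1r (flip a)) (dr q (flip a))"
  by (rule box_data.VJ_irreducible, rule box_I box_IS box_II box_IIS)+

text \<open>The same four families carried over by \<open>phi\<close>, giving III, IIIS, IV and IVS
  and their variants with \<open>T\<close>.\<close>

lemma U_modules:
  "irreducible_U q (ls q a) (Qdiff q (dL a) (dR (flip a) \<circ> tw q a))
     (ls q (flip a)) (Qdiff q (dL (flip a)) (dR a \<circ> tw q (flip a)))"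
  "irreducible_U q (rs q a) (Qdiff q (dR a) (dL (flip a) \<circ> tw q a))
     (rs q (flip a)) (Qdiff q (dR (flip a)) (dL a \<circ> tw q (flip a)))"
  "irreducible_U q (Qdiff q (ls q a) (tw q a \<circ> rs q (flip a))) (dL a)
     (Qdiff q (ls q (flip a)) (tw q (flip a) \<circ> rs q a)) (dL (flip a))"
  "irreducible_U q (Qdiff q (rs q a) (tw q a \<circ> ls q (flip a))) (dR a)
     (Qdiff q (rs q (flip a)) (tw q (flip a) \<circ> ls q a)) (dR (flip a))"
  by (rule box_data.U_irreducible[OF box_I[of a]] box_data.U_irreducible[OF box_IS[of a]]
        box_data.U_irreducible[OF box_II[of a]] box_data.U_irreducible[OF box_IIS[of a]];
      simp add: phi_intertwines Qdiff_def D1_def D1r_def L1_def L1r_def)+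

lemma Qdiff_eqs:
  "Qdiff q (dl q a) (dr q (flip a) \<circ> tw q a) = D1 a"
  "Qdiff q (dr q a) (dl q (flip a) \<circ> tw q a) = D1r a"
  "Qdiff q ((*) (gen a)) (tw q a \<circ> (\<lambda>v. v * gen (flip a))) = L1 a"
  "Qdiff q (\<lambda>v. v * gen a) (tw q a \<circ> (*) (gen (flip a))) = L1r a"
  by (simp_all add: fun_eq_iff Qdiff_def D1_def D1r_def L1_def L1r_def)

lemmas letter_ops = op_eqs op_eqs_r[OF q0] K_eq[OF q0] Kinv_eq[OF q0] adj_L adj_R adj_ls adj_rs

end

theorem theorem14p8:
  fixes q :: "'f::field"
  assumes "q \<noteq> 0"
    and "\<And>n. n > 0 \<Longrightarrow> q ^ n \<noteq> 1"
  shows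
  "irreducible_VJ q A_L (Qdiff q (adj (A_l q)) (adj (B_r q) \<circ> K q))
     B_L (Qdiff q (adj (B_l q)) (adj (A_r q) \<circ> Kinv q)) \<and>
   irreducible_VJ q A_R (Qdiff q (adj (A_r q)) (adj (B_l q) \<circ> K q))
     B_R (Qdiff q (adj (B_r q)) (adj (A_l q) \<circ> Kinv q)) \<and>
   irreducible_VJ q B_L (Qdiff q (adj (B_l q)) (adj (A_r q) \<circ> Kinv q))
     A_L (Qdiff q (adj (A_l q)) (adj (B_r q) \<circ> K q)) \<and>
   irreducible_VJ q B_R (Qdiff q (adj (B_r q)) (adj (A_l q) \<circ> Kinv q))
     A_R (Qdiff q (adj (A_r q)) (adj (B_l q) \<circ> K q)) \<and>
   irreducible_VJ q (Qdiff q A_L (K q \<circ> B_R)) (adj (A_l q))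
     (Qdiff q B_L (Kinv q \<circ> A_R)) (adj (B_l q)) \<and>
   irreducible_VJ q (Qdiff q A_R (K q \<circ> B_L)) (adj (A_r q))
     (Qdiff q B_R (Kinv q \<circ> A_L)) (adj (B_r q)) \<and>
   irreducible_VJ q (Qdiff q B_L (Kinv q \<circ> A_R)) (adj (B_l q))
     (Qdiff q A_L (K q \<circ> B_R)) (adj (A_l q)) \<and>
   irreducible_VJ q (Qdiff q B_R (Kinv q \<circ> A_L)) (adj (B_r q))
     (Qdiff q A_R (K q \<circ> B_L)) (adj (A_r q)) \<and>
   irreducible_U q (A_l q) (Qdiff q (adj A_L) (adj B_R \<circ> K q))
     (B_l q) (Qdiff q (adj B_L) (adj A_R \<circ> Kinv q)) \<and>
   irreducible_U q (A_r q) (Qdiff q (adj A_R) (adj B_L \<circ> K q))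
     (B_r q) (Qdiff q (adj B_R) (adj A_L \<circ> Kinv q)) \<and>
   irreducible_U q (B_l q) (Qdiff q (adj B_L) (adj A_R \<circ> Kinv q))
     (A_l q) (Qdiff q (adj A_L) (adj B_R \<circ> K q)) \<and>
   irreducible_U q (B_r q) (Qdiff q (adj B_R) (adj A_L \<circ> Kinv q))
     (A_r q) (Qdiff q (adj A_R) (adj B_L \<circ> K q)) \<and>
   irreducible_U q (Qdiff q (A_l q) (K q \<circ> B_r q)) (adj A_L)
     (Qdiff q (B_l q) (Kinv q \<circ> A_r q)) (adj B_L) \<and>
   irreducible_U q (Qdiff q (A_r q) (K q \<circ> B_l q)) (adj A_R)
     (Qdiff q (B_r q) (Kinv q \<circ> A_l q)) (adj B_R) \<and>
   irreducible_U q (Qdiff q (B_l q) (Kinv q \<circ> A_r q)) (adj B_L)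
     (Qdiff q (A_l q) (K q \<circ> B_r q)) (adj A_L) \<and>
   irreducible_U q (Qdiff q (B_r q) (Kinv q \<circ> A_l q)) (adj B_R)
     (Qdiff q (A_r q) (K q \<circ> B_l q)) (adj A_R)"
proof -
  interpret qnz q by (unfold_locales) (use assms in auto)
  note Q = Qdiff_eqs[of LA, simplified] Qdiff_eqs[of LB, simplified]
  note VJ = VJ_modules[of LA, simplified] VJ_modules[of LB, simplified]
  note U = U_modules[of LA, simplified] U_modules[of LB, simplified]
  show ?thesis
    unfolding letter_ops Q by (intro conjI VJ U)
qed

end
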